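(* A surface $M\subset\mathbb{R}^3$ is a proper concircular surface if and only if one of the following conditions holds: 1) $M$ is the normal surface to a spherical curve; 2) $M$ is parallel to a conical surface.
   Context: A concircular vector field on $\mathbb{R}^3$ is a vector field $Y(p)=\mu p+v$ with constants $\mu\in\mathbb{R}$, $v\in\mathbb{R}^3$. A surface $M\subset\mathbb{R}^3$ with unit normal vector field $N$ is a concircular surface with axis $Y$ if $\lambda=\langle N,Y\rangle$ is constant along $M$; it is nontrivial if it is not an open piece of a plane or a sphere. A nontrivial concircular surface is proper if it is neither a generalized cylinder, nor a helix surface (a surface whose unit normal makes a constant angle with a fixed direction), nor a conical surface, i.e., if $\lambda\mu\neq0$. Normal surface to a spherical curve: for a unit speed curve $\delta(u)$ in a sphere, let $N_\delta(u)$ be the unit vector tangent to the sphere and orthogonal to $\delta'(u)$ (from the Darboux frame of $\delta$); the normal surface to $\delta$ is the surface parametrized by $X(u,z)=\delta(u)+z\,N_\delta(u)$. Conical surface: up to translation, a surface parametrized by $X(s,z)=z\,\beta(s)$, where $\beta$ is a curve in the unit sphere $\mathbb{S}^2(1)$; its unit normal is $N_\beta(s)$, the unit vector tangent to the sphere and orthogonal to $\beta'(s)$. A surface parallel to it is one obtained by moving each of its points a constant nonzero distance $d$ along the unit normal, i.e. $X(s,z)+d\,N_\beta(s)$.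
   Formalization: Conditions 1 and 2 are required locally (each point has a neighbourhood in M of type 1 or 2, with one common center and radius), and M is assumed nontrivial on the right-hand side too, since planes satisfy condition 2 and a connected M may mix both types. *)

theory Defs
  imports "HOL-Analysis.Analysis"
begin

text \<open>Smooth means of class \<open>C\<^sup>\<infinity>\<close>: all iterated directional derivatives exist and are
  differentiable. The domain \<open>S\<close> is meant to be open.\<close>

fun Ck_on :: "nat \<Rightarrow> 'a::euclidean_space set \<Rightarrow> ('a \<Rightarrow> 'b::euclidean_space) \<Rightarrow> bool" where
  "Ck_on 0 S f \<longleftrightarrow> continuous_on S f"
| "Ck_on (Suc k) S f \<longleftrightarrow> (\<forall>x\<in>S. f differentiable (at x)) \<and>
     (\<forall>v. Ck_on k S (\<lambda>x. frechet_derivative f (at x) v))"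

definition smooth_on :: "'a::euclidean_space set \<Rightarrow> ('a \<Rightarrow> 'b::euclidean_space) \<Rightarrow> bool" where
  "smooth_on S f \<longleftrightarrow> (\<forall>k. Ck_on k S f)"

text \<open>Connected regular (embedded) surfaces, given by local parametrizations that are smooth
  immersions and homeomorphisms onto relatively open sets.\<close>

definition surface :: "(real^3) set \<Rightarrow> bool" where
  "surface M \<longleftrightarrow> M \<noteq> {} \<and> connected M \<and>
     (\<forall>p\<in>M. \<exists>V U (\<phi> :: real \<times> real \<Rightarrow> real^3) \<psi>.
        openin (top_of_set M) V \<and> p \<in> V \<and> open U \<and> smooth_on U \<phi> \<and>
        (\<forall>x\<in>U. inj (frechet_derivative \<phi> (at x))) \<and> homeomorphism U V \<phi> \<psi>)"

definition tangent_space :: "(real^3) set \<Rightarrow> real^3 \<Rightarrow> (real^3) set" where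
  "tangent_space M p =
     {vector_derivative \<gamma> (at 0) | \<gamma> e. 0 < e \<and> smooth_on {-e<..<e} \<gamma> \<and>
        \<gamma> ` {-e<..<e} \<subseteq> M \<and> \<gamma> 0 = p}"

definition unit_normal_field :: "(real^3) set \<Rightarrow> (real^3 \<Rightarrow> real^3) \<Rightarrow> bool" where
  "unit_normal_field M N \<longleftrightarrow> continuous_on M N \<and>
     (\<forall>p\<in>M. norm (N p) = 1 \<and> (\<forall>v\<in>tangent_space M p. N p \<bullet> v = 0))"

definition concircular_field :: "real \<Rightarrow> real^3 \<Rightarrow> real^3 \<Rightarrow> real^3" where
  "concircular_field \<mu> v p = \<mu> *\<^sub>R p + v"

definition concircular_surface :: "(real^3) set \<Rightarrow> (real^3 \<Rightarrow> real^3) \<Rightarrow> real \<Rightarrow> bool" where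
  "concircular_surface M Y l \<longleftrightarrow> surface M \<and>
     (\<exists>N. unit_normal_field M N \<and> (\<forall>p\<in>M. N p \<bullet> Y p = l))"

definition nontrivial_surface :: "(real^3) set \<Rightarrow> bool" where
  "nontrivial_surface M \<longleftrightarrow>
     \<not> (\<exists>a b. a \<noteq> 0 \<and> openin (top_of_set {x. a \<bullet> x = b}) M) \<and>
     \<not> (\<exists>c r. 0 < r \<and> openin (top_of_set (sphere c r)) M)"

text \<open>Properness is the condition \<open>\<lambda>\<mu> \<noteq> 0\<close> for some axis. Axes are not unique: a circular cone
  has axes with \<open>\<lambda> = 0\<close> (centred at its vertex) as well as axes with \<open>\<lambda>\<mu> \<noteq> 0\<close>
  (centred at other points of its line of symmetry).\<close>

definition proper_concircular_surface :: "(real^3) set \<Rightarrow> bool" where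
  "proper_concircular_surface M \<longleftrightarrow> nontrivial_surface M \<and>
     (\<exists>\<mu> v l. concircular_surface M (concircular_field \<mu> v) l \<and> l * \<mu> \<noteq> 0)"

definition unit_speed_spherical_curve ::
    "real^3 \<Rightarrow> real \<Rightarrow> real set \<Rightarrow> (real \<Rightarrow> real^3) \<Rightarrow> bool" where
  "unit_speed_spherical_curve c r I \<delta> \<longleftrightarrow> 0 < r \<and> open I \<and> is_interval I \<and> smooth_on I \<delta> \<and>
     (\<forall>u\<in>I. \<delta> u \<in> sphere c r \<and> norm (vector_derivative \<delta> (at u)) = 1)"

text \<open>The unit vector tangent to the sphere \<open>sphere c r\<close> and orthogonal to \<open>\<delta>'\<close> (for a unit
  speed curve \<open>\<delta>\<close> in that sphere), unique up to sign.\<close>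

definition spherical_normal ::
    "real^3 \<Rightarrow> real \<Rightarrow> (real \<Rightarrow> real^3) \<Rightarrow> real \<Rightarrow> real^3" where
  "spherical_normal c r \<delta> u = cross3 ((1 / r) *\<^sub>R (\<delta> u - c)) (vector_derivative \<delta> (at u))"

text \<open>In both of the following definitions \<open>U\<close> is the parameter domain, so that \<open>M\<close> is an open
  piece of the complete ruled surface. They are applied to surfaces \<open>M\<close>, hence no
  regularity of the parametrization itself is demanded: a cone may contain its vertex \<open>z = 0\<close>,
  which is possible for a regular surface only if the cone is flat there.\<close>

definition normal_surface_to_spherical_curve ::
    "real^3 \<Rightarrow> real \<Rightarrow> (real^3) set \<Rightarrow> bool" where
  "normal_surface_to_spherical_curve c r M \<longleftrightarrow>
     (\<exists>I \<delta> U. unit_speed_spherical_curve c r I \<delta> \<and> open U \<and> U \<subseteq> I \<times> UNIV \<and>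
        M = (\<lambda>(u, z). \<delta> u + z *\<^sub>R spherical_normal c r \<delta> u) ` U)"

text \<open>The conical surface \<open>c + z \<beta>(s)\<close> with vertex \<open>c\<close>, moved by \<open>d\<close> along its unit normal.
  The sign of \<open>d\<close> is immaterial, since reversing \<open>\<beta>\<close> reverses the unit normal.\<close>

definition parallel_to_conical_surface ::
    "real^3 \<Rightarrow> real \<Rightarrow> (real^3) set \<Rightarrow> bool" where
  "parallel_to_conical_surface c d M \<longleftrightarrow> d \<noteq> 0 \<and>
     (\<exists>I \<beta> U. unit_speed_spherical_curve 0 1 I \<beta> \<and> open U \<and> U \<subseteq> I \<times> UNIV \<and>
        M = (\<lambda>(s, z). c + z *\<^sub>R \<beta> s + d *\<^sub>R spherical_normal 0 1 \<beta> s) ` U)"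

end

theory Submission
  imports Defs
begin

text \<open>
  Let \<open>c\<close> be the zero of the axis, \<open>Y(p) = \<mu> (p - c)\<close>. A surface is concircular with \<open>\<lambda> \<mu> \<noteq> 0\<close> iff all
  its tangent planes have the same distance \<open>r > 0\<close> from \<open>c\<close>: for the suitably oriented unit normal \<open>n\<close> along a
  parametrization \<open>\<phi>\<close>, this says \<open>n \<bullet> (\<phi> - c) = r\<close>.

  Let \<open>\<tau> = \<phi> - c - r n\<close> be the tangential part of the position vector. Differentiating the condition
  gives \<open>dn(v) \<bullet> \<tau> = 0\<close> for all \<open>v\<close>, and since the shape operator is self-adjoint, \<open>dn\<close> vanishes in the
  direction of \<open>\<tau>\<close>. Hence \<open>dn\<close> has rank at most one wherever \<open>\<tau> \<noteq> 0\<close>. The points with \<open>\<tau> = 0\<close> are those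
  on the sphere of radius \<open>r\<close>. On their interior \<open>dn = d\<phi> / r\<close> is injective, hence so it is on the closure
  of the interior by continuity; conversely, \<open>\<tau> = 0\<close> near each point where \<open>dn\<close> is injective. So the
  interior is open and closed in the connected surface. If it is everything, the surface is an open piece of the
  sphere, which is excluded. Otherwise it is empty, \<open>dn\<close> is nowhere injective, and so it has rank at most one everywhere. Near a point \<open>x\<close> there are
  three cases.

  \<^item> \<open>dn(x) \<noteq> 0\<close>: then \<open>c + r n\<close> has constant rank one and runs through a curve \<open>\<delta>\<close> on the sphere. As
    \<open>\<phi> - c\<close> has component \<open>r\<close> along \<open>n\<close> and none along \<open>\<delta>'\<close>, the vector \<open>\<phi> - \<delta>\<close> is a multiple of
    \<open>N\<^sub>\<delta>\<close>: a normal surface to \<open>\<delta>\<close>.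
  \<^item> \<open>dn(x) = 0\<close> and \<open>\<tau>(x) \<noteq> 0\<close>: then \<open>T = \<tau> / \<parallel>\<tau>\<parallel>\<close> has constant rank one and runs through a spherical curve
    \<open>\<beta>\<close>. As \<open>n\<close> is orthogonal to \<open>\<beta>\<close> and \<open>\<beta>'\<close>, it is \<open>\<plusminus>N\<^sub>\<beta>\<close>, and \<open>\<phi> = c + \<parallel>\<tau>\<parallel> \<beta> + r n\<close> is
    parallel to a cone.
  \<^item> \<open>dn(x) = 0\<close> and \<open>\<tau>(x) = 0\<close>: then \<open>\<tau>\<close> serves as a local coordinate system in which \<open>n\<close> is constant
    along rays. The surface is a plane near \<open>x\<close>, which is parallel to the cone over a great circle.

  Both rank-one cases rest on \<open>rank_one_factorization\<close>. The inverse function theorem provides the level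
  curves of the map; the curve itself is the restriction of the map to a line, parametrized by arc length.
  That the parameters fill an open set is invariance of domain, since \<open>\<phi>\<close> is injective.

  Conversely, in both constructions the plane spanned by the ruling and the velocity of the spherical curve is
  the tangent plane, at singular points of the parametrization by continuity along the ruling
  (\<open>ruled_surface_normal\<close>), and its distance from \<open>c\<close> is \<open>r\<close>. The requirement that the support
  function be \<open>+r\<close> selects one of the two unit normals at each point, continuously.
\<close>

section \<open>Calculus of smooth maps\<close>

lemma frechet_derivative_cong_open:
  assumes "open S" "x \<in> S" "\<And>y. y \<in> S \<Longrightarrow> f y = g y"
  shows "frechet_derivative f (at x) = frechet_derivative g (at x)"
proof -
  have "(f has_derivative D) (at x) \<longleftrightarrow> (g has_derivative D) (at x)" for D
    using assms has_derivative_transform_within_open[of f D x UNIV S g]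
      has_derivative_transform_within_open[of g D x UNIV S f] by auto
  then show ?thesis
    unfolding frechet_derivative_def by simp
qed

lemma Ck_on_cong:
  assumes "open S" "\<And>y. y \<in> S \<Longrightarrow> f y = g y" "Ck_on k S f"
  shows "Ck_on k S g"
  using assms
proof (induction k arbitrary: f g)
  case 0
  then show ?case by (simp cong: continuous_on_cong)
next
  case (Suc k)
  have "g differentiable at x" if "x \<in> S" for x
  proof -
    have "f differentiable at x" using Suc.prems(3) that by simp
    then obtain D where "(f has_derivative D) (at x)" unfolding differentiable_def by blast
    then have "(g has_derivative D) (at x)"
      by (rule has_derivative_transform_within_open[OF _ Suc.prems(1) that Suc.prems(2)])
    then show ?thesis unfolding differentiable_def by blast
  qed
  moreover have "Ck_on k S (\<lambda>x. frechet_derivative g (at x) v)" for v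
  proof (rule Suc.IH[OF Suc.prems(1)])
    show "Ck_on k S (\<lambda>x. frechet_derivative f (at x) v)" using Suc.prems by simp
    show "frechet_derivative f (at y) v = frechet_derivative g (at y) v" if "y \<in> S" for y
      using frechet_derivative_cong_open[of S y f g] Suc.prems(1,2) that by simp
  qed
  ultimately show ?case by simp
qed

lemma Ck_on_subset: "Ck_on k S f \<Longrightarrow> T \<subseteq> S \<Longrightarrow> Ck_on k T f"
proof (induction k arbitrary: f)
  case (Suc k)
  then show ?case by (auto dest!: subsetD)
qed (auto intro: continuous_on_subset)

lemma Ck_on_Suc_imp: "Ck_on (Suc k) S f \<Longrightarrow> Ck_on k S f"
proof (induction k arbitrary: f)
  case 0
  then show ?case
    by (auto intro!: continuous_at_imp_continuous_on differentiable_imp_continuous_within)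
next
  case (Suc k)
  have "f differentiable at x" if "x \<in> S" for x
    using Suc.prems that unfolding Ck_on.simps(2) by blast
  moreover have "Ck_on k S (\<lambda>x. frechet_derivative f (at x) v)" for v
  proof (rule Suc.IH)
    show "Ck_on (Suc k) S (\<lambda>x. frechet_derivative f (at x) v)"
      using Suc.prems unfolding Ck_on.simps(2)[of "Suc k"] by blast
  qed
  ultimately show ?case unfolding Ck_on.simps(2) by blast
qed

text \<open>The form in which all closure properties are proved: it suffices to exhibit the derivative.\<close>

lemma Ck_on_SucI:
  assumes "open S" "\<And>x. x \<in> S \<Longrightarrow> (f has_derivative f' x) (at x)" "\<And>v. Ck_on k S (\<lambda>x. f' x v)"
  shows "Ck_on (Suc k) S f"
proof -
  have "Ck_on k S (\<lambda>x. frechet_derivative f (at x) v)" for v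
  proof (rule Ck_on_cong[OF assms(1) _ assms(3)[of v]])
    show "f' y v = frechet_derivative f (at y) v" if "y \<in> S" for y
      using frechet_derivative_at[OF assms(2)[OF that]] by simp
  qed
  then show ?thesis using assms(2) by (auto simp: differentiable_def)
qed

lemma Ck_on_derivative:
  assumes "Ck_on (Suc k) S f" "x \<in> S"
  shows "(f has_derivative frechet_derivative f (at x)) (at x)"
  using assms frechet_derivative_works by auto

lemma Ck_on_const: "open S \<Longrightarrow> Ck_on k S (\<lambda>x. a)"
proof (induction k arbitrary: a)
  case (Suc k)
  show ?case
    by (rule Ck_on_SucI[where f'="\<lambda>x v. 0"]) (use Suc in auto)
qed auto

lemma Ck_on_ident: "open S \<Longrightarrow> Ck_on k S (\<lambda>x. x)"
proof (cases k)
  case (Suc j)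
  assume "open S"
  then show ?thesis unfolding Suc
    by (intro Ck_on_SucI[where f'="\<lambda>x v. v"] Ck_on_const) (auto intro!: has_derivative_ident)
qed auto

lemma Ck_on_linear:
  assumes L: "bounded_linear L" and S: "open S"
  shows "Ck_on k S f \<Longrightarrow> Ck_on k S (\<lambda>x. L (f x))"
proof (induction k arbitrary: f)
  case 0
  then show ?case using linear_continuous_on_compose[OF _ bounded_linear.linear[OF L]] by (simp add: o_def)
next
  case (Suc k)
  show ?case
  proof (rule Ck_on_SucI[OF S])
    show "((\<lambda>x. L (f x)) has_derivative (\<lambda>v. L (frechet_derivative f (at x) v))) (at x)" if "x \<in> S" for x
      by (rule bounded_linear.has_derivative[OF L Ck_on_derivative[OF Suc.prems that]])
    show "Ck_on k S (\<lambda>x. L (frechet_derivative f (at x) v))" for v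
      using Suc by simp
  qed
qed

lemma Ck_on_add:
  assumes S: "open S"
  shows "Ck_on k S f \<Longrightarrow> Ck_on k S g \<Longrightarrow> Ck_on k S (\<lambda>x. f x + g x)"
proof (induction k arbitrary: f g)
  case 0
  then show ?case by (auto intro: continuous_intros)
next
  case (Suc k)
  show ?case
  proof (rule Ck_on_SucI[OF S])
    show "((\<lambda>x. f x + g x) has_derivative
        (\<lambda>v. frechet_derivative f (at x) v + frechet_derivative g (at x) v)) (at x)" if "x \<in> S" for x
      by (rule has_derivative_add[OF Ck_on_derivative[OF Suc.prems(1) that] Ck_on_derivative[OF Suc.prems(2) that]])
    show "Ck_on k S (\<lambda>x. frechet_derivative f (at x) v + frechet_derivative g (at x) v)" for v
      using Suc by simp
  qed
qed

lemma Ck_on_bilinear: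
  assumes B: "bounded_bilinear B" and S: "open S"
  shows "Ck_on k S f \<Longrightarrow> Ck_on k S g \<Longrightarrow> Ck_on k S (\<lambda>x. B (f x) (g x))"
proof (induction k arbitrary: f g)
  case 0
  then show ?case by (simp add: bounded_bilinear.continuous_on[OF B])
next
  case (Suc k)
  show ?case
  proof (rule Ck_on_SucI[OF S])
    show "((\<lambda>x. B (f x) (g x)) has_derivative
        (\<lambda>v. B (f x) (frechet_derivative g (at x) v) + B (frechet_derivative f (at x) v) (g x))) (at x)"
      if "x \<in> S" for x
      by (rule bounded_bilinear.FDERIV[OF B Ck_on_derivative[OF Suc.prems(1) that] Ck_on_derivative[OF Suc.prems(2) that]])
    show "Ck_on k S (\<lambda>x. B (f x) (frechet_derivative g (at x) v) + B (frechet_derivative f (at x) v) (g x))" for v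
      using Suc.prems Ck_on_Suc_imp[OF Suc.prems(1)] Ck_on_Suc_imp[OF Suc.prems(2)]
      by (intro Ck_on_add[OF S] Suc.IH) auto
  qed
qed

lemma Ck_on_inverse:
  fixes f :: "'a::euclidean_space \<Rightarrow> real"
  assumes S: "open S"
  shows "Ck_on k S f \<Longrightarrow> (\<And>x. x \<in> S \<Longrightarrow> f x \<noteq> 0) \<Longrightarrow> Ck_on k S (\<lambda>x. inverse (f x))"
proof (induction k)
  case 0
  then show ?case by (auto intro: continuous_intros)
next
  case (Suc k)
  show ?case
  proof (rule Ck_on_SucI[OF S])
    show "((\<lambda>x. inverse (f x)) has_derivative
       (\<lambda>v. - (inverse (f x) * frechet_derivative f (at x) v * inverse (f x)))) (at x)" if "x \<in> S" for x
      by (rule Deriv.has_derivative_inverse[OF Suc.prems(2)[OF that] Ck_on_derivative[OF Suc.prems(1) that]])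
    have inv: "Ck_on k S (\<lambda>x. inverse (f x))"
      by (rule Suc.IH[OF Ck_on_Suc_imp[OF Suc.prems(1)] Suc.prems(2)])
    have der: "Ck_on k S (\<lambda>x. frechet_derivative f (at x) v)" for v
      using Suc.prems(1) by simp
    show "Ck_on k S (\<lambda>x. - (inverse (f x) * frechet_derivative f (at x) v * inverse (f x)))" for v
      by (rule Ck_on_linear[OF bounded_linear_minus[OF bounded_linear_ident] S
            Ck_on_bilinear[OF bounded_bilinear_mult S Ck_on_bilinear[OF bounded_bilinear_mult S inv der] inv]])
  qed
qed

lemma Ck_on_sqrt:
  fixes f :: "'a::euclidean_space \<Rightarrow> real"
  assumes S: "open S"
  shows "Ck_on k S f \<Longrightarrow> (\<And>x. x \<in> S \<Longrightarrow> f x > 0) \<Longrightarrow> Ck_on k S (\<lambda>x. sqrt (f x))"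
proof (induction k)
  case 0
  then show ?case by (auto intro: continuous_intros)
next
  case (Suc k)
  show ?case
  proof (rule Ck_on_SucI[OF S])
    show "((\<lambda>x. sqrt (f x)) has_derivative
       (\<lambda>v. frechet_derivative f (at x) v * (inverse 2 * inverse (sqrt (f x))))) (at x)" if "x \<in> S" for x
      using has_derivative_real_sqrt[OF Suc.prems(2)[OF that] Ck_on_derivative[OF Suc.prems(1) that]]
      by (simp add: field_simps)
    have "Ck_on k S (\<lambda>x. sqrt (f x))"
      by (rule Suc.IH[OF Ck_on_Suc_imp[OF Suc.prems(1)] Suc.prems(2)])
    then have inv: "Ck_on k S (\<lambda>x. inverse (sqrt (f x)))"
      by (rule Ck_on_inverse[OF S]) (use Suc.prems(2) in force)
    have der: "Ck_on k S (\<lambda>x. frechet_derivative f (at x) v)" for v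
      using Suc.prems(1) by simp
    show "Ck_on k S (\<lambda>x. frechet_derivative f (at x) v * (inverse 2 * inverse (sqrt (f x))))" for v
      by (rule Ck_on_bilinear[OF bounded_bilinear_mult S der
            Ck_on_bilinear[OF bounded_bilinear_mult S Ck_on_const[OF S] inv]])
  qed
qed

lemma Ck_on_affine:
  assumes "open S" and L: "bounded_linear L"
  shows "Ck_on k S f \<Longrightarrow> open T \<Longrightarrow> (\<And>t. t \<in> T \<Longrightarrow> x0 + L t \<in> S) \<Longrightarrow> Ck_on k T (\<lambda>t. f (x0 + L t))"
proof (induction k arbitrary: f)
  case 0
  then show ?case
    by (auto intro!: continuous_on_compose2[of S f] continuous_intros
        linear_continuous_on[OF L])
next
  case (Suc k)
  show ?case
  proof (rule Ck_on_SucI[OF \<open>open T\<close>])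
    show "((\<lambda>t. f (x0 + L t)) has_derivative (\<lambda>v. frechet_derivative f (at (x0 + L t)) (L v))) (at t)"
      if "t \<in> T" for t
    proof -
      have "((\<lambda>t. x0 + L t) has_derivative L) (at t)"
        using L by (auto intro!: derivative_eq_intros bounded_linear_imp_has_derivative)
      from diff_chain_at[OF this Ck_on_derivative[OF Suc.prems(1) Suc.prems(3)[OF that]]]
      show ?thesis by (simp add: o_def)
    qed
    have "Ck_on k S (\<lambda>x. frechet_derivative f (at x) (L v))" for v
      using Suc.prems(1) by simp
    then show "Ck_on k T (\<lambda>t. frechet_derivative f (at (x0 + L t)) (L v))" for v
      by (rule Suc.IH[OF _ Suc.prems(2,3)])
  qed
qed

lemma Ck_on_compose_real:
  fixes f :: "real \<Rightarrow> 'b::euclidean_space" and s :: "real \<Rightarrow> real"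
  assumes "open T"
  shows "Ck_on k S f \<Longrightarrow> Ck_on k T s \<Longrightarrow> s ` T \<subseteq> S \<Longrightarrow> Ck_on k T (\<lambda>t. f (s t))"
proof (induction k arbitrary: f)
  case 0
  then show ?case by (auto intro: continuous_on_compose2)
next
  case (Suc k)
  show ?case
  proof (rule Ck_on_SucI[OF assms])
    show "((\<lambda>t. f (s t)) has_derivative
        (\<lambda>v. frechet_derivative s (at t) v *\<^sub>R frechet_derivative f (at (s t)) 1)) (at t)" if "t \<in> T" for t
    proof -
      have st: "s t \<in> S" using Suc.prems that by auto
      have fd: "(f has_derivative frechet_derivative f (at (s t))) (at (s t))"
        by (rule Ck_on_derivative[OF Suc.prems(1) st])
      have cmul: "frechet_derivative f (at (s t)) (frechet_derivative s (at t) v)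
          = frechet_derivative s (at t) v *\<^sub>R frechet_derivative f (at (s t)) 1" for v
        using linear_cmul[OF has_derivative_linear[OF fd], of "frechet_derivative s (at t) v" 1] by simp
      show ?thesis
        using diff_chain_at[OF Ck_on_derivative[OF Suc.prems(2) that] fd]
        unfolding o_def cmul .
    qed
    show "Ck_on k T (\<lambda>t. frechet_derivative s (at t) v *\<^sub>R frechet_derivative f (at (s t)) 1)" for v
    proof (rule Ck_on_bilinear[OF bounded_bilinear_scaleR assms])
      show "Ck_on k T (\<lambda>t. frechet_derivative s (at t) v)" using Suc.prems(2) by simp
      have "Ck_on k S (\<lambda>x. frechet_derivative f (at x) 1)" using Suc.prems(1) by simp
      then show "Ck_on k T (\<lambda>t. frechet_derivative f (at (s t)) 1)"
        by (rule Suc.IH[OF _ Ck_on_Suc_imp[OF Suc.prems(2)] Suc.prems(3)])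
    qed
  qed
qed

lemma smooth_onI: "(\<And>k. Ck_on k S f) \<Longrightarrow> smooth_on S f"
  unfolding smooth_on_def by simp

lemma smooth_onD: "smooth_on S f \<Longrightarrow> Ck_on k S f"
  unfolding smooth_on_def by simp

lemma smooth_on_cong:
  assumes "open S" "\<And>y. y \<in> S \<Longrightarrow> f y = g y" "smooth_on S f"
  shows "smooth_on S g"
  by (rule smooth_onI, rule Ck_on_cong[OF assms(1,2) smooth_onD[OF assms(3)]])

lemma smooth_on_subset: "smooth_on S f \<Longrightarrow> T \<subseteq> S \<Longrightarrow> smooth_on T f"
  by (rule smooth_onI, rule Ck_on_subset[OF smooth_onD])

lemma smooth_on_const: "open S \<Longrightarrow> smooth_on S (\<lambda>x. a)"
  by (rule smooth_onI, rule Ck_on_const)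

lemma smooth_on_ident: "open S \<Longrightarrow> smooth_on S (\<lambda>x. x)"
  by (rule smooth_onI, rule Ck_on_ident)

lemma smooth_on_add: "open S \<Longrightarrow> smooth_on S f \<Longrightarrow> smooth_on S g \<Longrightarrow> smooth_on S (\<lambda>x. f x + g x)"
  by (rule smooth_onI, rule Ck_on_add[OF _ smooth_onD smooth_onD])

lemma smooth_on_linear: "bounded_linear L \<Longrightarrow> open S \<Longrightarrow> smooth_on S f \<Longrightarrow> smooth_on S (\<lambda>x. L (f x))"
  by (rule smooth_onI, rule Ck_on_linear[OF _ _ smooth_onD])

lemma smooth_on_bilinear:
  "bounded_bilinear B \<Longrightarrow> open S \<Longrightarrow> smooth_on S f \<Longrightarrow> smooth_on S g
    \<Longrightarrow> smooth_on S (\<lambda>x. B (f x) (g x))"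
  by (rule smooth_onI, rule Ck_on_bilinear[OF _ _ smooth_onD smooth_onD])

lemma smooth_on_affine:
  assumes "open S" "bounded_linear L" "smooth_on S f" "open T" "\<And>t. t \<in> T \<Longrightarrow> x0 + L t \<in> S"
  shows "smooth_on T (\<lambda>t. f (x0 + L t))"
  by (rule smooth_onI, rule Ck_on_affine[OF assms(1,2) smooth_onD[OF assms(3)] assms(4,5)])

lemma smooth_on_inverse:
  fixes f :: "'a::euclidean_space \<Rightarrow> real"
  assumes "open S" "smooth_on S f" "\<And>x. x \<in> S \<Longrightarrow> f x \<noteq> 0"
  shows "smooth_on S (\<lambda>x. inverse (f x))"
  by (rule smooth_onI, rule Ck_on_inverse[OF assms(1) smooth_onD[OF assms(2)] assms(3)])

lemmas smooth_on_scaleR = smooth_on_bilinear[OF bounded_bilinear_scaleR]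
lemmas smooth_on_inner = smooth_on_bilinear[OF bounded_bilinear_inner]

lemma smooth_on_norm:
  assumes "open S" "smooth_on S f" "\<And>x. x \<in> S \<Longrightarrow> f x \<noteq> 0"
  shows "smooth_on S (\<lambda>x. norm (f x))"
  unfolding norm_eq_sqrt_inner
proof (rule smooth_onI, rule Ck_on_sqrt[OF assms(1)])
  show "Ck_on k S (\<lambda>x. f x \<bullet> f x)" for k
    by (rule smooth_onD[OF smooth_on_inner[OF assms(1,2,2)]])
qed (use assms(3) in auto)

lemma bounded_bilinear_cross3: "bounded_bilinear cross3"
  using bilinear_cross bilinear_conv_bounded_bilinear by blast

lemmas smooth_on_cross3 = smooth_on_bilinear[OF bounded_bilinear_cross3]

lemma smooth_on_diff:
  assumes "open S" "smooth_on S f" "smooth_on S g"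
  shows "smooth_on S (\<lambda>x. f x - g x)"
  using smooth_on_add[OF assms(1,2)
      smooth_on_linear[OF bounded_linear_minus[OF bounded_linear_ident] assms(1,3)]]
  by simp

lemma smooth_on_derivative:
  "smooth_on S f \<Longrightarrow> x \<in> S \<Longrightarrow> (f has_derivative frechet_derivative f (at x)) (at x)"
  by (rule Ck_on_derivative[OF smooth_onD])

lemma smooth_on_frechet_derivative:
  assumes "smooth_on S f"
  shows "smooth_on S (\<lambda>x. frechet_derivative f (at x) v)"
proof (rule smooth_onI)
  show "Ck_on k S (\<lambda>x. frechet_derivative f (at x) v)" for k
    using smooth_onD[OF assms, of "Suc k"] by simp
qed

lemma smooth_on_imp_continuous_on: "smooth_on S f \<Longrightarrow> continuous_on S f"
  using smooth_onD[of S f 0] by simp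

lemma smooth_on_vector_derivative:
  assumes "smooth_on S f" "t \<in> S"
  shows "(f has_vector_derivative vector_derivative f (at t)) (at t)"
proof -
  have "f differentiable (at t)"
    using smooth_on_derivative[OF assms] by (rule differentiableI)
  then show ?thesis by (simp add: vector_derivative_works)
qed

lemma smooth_on_deriv_curve:
  assumes "open S" "smooth_on S f"
  shows "smooth_on S (\<lambda>t::real. vector_derivative f (at t))"
proof (rule smooth_on_cong[OF assms(1) _ smooth_on_frechet_derivative[OF assms(2), of 1]])
  show "frechet_derivative f (at t) 1 = vector_derivative f (at t)" if "t \<in> S" for t
  proof -
    have "f differentiable (at t)"
      using smooth_on_derivative[OF assms(2) that] by (rule differentiableI)
    from frechet_derivative_eq_vector_derivative[OF this] show ?thesis by simp
  qed
qed

section \<open>Symmetry of second derivatives\<close>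

lemma has_vector_derivative_along_line:
  assumes "smooth_on S f" "x + s *\<^sub>R v \<in> S"
  shows "((\<lambda>s. f (x + s *\<^sub>R v)) has_vector_derivative frechet_derivative f (at (x + s *\<^sub>R v)) v) (at s)"
proof -
  have line: "((\<lambda>s. x + s *\<^sub>R v) has_vector_derivative v) (at s)"
    by (auto intro!: derivative_eq_intros simp: has_vector_derivative_def)
  from vector_derivative_diff_chain_within[OF this has_derivative_at_withinI[OF smooth_on_derivative[OF assms]]]
  show ?thesis by (simp add: o_def)
qed

text \<open>The mean value theorem in \<open>s\<close>, then in \<open>t\<close>. Pairing with \<open>b\<close> reduces vector-valued maps to real ones.\<close>

lemma second_difference_mean_value:
  assumes f: "smooth_on S f" and h: "0 < h"
    and sub: "\<And>s t. \<lbrakk>0 \<le> s; s \<le> h; 0 \<le> t; t \<le> h\<rbrakk> \<Longrightarrow> x + s *\<^sub>R v + t *\<^sub>R w \<in> S"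
  obtains s t where "0 < s" "s < h" "0 < t" "t < h"
    "(f (x + h *\<^sub>R v + h *\<^sub>R w) - f (x + h *\<^sub>R v) - f (x + h *\<^sub>R w) + f x) \<bullet> b =
      h * (h * (frechet_derivative (\<lambda>y. frechet_derivative f (at y) v) (at (x + s *\<^sub>R v + t *\<^sub>R w)) w \<bullet> b))"
proof -
  let ?Dv = "\<lambda>y. frechet_derivative f (at y) v"
  let ?p = "\<lambda>s. (f (x + h *\<^sub>R w + s *\<^sub>R v) - f (x + s *\<^sub>R v)) \<bullet> b"
  have dp: "DERIV ?p s :> (?Dv (x + h *\<^sub>R w + s *\<^sub>R v) - ?Dv (x + s *\<^sub>R v)) \<bullet> b"
    if "0 \<le> s" "s \<le> h" for s
    unfolding has_real_derivative_iff_has_vector_derivative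
  proof (intro bounded_linear.has_vector_derivative[OF bounded_linear_inner_left]
      has_vector_derivative_diff has_vector_derivative_along_line[OF f])
    show "x + h *\<^sub>R w + s *\<^sub>R v \<in> S" using sub[of s h] that h by (simp add: algebra_simps)
    show "x + s *\<^sub>R v \<in> S" using sub[of s 0] that h by simp
  qed
  obtain s where s: "0 < s" "s < h"
    "?p h - ?p 0 = (h - 0) * ((?Dv (x + h *\<^sub>R w + s *\<^sub>R v) - ?Dv (x + s *\<^sub>R v)) \<bullet> b)"
    using MVT2[OF h dp] by blast
  let ?q = "\<lambda>t. ?Dv (x + s *\<^sub>R v + t *\<^sub>R w) \<bullet> b"
  have dq: "DERIV ?q t :> frechet_derivative ?Dv (at (x + s *\<^sub>R v + t *\<^sub>R w)) w \<bullet> b"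
    if "0 \<le> t" "t \<le> h" for t
    unfolding has_real_derivative_iff_has_vector_derivative
  proof (intro bounded_linear.has_vector_derivative[OF bounded_linear_inner_left]
      has_vector_derivative_along_line[OF smooth_on_frechet_derivative[OF f]])
    show "x + s *\<^sub>R v + t *\<^sub>R w \<in> S" using sub[of s t] that s by simp
  qed
  obtain t where t: "0 < t" "t < h"
    "?q h - ?q 0 = (h - 0) * (frechet_derivative ?Dv (at (x + s *\<^sub>R v + t *\<^sub>R w)) w \<bullet> b)"
    using MVT2[OF h dq] by blast
  show ?thesis
  proof (rule that[OF s(1,2) t(1,2)])
    have "x + h *\<^sub>R w + h *\<^sub>R v = x + h *\<^sub>R v + h *\<^sub>R w" "x + h *\<^sub>R w + s *\<^sub>R v = x + s *\<^sub>R v + h *\<^sub>R w"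
      by simp_all
    then show "(f (x + h *\<^sub>R v + h *\<^sub>R w) - f (x + h *\<^sub>R v) - f (x + h *\<^sub>R w) + f x) \<bullet> b =
      h * (h * (frechet_derivative ?Dv (at (x + s *\<^sub>R v + t *\<^sub>R w)) w \<bullet> b))"
      using s(3) t(3) by (simp add: inner_diff_left inner_add_left algebra_simps)
  qed
qed

text \<open>Both iterated derivatives are limits of the same second difference quotient.\<close>

lemma second_derivative_symmetric:
  fixes f :: "'a::euclidean_space \<Rightarrow> 'b::euclidean_space"
  assumes S: "open S" "x \<in> S" and f: "smooth_on S f"
  shows "frechet_derivative (\<lambda>y. frechet_derivative f (at y) v) (at x) w
       = frechet_derivative (\<lambda>y. frechet_derivative f (at y) w) (at x) v"
    (is "?P x = ?Q x")
proof -
  have "\<bar>(?P x - ?Q x) \<bullet> b\<bar> \<le> e" if e: "0 < e" for b e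
  proof -
    have "continuous_on S (\<lambda>y. ?P y \<bullet> b)" "continuous_on S (\<lambda>y. ?Q y \<bullet> b)"
      by (intro continuous_intros smooth_on_imp_continuous_on smooth_on_frechet_derivative f)+
    then have "continuous (at x) (\<lambda>y. ?P y \<bullet> b)" "continuous (at x) (\<lambda>y. ?Q y \<bullet> b)"
      using S continuous_on_eq_continuous_at by blast+
    then obtain d1 d2 where d: "0 < d1" "\<And>y. dist y x < d1 \<Longrightarrow> dist (?P y \<bullet> b) (?P x \<bullet> b) < e/2"
      "0 < d2" "\<And>y. dist y x < d2 \<Longrightarrow> dist (?Q y \<bullet> b) (?Q x \<bullet> b) < e/2"
      unfolding continuous_at_eps_delta using half_gt_zero[OF e] by (metis dist_norm)
    obtain d3 where d3: "0 < d3" "ball x d3 \<subseteq> S" using S open_contains_ball by blast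
    define r where "r = min d1 (min d2 d3)"
    have r: "0 < r" "r \<le> d1" "r \<le> d2" "r \<le> d3" using d d3 by (auto simp: r_def)
    define h where "h = r / (2 * (norm v + norm w + 1))"
    have n: "0 < norm v + norm w + 1" by (simp add: add_nonneg_pos)
    have h: "0 < h" using r n by (simp add: h_def)
    have hr: "h * (norm v + norm w + 1) = r / 2" using n by (simp add: h_def field_simps)
    have near: "dist (x + s *\<^sub>R v + t *\<^sub>R w) x < r" if st: "0 \<le> s" "s \<le> h" "0 \<le> t" "t \<le> h" for s t
    proof -
      have "norm (s *\<^sub>R v + t *\<^sub>R w) \<le> s * norm v + t * norm w"
        using norm_triangle_ineq[of "s *\<^sub>R v" "t *\<^sub>R w"] st by simp
      also have "\<dots> \<le> h * norm v + h * norm w"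
        using st by (intro add_mono mult_right_mono) auto
      also have "\<dots> \<le> r / 2"
        using hr h by (simp add: algebra_simps)
      finally show ?thesis using r by (simp add: dist_norm add.assoc)
    qed
    have sub: "x + s *\<^sub>R v + t *\<^sub>R w \<in> S" if "0 \<le> s" "s \<le> h" "0 \<le> t" "t \<le> h" for s t
      using near[OF that] d3 r by (auto simp: dist_commute subset_eq)
    have sub': "x + t *\<^sub>R w + s *\<^sub>R v \<in> S" if "0 \<le> t" "t \<le> h" "0 \<le> s" "s \<le> h" for s t
      using sub[OF that(3,4,1,2)] by (simp add: algebra_simps)
    obtain s t where st: "0 < s" "s < h" "0 < t" "t < h"
      "(f (x + h *\<^sub>R v + h *\<^sub>R w) - f (x + h *\<^sub>R v) - f (x + h *\<^sub>R w) + f x) \<bullet> b =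
        h * (h * (?P (x + s *\<^sub>R v + t *\<^sub>R w) \<bullet> b))"
      using second_difference_mean_value[OF f h sub] by blast
    obtain t' s' where st': "0 < t'" "t' < h" "0 < s'" "s' < h"
      "(f (x + h *\<^sub>R w + h *\<^sub>R v) - f (x + h *\<^sub>R w) - f (x + h *\<^sub>R v) + f x) \<bullet> b =
        h * (h * (?Q (x + t' *\<^sub>R w + s' *\<^sub>R v) \<bullet> b))"
      using second_difference_mean_value[OF f h sub'] by blast
    have eq: "f (x + h *\<^sub>R w + h *\<^sub>R v) - f (x + h *\<^sub>R w) - f (x + h *\<^sub>R v) + f x
       = f (x + h *\<^sub>R v + h *\<^sub>R w) - f (x + h *\<^sub>R v) - f (x + h *\<^sub>R w) + f x"
      by (simp add: algebra_simps)
    have "?P (x + s *\<^sub>R v + t *\<^sub>R w) \<bullet> b = ?Q (x + t' *\<^sub>R w + s' *\<^sub>R v) \<bullet> b"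
      using st(5) st'(5) h unfolding eq by simp
    moreover have "dist (?P (x + s *\<^sub>R v + t *\<^sub>R w) \<bullet> b) (?P x \<bullet> b) < e/2"
      using near[of s t] st r by (intro d(2)) auto
    moreover have swap: "x + t' *\<^sub>R w + s' *\<^sub>R v = x + s' *\<^sub>R v + t' *\<^sub>R w" by simp
    have "dist (x + t' *\<^sub>R w + s' *\<^sub>R v) x < d2"
      unfolding swap by (rule less_le_trans[OF near r(3)]) (use st' in auto)
    then have "dist (?Q (x + t' *\<^sub>R w + s' *\<^sub>R v) \<bullet> b) (?Q x \<bullet> b) < e/2"
      by (rule d(4))
    ultimately show ?thesis
      unfolding dist_real_def inner_diff_left by linarith
  qed
  then have "\<bar>(?P x - ?Q x) \<bullet> (?P x - ?Q x)\<bar> \<le> 0"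
    using field_le_epsilon[of "\<bar>(?P x - ?Q x) \<bullet> (?P x - ?Q x)\<bar>" 0] unfolding add_0_left by blast
  then show ?thesis unfolding abs_le_zero_iff inner_eq_zero_iff by simp
qed

section \<open>Linear maps on the plane\<close>

lemma linear_plane_expansion:
  fixes L :: "real \<times> real \<Rightarrow> 'b::real_vector"
  assumes "linear L"
  shows "L v = fst v *\<^sub>R L (1, 0) + snd v *\<^sub>R L (0, 1)"
proof -
  have "L (fst v *\<^sub>R (1, 0) + snd v *\<^sub>R (0, 1)) = fst v *\<^sub>R L (1, 0) + snd v *\<^sub>R L (0, 1)"
    by (simp only: linear_add[OF assms] linear_cmul[OF assms])
  then show ?thesis by simp
qed

lemma parallel_if_common_kernel:
  fixes l :: "real \<times> real \<Rightarrow> real"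
  assumes l: "linear l" and "l b \<noteq> 0" and "l a = 0" "a \<noteq> 0" "l w = 0"
  shows "\<exists>t. w = t *\<^sub>R a"
proof -
  define p q where "p = l (1, 0)" and "q = l (0, 1)"
  have eq: "l y = fst y * p + snd y * q" for y
    using linear_plane_expansion[OF l, of y] by (simp add: p_def q_def)
  have pq: "p \<noteq> 0 \<or> q \<noteq> 0" using assms(2) eq[of b] by auto
  have a: "fst a * p + snd a * q = 0" and w: "fst w * p + snd w * q = 0"
    using assms eq by auto
  have "(fst a * snd w - snd a * fst w) * p = 0"
    using a w by algebra
  moreover have "(fst a * snd w - snd a * fst w) * q = 0"
    using a w by algebra
  ultimately have det: "fst a * snd w = snd a * fst w" using pq by auto
  show ?thesis
  proof (cases "fst a = 0")
    case True
    then have "snd a \<noteq> 0" using \<open>a \<noteq> 0\<close> by (simp add: prod_eq_iff)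
    then show ?thesis using True det
      by (intro exI[of _ "snd w / snd a"]) (auto simp: prod_eq_iff)
  next
    case False
    then show ?thesis using det
      by (intro exI[of _ "fst w / fst a"]) (auto simp: prod_eq_iff field_simps)
  qed
qed

lemma linear_functional_kernel:
  fixes l :: "real \<times> real \<Rightarrow> real"
  assumes l: "linear l"
  obtains b where "b \<noteq> 0" "l b = 0"
proof (cases "l (1, 0) = 0")
  case True
  then show ?thesis using that[of "(1, 0)"] by (simp add: zero_prod_def)
next
  case False
  let ?b = "l (0, 1) *\<^sub>R (1, 0) - l (1, 0) *\<^sub>R (0, 1) :: real \<times> real"
  have "l ?b = 0" unfolding linear_diff[OF l] linear_cmul[OF l] by simp
  moreover have "?b \<noteq> 0" using False by (simp add: zero_prod_def)
  ultimately show ?thesis using that by blast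
qed

lemma kernel_iff_cross3_eq_0:
  fixes L :: "real \<times> real \<Rightarrow> real^3"
  assumes L: "linear L"
  shows "(\<exists>a. a \<noteq> 0 \<and> L a = 0) \<longleftrightarrow> cross3 (L (1, 0)) (L (0, 1)) = 0"
proof
  assume "\<exists>a. a \<noteq> 0 \<and> L a = 0"
  then obtain a where a: "a \<noteq> 0" "L a = 0" by blast
  let ?p = "L (1, 0)" and ?q = "L (0, 1)"
  have e: "fst a *\<^sub>R ?p + snd a *\<^sub>R ?q = 0" using linear_plane_expansion[OF L, of a] a(2) by simp
  have "fst a *\<^sub>R cross3 ?p ?q = cross3 (fst a *\<^sub>R ?p + snd a *\<^sub>R ?q) ?q"
    by (simp add: cross_add_left cross_mult_left)
  then have 1: "fst a *\<^sub>R cross3 ?p ?q = 0" unfolding e by simp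
  have "snd a *\<^sub>R cross3 ?p ?q = cross3 ?p (fst a *\<^sub>R ?p + snd a *\<^sub>R ?q)"
    by (simp add: cross_add_right cross_mult_right)
  then have 2: "snd a *\<^sub>R cross3 ?p ?q = 0" unfolding e by simp
  show "cross3 ?p ?q = 0" using 1 2 a(1) by (auto simp: prod_eq_iff)
next
  assume "cross3 (L (1, 0)) (L (0, 1)) = 0"
  then consider "L (1, 0) = 0" | "L (0, 1) = 0" | k where "L (0, 1) = k *\<^sub>R L (1, 0)"
    unfolding cross_eq_0 collinear_lemma by blast
  then show "\<exists>a. a \<noteq> 0 \<and> L a = 0"
  proof cases
    case 1
    then show ?thesis by (intro exI[of _ "(1, 0)"]) (simp add: zero_prod_def)
  next
    case 2
    then show ?thesis by (intro exI[of _ "(0, 1)"]) (simp add: zero_prod_def)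
  next
    case (3 k)
    then have "L (- k, 1) = 0" using linear_plane_expansion[OF L, of "(- k, 1)"] by simp
    then show ?thesis by (intro exI[of _ "(- k, 1)"]) (simp add: zero_prod_def)
  qed
qed

section \<open>Maps of rank one\<close>

lemma smooth_on_Pair:
  assumes "open S" "smooth_on S f" "smooth_on S g"
  shows "smooth_on S (\<lambda>x. (f x, g x))"
proof -
  have "smooth_on S (\<lambda>x. (f x, 0) + (0, g x))"
    by (rule smooth_on_add[OF assms(1)
          smooth_on_linear[OF bounded_linear_Pair[OF bounded_linear_ident bounded_linear_zero] assms(1,2)]
          smooth_on_linear[OF bounded_linear_Pair[OF bounded_linear_zero bounded_linear_ident] assms(1,3)]])
  then show ?thesis by simp
qed

lemma smooth_inverse_function:
  fixes G :: "'a::euclidean_space \<Rightarrow> 'a"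
  assumes U: "open U" "x0 \<in> U" and G: "smooth_on U G"
    and inj: "\<And>w. frechet_derivative G (at x0) w = 0 \<Longrightarrow> w = 0"
  obtains W V H H' where "open W" "x0 \<in> W" "W \<subseteq> U" "open V" "homeomorphism W V G H"
    "\<And>y. y \<in> V \<Longrightarrow> (H has_derivative H' y) (at y)"
    "\<And>y w. y \<in> V \<Longrightarrow> frechet_derivative G (at (H y)) (H' y w) = w"
proof -
  define G' where "G' x = Blinfun (frechet_derivative G (at x))" for x
  have bl: "bounded_linear (frechet_derivative G (at x))" if "x \<in> U" for x
    using smooth_on_derivative[OF G that] by (rule has_derivative_bounded_linear)
  have G'_app: "blinfun_apply (G' x) = frechet_derivative G (at x)" if "x \<in> U" for x
    unfolding G'_def by (rule bounded_linear_Blinfun_apply[OF bl[OF that]])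
  have cont: "continuous_on U G'"
  proof (rule continuous_on_blinfun_componentwise)
    show "continuous_on U (\<lambda>x. blinfun_apply (G' x) i)" for i
      using smooth_on_imp_continuous_on[OF smooth_on_frechet_derivative[OF G, of i]]
      by (rule continuous_on_eq) (simp add: G'_app)
  qed
  have lin: "linear (frechet_derivative G (at x0))"
    using bl[OF U(2)] bounded_linear.linear by blast
  have "inj (frechet_derivative G (at x0))"
    using linear_injective_0[OF lin] inj by blast
  then obtain L where L: "linear L" "\<And>x. L (frechet_derivative G (at x0) x) = x"
    using linear_injective_isomorphism[OF lin] by blast
  have "Blinfun L o\<^sub>L G' x0 = id_blinfun"
    by (rule blinfun_eqI)
       (simp add: G'_app[OF U(2)] L bounded_linear_Blinfun_apply linear_conv_bounded_linear[symmetric])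
  moreover have "(G has_derivative blinfun_apply (G' x)) (at x)" if "x \<in> U" for x
    using smooth_on_derivative[OF G that] G'_app[OF that] by simp
  ultimately obtain W V H H' where *: "W \<subseteq> U" "open W" "x0 \<in> W" "open V" "G x0 \<in> V" "homeomorphism W V G H"
    "\<And>y. y \<in> V \<Longrightarrow> (H has_derivative H' y) (at y)"
    "\<And>y. y \<in> V \<Longrightarrow> H' y = inv (blinfun_apply (G' (H y)))"
    "\<And>y. y \<in> V \<Longrightarrow> bij (blinfun_apply (G' (H y)))"
    using inverse_function_theorem[OF U(1) _ cont U(2)] by metis
  show ?thesis
  proof (rule that[OF *(2,3,1,4,6,7)])
    fix y w assume y: "y \<in> V"
    have "H y \<in> U" using homeomorphism_image2[OF *(6)] y *(1) by blast
    then show "frechet_derivative G (at (H y)) (H' y w) = w"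
      using *(8,9)[OF y] G'_app surj_f_inv_f[OF bij_is_surj] by metis
  qed auto
qed

text \<open>Arc length \<open>S\<close> is an antiderivative of the speed \<open>w\<close>. Its inverse satisfies \<open>\<sigma>' = 1 / w(\<sigma>)\<close>,
  and this equation raises the differentiability class of \<open>\<sigma>\<close> step by step. The passage from \<open>e\<close> to a smaller \<open>d\<close>
  provides a compact interval on which the antiderivative exists.\<close>

lemma arc_length_parametrization:
  fixes k :: "real \<Rightarrow> 'b::euclidean_space"
  assumes e: "0 < e" and k: "smooth_on {-e<..<e} k"
    and reg: "\<And>t. t \<in> {-e<..<e} \<Longrightarrow> vector_derivative k (at t) \<noteq> 0"
  obtains d I \<sigma> S where "0 < d" "d < e" "open I" "is_interval I" "smooth_on I \<sigma>" "\<sigma> ` I \<subseteq> {-d<..<d}"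
    "S ` {-d<..<d} \<subseteq> I" "\<And>t. t \<in> {-d<..<d} \<Longrightarrow> \<sigma> (S t) = t" "\<And>t. t \<in> {-d<..<d} \<Longrightarrow> S differentiable (at t)"
    "\<And>s. s \<in> I \<Longrightarrow> norm (vector_derivative (\<lambda>s. k (\<sigma> s)) (at s)) = 1"
proof -
  define w where "w t = norm (vector_derivative k (at t))" for t
  define d where "d = e / 2"
  define J where "J = {-d<..<d}"
  have d: "0 < d" "d < e" using e by (auto simp: d_def)
  have JE: "J \<subseteq> {-e<..<e}" using d by (auto simp: J_def)
  have oJ: "open J" by (simp add: J_def)
  have w: "smooth_on {-e<..<e} w" unfolding w_def
    by (intro smooth_on_norm smooth_on_deriv_curve k reg) auto
  have wpos: "w t > 0" if "t \<in> J" for t using reg[of t] that JE by (auto simp: w_def)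
  have "{-d..d} \<subseteq> {-e<..<e}" using d by auto
  then have "continuous_on {-d..d} w"
    using smooth_on_imp_continuous_on[OF w] continuous_on_subset by blast
  then obtain S where S: "\<And>t. t \<in> {-d..d} \<Longrightarrow> (S has_vector_derivative w t) (at t within {-d..d})"
    using antiderivative_continuous by blast
  have dS: "DERIV S t :> w t" if "t \<in> J" for t
  proof -
    have "(S has_vector_derivative w t) (at t within J)"
      by (rule has_vector_derivative_within_subset[OF S]) (use that in \<open>auto simp: J_def\<close>)
    then show ?thesis
      unfolding has_real_derivative_iff_has_vector_derivative at_within_open[OF that oJ] .
  qed
  have mono: "S a < S b" if "a \<in> J" "b \<in> J" "a < b" for a b
  proof (rule DERIV_pos_imp_increasing[OF that(3)])
    fix x assume "a \<le> x" "x \<le> b"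
    then have "x \<in> J" using that by (auto simp: J_def)
    then show "\<exists>y. DERIV S x :> y \<and> 0 < y" using dS[of x] wpos[of x] by auto
  qed
  have injS: "inj_on S J"
  proof (rule inj_onI)
    fix a b assume "a \<in> J" "b \<in> J" "S a = S b"
    then show "a = b" using mono[of a b] mono[of b a] by (cases a b rule: linorder_cases) auto
  qed
  have contS: "continuous_on J S"
    by (intro continuous_at_imp_continuous_on ballI DERIV_isCont[OF dS])
  define I where "I = S ` J"
  have oI: "open I" unfolding I_def
    by (rule invariance_of_domain[OF contS oJ injS])
  have "connected I" unfolding I_def
    by (rule connected_continuous_image[OF contS]) (simp add: J_def)
  then have iI: "is_interval I" by (simp add: is_interval_connected_1)
  define \<sigma> where "\<sigma> = inv_into J S"
  have \<sigma>S: "\<sigma> (S t) = t" if "t \<in> J" for t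
    using injS that by (simp add: \<sigma>_def)
  have \<sigma>J: "\<sigma> s \<in> J" if "s \<in> I" for s
    using that \<sigma>S by (auto simp: I_def)
  have d\<sigma>: "(\<sigma> has_derivative (\<lambda>v. v * inverse (w (\<sigma> s)))) (at s)" if sI: "s \<in> I" for s
  proof -
    obtain t where t: "t \<in> J" "s = S t" using sI unfolding I_def by blast
    have "(\<sigma> has_derivative (\<lambda>v. v * inverse (w t))) (at (S t))"
    proof (rule has_derivative_inverse_strong[OF oJ t(1) contS \<sigma>S])
      show "(S has_derivative (\<lambda>v. w t * v)) (at t)"
        using dS[OF t(1)] by (simp add: has_field_derivative_def)
      show "(\<lambda>v. w t * v) \<circ> (\<lambda>v. v * inverse (w t)) = id"
        using wpos[OF t(1)] by (auto simp: fun_eq_iff)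
    qed auto
    then show ?thesis unfolding t(2) \<sigma>S[OF t(1)] .
  qed
  have wi: "smooth_on J (\<lambda>t. inverse (w t))"
  proof (rule smooth_on_inverse[OF oJ smooth_on_subset[OF w JE]])
    show "w t \<noteq> 0" if "t \<in> J" for t using wpos[OF that] by simp
  qed
  have Ck\<sigma>: "Ck_on n I \<sigma>" for n
  proof (induction n)
    case 0
    show ?case unfolding Ck_on.simps(1)
      by (intro continuous_at_imp_continuous_on ballI has_derivative_continuous[OF d\<sigma>])
  next
    case (Suc n)
    have inv: "Ck_on n I (\<lambda>s. inverse (w (\<sigma> s)))"
      by (rule Ck_on_compose_real[OF oI smooth_onD[OF wi] Suc.IH]) (use \<sigma>J in auto)
    show ?case
    proof (rule Ck_on_SucI[OF oI d\<sigma>])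
      show "Ck_on n I (\<lambda>s. v * inverse (w (\<sigma> s)))" for v
        by (rule Ck_on_linear[OF bounded_linear_mult_right oI inv])
    qed
  qed
  show ?thesis
  proof (rule that[OF d oI iI, of \<sigma> S])
    show "smooth_on I \<sigma>" by (rule smooth_onI[OF Ck\<sigma>])
    show "\<sigma> ` I \<subseteq> {-d<..<d}" using \<sigma>J unfolding J_def by blast
    show "S ` {-d<..<d} \<subseteq> I" unfolding J_def I_def by (rule order_refl)
    show "\<sigma> (S t) = t" if "t \<in> {-d<..<d}" for t
      using \<sigma>S that by (simp add: J_def)
    show "S differentiable at t" if "t \<in> {-d<..<d}" for t
      unfolding real_differentiable_def using dS[of t] that by (auto simp: J_def)
    fix s assume s: "s \<in> I"
    have "\<sigma> s \<in> {-e<..<e}" using \<sigma>J[OF s] JE by blast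
    note dk = smooth_on_vector_derivative[OF k this]
    have "(\<sigma> has_vector_derivative inverse (w (\<sigma> s))) (at s)"
      using d\<sigma>[OF s] by (simp add: has_vector_derivative_def)
    from vector_diff_chain_at[OF this dk]
    have "((\<lambda>s. k (\<sigma> s)) has_vector_derivative inverse (w (\<sigma> s)) *\<^sub>R vector_derivative k (at (\<sigma> s))) (at s)"
      by (simp add: o_def)
    then have "vector_derivative (\<lambda>s. k (\<sigma> s)) (at s) = inverse (w (\<sigma> s)) *\<^sub>R vector_derivative k (at (\<sigma> s))"
      by (rule vector_derivative_at)
    then show "norm (vector_derivative (\<lambda>s. k (\<sigma> s)) (at s)) = 1"
      using wpos[OF \<sigma>J[OF s]] by (simp add: w_def)
  qed
qed

text \<open>A map of rank one is locally a curve composed with a real function. With \<open>e = Df(x0) v\<close>, the function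
  \<open>f \<bullet> e\<close> together with a linear function constant along \<open>v\<close> forms local coordinates, and \<open>f\<close> depends
  on the first of them only. So every value near \<open>f x0\<close> is already attained on the line
  \<open>x0 + a v\<close>, and the restriction of \<open>f\<close> to this line, parametrized by arc length, is the curve. The last conclusion says that the velocity of the
  curve is a value of \<open>Df(x)\<close>, so that it inherits every orthogonality relation of \<open>Df(x)\<close>.\<close>

lemma rank_one_factorization:
  fixes f :: "real \<times> real \<Rightarrow> 'b::euclidean_space"
  assumes U: "open U" "x0 \<in> U" and f: "smooth_on U f"
    and rank: "\<And>x. x \<in> U \<Longrightarrow> \<exists>a. a \<noteq> 0 \<and> frechet_derivative f (at x) a = 0"
    and v: "frechet_derivative f (at x0) v \<noteq> 0"
  obtains W I \<delta> u where "open W" "x0 \<in> W" "W \<subseteq> U" "open I" "is_interval I" "smooth_on I \<delta>"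
    "\<And>s. s \<in> I \<Longrightarrow> norm (vector_derivative \<delta> (at s)) = 1" "\<delta> ` I \<subseteq> f ` U"
    "continuous_on W u" "u ` W \<subseteq> I" "\<And>x. x \<in> W \<Longrightarrow> f x = \<delta> (u x)"
    "\<And>x. x \<in> W \<Longrightarrow> \<exists>w. vector_derivative \<delta> (at (u x)) = frechet_derivative f (at x) w"
proof -
  define D where "D x = frechet_derivative f (at x)" for x
  have dD: "(f has_derivative D x) (at x)" if "x \<in> U" for x
    unfolding D_def by (rule smooth_on_derivative[OF f that])
  have linD: "linear (D x)" if "x \<in> U" for x
    using dD[OF that] by (rule has_derivative_linear)
  define e where "e = D x0 v"
  have e: "e \<noteq> 0" using v by (simp add: e_def D_def)
  have v0: "v \<noteq> 0" using e linear_0[OF linD[OF U(2)]] by (auto simp: e_def)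
  \<comment> \<open>\<open>j\<close> is \<open>v\<close> turned by a right angle.\<close>
  define j where "j = (- snd v, fst v)"
  have jv: "v \<bullet> j = 0" by (simp add: j_def inner_prod_def)
  have jj: "j \<bullet> j \<noteq> 0" using v0 by (auto simp: j_def prod_eq_iff)
  have linj: "linear (\<lambda>y. y \<bullet> j)"
    by (rule bounded_linear.linear[OF bounded_linear_inner_left])
  define G where "G x = (f x \<bullet> e, x \<bullet> j)" for x
  have G: "smooth_on U G" unfolding G_def
    by (rule smooth_on_Pair[OF U(1) smooth_on_linear[OF bounded_linear_inner_left U(1) f]
          smooth_on_linear[OF bounded_linear_inner_left U(1) smooth_on_ident[OF U(1)]]])
  have dG: "frechet_derivative G (at x) w = (D x w \<bullet> e, w \<bullet> j)" if "x \<in> U" for x w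
  proof -
    have "(G has_derivative (\<lambda>w. (D x w \<bullet> e, w \<bullet> j))) (at x)" unfolding G_def
      by (intro has_derivative_Pair bounded_linear.has_derivative[OF bounded_linear_inner_left]
          dD that has_derivative_ident)
    from fun_cong[OF frechet_derivative_at[OF this], of w] show ?thesis by simp
  qed
  have inj: "w = 0" if "frechet_derivative G (at x0) w = 0" for w
  proof -
    have w: "D x0 w \<bullet> e = 0" "w \<bullet> j = 0"
      using that dG[OF U(2), of w] by (simp_all add: zero_prod_def)
    from parallel_if_common_kernel[OF linj jj jv v0 w(2)] obtain t where t: "w = t *\<^sub>R v" by blast
    have "t * (e \<bullet> e) = 0"
      using w(1) linear_cmul[OF linD[OF U(2)], of t v] by (simp add: t e_def)
    then show "w = 0" using e t by simp
  qed
  obtain W0 V H H' where W0: "open W0" "x0 \<in> W0" "W0 \<subseteq> U" and V: "open V"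
    and hom: "homeomorphism W0 V G H"
    and dH: "\<And>y. y \<in> V \<Longrightarrow> (H has_derivative H' y) (at y)"
    and GH': "\<And>y w. y \<in> V \<Longrightarrow> frechet_derivative G (at (H y)) (H' y w) = w"
    using smooth_inverse_function[OF U G inj] by metis
  have GV: "G x \<in> V" if "x \<in> W0" for x using homeomorphism_image1[OF hom] that by blast
  have HW: "H y \<in> W0" if "y \<in> V" for y using homeomorphism_image2[OF hom] that by blast
  have HG: "H (G x) = x" if "x \<in> W0" for x using homeomorphism_apply1[OF hom that] .
  have GH: "G (H y) = y" if "y \<in> V" for y using homeomorphism_apply2[OF hom that] .
  obtain \<rho> where \<rho>: "0 < \<rho>" "ball (G x0) \<rho> \<subseteq> V"
    using V GV[OF W0(2)] open_contains_ball by blast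
  define K where "K = ball (G x0) \<rho>"
  define b0 where "b0 = x0 \<bullet> j"
  have Gx0: "G x0 = (f x0 \<bullet> e, b0)" by (simp add: G_def b0_def)
  have KV: "y \<in> V" if "y \<in> K" for y using that \<rho> by (auto simp: K_def)
  have Kb0: "(t, b0) \<in> K" if "(t, b) \<in> K" for t b
  proof -
    have "dist (f x0 \<bullet> e) t \<le> dist (f x0 \<bullet> e, b0) (t, b)"
      using dist_fst_le[of "(f x0 \<bullet> e, b0)" "(t, b)"] by simp
    also have "\<dots> < \<rho>" using that by (simp add: K_def Gx0)
    finally show ?thesis by (simp add: K_def Gx0 dist_Pair_Pair)
  qed
  \<comment> \<open>The differential of \<open>f\<close> has the same kernel as that of \<open>f \<bullet> e\<close>, so \<open>f\<close> is constant along
    the level curves of \<open>f \<bullet> e\<close>.\<close>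
  have level: "f (H (t, b)) = f (H (t, b0))" if tb: "(t, b) \<in> K" for t b
  proof -
    define B where "B = {b. (t, b) \<in> K}"
    have convB: "convex B"
    proof (rule convexI)
      fix b1 b2 p q :: real
      assume B: "b1 \<in> B" "b2 \<in> B" and pq: "0 \<le> p" "0 \<le> q" "p + q = 1"
      have "p *\<^sub>R (t, b1) + q *\<^sub>R (t, b2) \<in> K"
        using B pq unfolding B_def K_def by (intro convexD[OF convex_ball]) auto
      moreover have "p *\<^sub>R (t, b1) + q *\<^sub>R (t, b2) = (t, p *\<^sub>R b1 + q *\<^sub>R b2)"
        using pq(3) by (simp add: distrib_right[symmetric])
      ultimately show "p *\<^sub>R b1 + q *\<^sub>R b2 \<in> B" by (simp add: B_def)
    qed
    have der: "((\<lambda>b. f (H (t, b))) has_derivative (\<lambda>h. 0)) (at b within B)" if b: "b \<in> B" for b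
    proof -
      let ?q = "H (t, b)"
      have tbV: "(t, b) \<in> V" using b KV by (simp add: B_def)
      have q: "?q \<in> U" using HW[OF tbV] W0(3) by blast
      have line: "((\<lambda>b. (t, b)) has_derivative (\<lambda>h. (0, h))) (at b)"
        by (intro has_derivative_Pair has_derivative_const has_derivative_ident)
      have "((\<lambda>b. H (t, b)) has_derivative (\<lambda>h. H' (t, b) (0, h))) (at b)"
        using diff_chain_at[OF line dH[OF tbV]] by (simp add: o_def)
      from diff_chain_at[OF this dD[OF q]]
      have d: "((\<lambda>b. f (H (t, b))) has_derivative (\<lambda>h. D ?q (H' (t, b) (0, h)))) (at b)"
        by (simp add: o_def)
      have "D ?q (H' (t, b) (0, h)) = 0" for h
      proof -
        have lin: "linear (\<lambda>y. D ?q y \<bullet> e)"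
          using linear_compose[OF linD[OF q] bounded_linear.linear[OF bounded_linear_inner_left]]
          by (simp add: o_def)
        have one: "D ?q (H' (t, b) (1, 0)) \<bullet> e = 1" and zero: "D ?q (H' (t, b) (0, h)) \<bullet> e = 0"
          using arg_cong[OF GH'[OF tbV, unfolded dG[OF q]], of fst] by simp_all
        obtain a where a: "a \<noteq> 0" "D ?q a = 0" using rank[OF q] by (auto simp: D_def)
        obtain s where "H' (t, b) (0, h) = s *\<^sub>R a"
          using parallel_if_common_kernel[OF lin, of "H' (t, b) (1, 0)" a "H' (t, b) (0, h)"] one zero a
          by auto
        then show ?thesis using a linear_cmul[OF linD[OF q]] by simp
      qed
      then have "((\<lambda>b. f (H (t, b))) has_derivative (\<lambda>h. 0)) (at b)" using d by simp
      then show ?thesis by (rule has_derivative_at_withinI)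
    qed
    obtain k where k: "\<And>b. b \<in> B \<Longrightarrow> f (H (t, b)) = k"
      using has_derivative_zero_constant[OF convB der] by blast
    show ?thesis using k[of b] k[of b0] tb Kb0[OF tb] by (simp add: B_def)
  qed
  define h where "h t = (H (t, b0) - x0) \<bullet> v / (v \<bullet> v)" for t
  have Hline: "H (t, b0) = x0 + h t *\<^sub>R v" if "(t, b0) \<in> V" for t
  proof -
    have "H (t, b0) \<bullet> j = b0" using GH[OF that] by (simp add: G_def)
    then have "(H (t, b0) - x0) \<bullet> j = 0" by (simp add: inner_diff_left b0_def)
    from parallel_if_common_kernel[OF linj jj jv v0 this]
    obtain s where s: "H (t, b0) - x0 = s *\<^sub>R v" by blast
    then have "h t = s" using v0 by (simp add: h_def)
    then show ?thesis using s by (simp add: algebra_simps)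
  qed
  have contD: "continuous_on W0 (\<lambda>x. D x v)" unfolding D_def
    by (rule continuous_on_subset[OF smooth_on_imp_continuous_on[OF smooth_on_frechet_derivative[OF f]] W0(3)])
  have contG: "continuous_on W0 G" using hom by (simp add: homeomorphism_def)
  define W1 where "W1 = (W0 \<inter> G -` K) \<inter> (W0 \<inter> (\<lambda>x. D x v) -` (- {0}))"
  have W1: "open W1" unfolding W1_def
    by (intro open_Int continuous_open_preimage[OF contG W0(1)]
        continuous_open_preimage[OF contD W0(1)]) (auto simp: K_def)
  have x0W1: "x0 \<in> W1" using W0(2) e \<rho> by (auto simp: W1_def e_def K_def)
  have W1D: "x \<in> W0" "x \<in> U" "G x \<in> K" "D x v \<noteq> 0" if "x \<in> W1" for x
    using that W0(3) by (auto simp: W1_def)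
  obtain \<epsilon>' where \<epsilon>': "0 < \<epsilon>'" "ball x0 \<epsilon>' \<subseteq> W1" using W1 x0W1 open_contains_ball by blast
  \<comment> \<open>For \<open>\<bar>a\<bar> < \<epsilon>\<close> the point \<open>x0 + a v\<close> stays in the ball of radius \<open>\<epsilon>'\<close>.\<close>
  define \<epsilon> where "\<epsilon> = \<epsilon>' / norm v"
  have \<epsilon>: "0 < \<epsilon>" using \<epsilon>' v0 by (simp add: \<epsilon>_def)
  have lineW1: "x0 + a *\<^sub>R v \<in> W1" if "a \<in> {-\<epsilon><..<\<epsilon>}" for a
  proof -
    have "\<bar>a\<bar> < \<epsilon>" using that by auto
    then have "\<bar>a\<bar> * norm v < \<epsilon>'" using v0 by (simp add: \<epsilon>_def pos_less_divide_eq)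
    then show ?thesis using \<epsilon>'(2) by (auto simp: dist_norm subset_eq)
  qed
  define k where "k a = f (x0 + a *\<^sub>R v)" for a
  have k: "smooth_on {-\<epsilon><..<\<epsilon>} k" unfolding k_def
    by (rule smooth_on_affine[OF U(1) bounded_linear_scaleR_left f])
       (use lineW1 W1D in auto)
  have "vector_derivative k (at a) \<noteq> 0" if "a \<in> {-\<epsilon><..<\<epsilon>}" for a
  proof -
    have "vector_derivative k (at a) = D (x0 + a *\<^sub>R v) v"
      unfolding D_def k_def
      by (rule vector_derivative_at[OF has_vector_derivative_along_line[OF f]])
         (use lineW1[OF that] W1D in auto)
    then show ?thesis using W1D(4)[OF lineW1[OF that]] by simp
  qed
  then obtain d I \<sigma> S where d: "0 < d" "d < \<epsilon>" and I: "open I" "is_interval I"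
    and \<sigma>: "smooth_on I \<sigma>" "\<sigma> ` I \<subseteq> {-d<..<d}"
    and S: "S ` {-d<..<d} \<subseteq> I" "\<And>t. t \<in> {-d<..<d} \<Longrightarrow> \<sigma> (S t) = t"
      "\<And>t. t \<in> {-d<..<d} \<Longrightarrow> S differentiable (at t)"
    and unit: "\<And>s. s \<in> I \<Longrightarrow> norm (vector_derivative (\<lambda>s. k (\<sigma> s)) (at s)) = 1"
    using arc_length_parametrization[OF \<epsilon> k] by metis
  define \<delta> where "\<delta> s = k (\<sigma> s)" for s
  have \<delta>: "smooth_on I \<delta>"
  proof (rule smooth_onI)
    fix m
    have "\<sigma> ` I \<subseteq> {-\<epsilon><..<\<epsilon>}" using \<sigma>(2) d by force
    then show "Ck_on m I \<delta>" unfolding \<delta>_def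
      by (rule Ck_on_compose_real[OF I(1) smooth_onD[OF k] smooth_onD[OF \<sigma>(1)]])
  qed
  define g where "g x = h (f x \<bullet> e)" for x
  have dg: "g differentiable (at x)" if "x \<in> W1" for x
  proof -
    have "(f x \<bullet> e, b0) \<in> V" using KV Kb0 W1D(3)[OF that] by (simp add: G_def)
    note dHx = dH[OF this]
    have "((\<lambda>x. (f x \<bullet> e, b0)) has_derivative (\<lambda>w. (D x w \<bullet> e, 0))) (at x)"
      by (intro has_derivative_Pair bounded_linear.has_derivative[OF bounded_linear_inner_left]
          dD W1D(2) that has_derivative_const)
    from diff_chain_at[OF this dHx] obtain Q where "((\<lambda>x. H (f x \<bullet> e, b0)) has_derivative Q) (at x)"
      by (auto simp: o_def)
    then have "((\<lambda>x. (H (f x \<bullet> e, b0) - x0) \<bullet> v / (v \<bullet> v)) has_derivative (\<lambda>w. (Q w - 0) \<bullet> v / (v \<bullet> v))) (at x)"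
      by (intro bounded_linear.has_derivative[OF bounded_linear_divide]
          bounded_linear.has_derivative[OF bounded_linear_inner_left] has_derivative_diff has_derivative_const)
    then show ?thesis unfolding g_def h_def by (rule differentiableI)
  qed
  have contg: "continuous_on W1 g"
    by (intro continuous_at_imp_continuous_on ballI differentiable_imp_continuous_within dg)
  define W where "W = W1 \<inter> g -` {-d<..<d}"
  have W: "open W" unfolding W_def
    by (rule continuous_open_preimage[OF contg W1]) simp
  have "H (f x0 \<bullet> e, b0) = x0" using HG[OF W0(2)] by (simp add: Gx0)
  then have x0W: "x0 \<in> W" using x0W1 d by (simp add: W_def g_def h_def)
  have WD: "x \<in> W1" "g x \<in> {-d<..<d}" if "x \<in> W" for x using that by (auto simp: W_def)
  define u where "u x = S (g x)" for x
  have uI: "u x \<in> I" if "x \<in> W" for x using S(1) WD(2)[OF that] by (auto simp: u_def)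
  have fu: "f x = \<delta> (u x)" if "x \<in> W" for x
  proof -
    have x: "x \<in> W0" "(f x \<bullet> e, x \<bullet> j) \<in> K" using W1D(1,3)[OF WD(1)[OF that]] by (auto simp: G_def)
    have "f x = f (H (f x \<bullet> e, x \<bullet> j))" using HG[OF x(1)] by (simp add: G_def)
    also have "\<dots> = f (H (f x \<bullet> e, b0))" by (rule level[OF x(2)])
    also have "H (f x \<bullet> e, b0) = x0 + g x *\<^sub>R v"
      unfolding g_def by (rule Hline[OF KV[OF Kb0[OF x(2)]]])
    also have "f (x0 + g x *\<^sub>R v) = k (g x)" by (simp add: k_def)
    also have "k (g x) = \<delta> (u x)" by (simp add: \<delta>_def u_def S(2)[OF WD(2)[OF that]])
    finally show ?thesis .
  qed
  have du: "u differentiable (at x)" if "x \<in> W" for x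
    using differentiable_chain_at[OF dg[OF WD(1)[OF that]] S(3)[OF WD(2)[OF that]]]
    by (simp add: u_def[abs_def] o_def)
  show ?thesis
  proof (rule that[OF W x0W _ I \<delta>, of u])
    show "W \<subseteq> U" using WD(1) W1D(2) by blast
    show "norm (vector_derivative \<delta> (at s)) = 1" if "s \<in> I" for s
      using unit[OF that] by (simp add: \<delta>_def[abs_def])
    show "\<delta> ` I \<subseteq> f ` U"
    proof
      fix y assume "y \<in> \<delta> ` I"
      then obtain s where s: "s \<in> I" "y = \<delta> s" by blast
      then have "\<sigma> s \<in> {-\<epsilon><..<\<epsilon>}" using \<sigma>(2) d by force
      then have "x0 + \<sigma> s *\<^sub>R v \<in> U" using lineW1 W1D(2) by blast
      then show "y \<in> f ` U" by (simp add: s(2) \<delta>_def k_def)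
    qed
    show "continuous_on W u"
      by (intro continuous_at_imp_continuous_on ballI differentiable_imp_continuous_within du)
    show "u ` W \<subseteq> I" using uI by blast
    show "f x = \<delta> (u x)" if "x \<in> W" for x by (rule fu[OF that])
    fix x assume x: "x \<in> W"
    obtain u' where u': "(u has_derivative u') (at x)" using du[OF x] by (auto simp: differentiable_def)
    have "(\<delta> has_derivative (\<lambda>h. h *\<^sub>R vector_derivative \<delta> (at (u x)))) (at (u x))"
      using smooth_on_vector_derivative[OF \<delta> uI[OF x]] by (simp add: has_vector_derivative_def)
    from diff_chain_at[OF u' this]
    have "((\<lambda>x. \<delta> (u x)) has_derivative (\<lambda>w. u' w *\<^sub>R vector_derivative \<delta> (at (u x)))) (at x)"
      by (simp add: o_def)
    then have "(f has_derivative (\<lambda>w. u' w *\<^sub>R vector_derivative \<delta> (at (u x)))) (at x)"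
      by (rule has_derivative_transform_within_open[OF _ W x]) (simp add: fu)
    from has_derivative_unique[OF dD[OF W1D(2)[OF WD(1)[OF x]]] this]
    have Dx: "D x w = u' w *\<^sub>R vector_derivative \<delta> (at (u x))" for w
      by simp
    then have "u' v \<noteq> 0" using W1D(4)[OF WD(1)[OF x]] by auto
    then have "vector_derivative \<delta> (at (u x)) = D x (inverse (u' v) *\<^sub>R v)"
      using linear_cmul[OF linD[OF W1D(2)[OF WD(1)[OF x]]]] Dx[of v] by simp
    then show "\<exists>w. vector_derivative \<delta> (at (u x)) = frechet_derivative f (at x) w"
      unfolding D_def by (rule exI)
  qed
qed

section \<open>Frames along spherical curves\<close>

lemma orthogonal_to_frame_imp_0:
  fixes a b y :: "real^3"
  assumes "norm a = 1" "norm b = 1" "a \<bullet> b = 0" "y \<bullet> a = 0" "y \<bullet> b = 0" "y \<bullet> cross3 a b = 0"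
  shows "y = 0"
proof -
  have "cross3 y (cross3 a b) = 0" using assms by (simp add: Lagrange)
  moreover have "norm (cross3 a b) = 1"
    using norm_cross_dot[of a b] assms by (simp add: power2_eq_1_iff)
       (smt (verit) norm_ge_zero)
  ultimately show ?thesis
    using norm_and_cross_eq_0[of y "cross3 a b"] assms(6) by auto
qed

lemma frame_expansion:
  fixes a b y :: "real^3"
  assumes "norm a = 1" "norm b = 1" "a \<bullet> b = 0"
  shows "y = (y \<bullet> a) *\<^sub>R a + (y \<bullet> b) *\<^sub>R b + (y \<bullet> cross3 a b) *\<^sub>R cross3 a b"
proof -
  have nn: "a \<bullet> a = 1" "b \<bullet> b = 1" "b \<bullet> a = 0" "cross3 a b \<bullet> cross3 a b = 1"
    using norm_cross_dot[of a b] assms by (simp_all add: norm_eq_1 inner_commute power2_norm_eq_inner[symmetric])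
  have "y - ((y \<bullet> a) *\<^sub>R a + (y \<bullet> b) *\<^sub>R b + (y \<bullet> cross3 a b) *\<^sub>R cross3 a b) = 0"
    by (rule orthogonal_to_frame_imp_0[OF assms])
       (simp_all add: inner_diff_left inner_add_left nn assms dot_cross_self)
  then show ?thesis by simp
qed

lemma inner_constant_imp_derivative:
  fixes f g :: "'a::euclidean_space \<Rightarrow> 'b::euclidean_space"
  assumes S: "open S" "x \<in> S" and fg: "smooth_on S f" "smooth_on S g"
    and const: "\<And>y. y \<in> S \<Longrightarrow> f y \<bullet> g y = k"
  shows "f x \<bullet> frechet_derivative g (at x) v + frechet_derivative f (at x) v \<bullet> g x = 0"
proof -
  have "((\<lambda>y. f y \<bullet> g y) has_derivative
      (\<lambda>v. f x \<bullet> frechet_derivative g (at x) v + frechet_derivative f (at x) v \<bullet> g x)) (at x)"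
    by (intro has_derivative_inner smooth_on_derivative[OF fg(1) S(2)] smooth_on_derivative[OF fg(2) S(2)])
  moreover have "((\<lambda>y. f y \<bullet> g y) has_derivative (\<lambda>v. 0)) (at x)"
    by (rule has_derivative_transform_within_open[OF has_derivative_const[of k] S]) (simp add: const)
  ultimately have "(\<lambda>v. f x \<bullet> frechet_derivative g (at x) v + frechet_derivative f (at x) v \<bullet> g x) = (\<lambda>v. 0)"
    by (rule has_derivative_unique)
  then show ?thesis by (rule fun_cong)
qed

context
  fixes c :: "real^3" and r :: real and I :: "real set" and \<delta> :: "real \<Rightarrow> real^3"
  assumes \<delta>: "unit_speed_spherical_curve c r I \<delta>"
begin

lemma spherical_curveD:
  shows "0 < r" "open I" "is_interval I" "smooth_on I \<delta>"
    and "s \<in> I \<Longrightarrow> norm (\<delta> s - c) = r" "s \<in> I \<Longrightarrow> norm (vector_derivative \<delta> (at s)) = 1"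
proof -
  note D = \<delta>[unfolded unit_speed_spherical_curve_def]
  show "0 < r" "open I" "is_interval I" "smooth_on I \<delta>" using D by blast+
  show "norm (vector_derivative \<delta> (at s)) = 1" if "s \<in> I" using D that by blast
  have "\<delta> s \<in> sphere c r" if "s \<in> I" using D that by blast
  then show "norm (\<delta> s - c) = r" if "s \<in> I" using that by (simp add: dist_norm norm_minus_commute)
qed

lemma spherical_radius_unit:
  assumes "s \<in> I" shows "norm ((1 / r) *\<^sub>R (\<delta> s - c)) = 1"
  using spherical_curveD(1) spherical_curveD(5)[OF assms] by simp

lemma spherical_radius_orthogonal_velocity:
  assumes "s \<in> I" shows "((1 / r) *\<^sub>R (\<delta> s - c)) \<bullet> vector_derivative \<delta> (at s) = 0"
proof -
  have sm: "smooth_on I (\<lambda>s. \<delta> s - c)"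
    by (rule smooth_on_diff[OF spherical_curveD(2,4) smooth_on_const[OF spherical_curveD(2)]])
  have "(\<delta> s - c) \<bullet> frechet_derivative (\<lambda>s. \<delta> s - c) (at s) 1
      + frechet_derivative (\<lambda>s. \<delta> s - c) (at s) 1 \<bullet> (\<delta> s - c) = 0"
    by (rule inner_constant_imp_derivative[OF spherical_curveD(2) assms sm sm, of "r\<^sup>2"])
       (simp add: power2_norm_eq_inner[symmetric] spherical_curveD(5))
  moreover have "frechet_derivative (\<lambda>s. \<delta> s - c) (at s) 1 = vector_derivative \<delta> (at s)"
  proof -
    have "((\<lambda>s. \<delta> s - c) has_derivative (\<lambda>h. h *\<^sub>R vector_derivative \<delta> (at s) - 0)) (at s)"
      using smooth_on_vector_derivative[OF spherical_curveD(4) assms]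
      unfolding has_vector_derivative_def by (intro has_derivative_diff has_derivative_const)
    from fun_cong[OF frechet_derivative_at[OF this], of 1] show ?thesis by simp
  qed
  ultimately show ?thesis by (simp add: inner_commute)
qed

lemma spherical_normal_smooth: "smooth_on I (spherical_normal c r \<delta>)"
proof -
  note I = spherical_curveD(2)
  have "smooth_on I (\<lambda>s. cross3 ((1 / r) *\<^sub>R (\<delta> s - c)) (vector_derivative \<delta> (at s)))"
    by (rule smooth_on_cross3[OF I smooth_on_scaleR[OF I smooth_on_const[OF I]
          smooth_on_diff[OF I spherical_curveD(4) smooth_on_const[OF I]]]
          smooth_on_deriv_curve[OF I spherical_curveD(4)]])
  then show ?thesis by (simp add: spherical_normal_def[abs_def])
qed

lemma spherical_frame_expansion:
  assumes "s \<in> I"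
  shows "y = (y \<bullet> ((1 / r) *\<^sub>R (\<delta> s - c))) *\<^sub>R ((1 / r) *\<^sub>R (\<delta> s - c))
    + (y \<bullet> vector_derivative \<delta> (at s)) *\<^sub>R vector_derivative \<delta> (at s)
    + (y \<bullet> spherical_normal c r \<delta> s) *\<^sub>R spherical_normal c r \<delta> s"
  unfolding spherical_normal_def
  by (rule frame_expansion[OF spherical_radius_unit[OF assms] spherical_curveD(6)[OF assms]
        spherical_radius_orthogonal_velocity[OF assms]])

lemma vector_derivative_reverse:
  assumes "- s \<in> I"
  shows "vector_derivative (\<lambda>s. \<delta> (- s)) (at s) = - vector_derivative \<delta> (at (- s))"
proof -
  have "(uminus has_vector_derivative (-1)) (at s)"
    by (auto intro!: derivative_eq_intros simp: has_vector_derivative_def)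
  from vector_diff_chain_at[OF this smooth_on_vector_derivative[OF spherical_curveD(4) assms]]
  have "((\<lambda>s. \<delta> (- s)) has_vector_derivative (-1) *\<^sub>R vector_derivative \<delta> (at (- s))) (at s)"
    by (simp add: o_def)
  then show ?thesis using vector_derivative_at by fastforce
qed

text \<open>Reversing a curve reverses its spherical normal, which adjusts the sign of a unit normal.\<close>

lemma unit_speed_spherical_curve_reverse:
  "unit_speed_spherical_curve c r (uminus ` I) (\<lambda>s. \<delta> (- s))"
proof -
  have o: "open (uminus ` I)" using spherical_curveD(2) open_negations by blast
  have iv: "is_interval (uminus ` I)" using spherical_curveD(3) by simp
  have mem: "- s \<in> I" if "s \<in> uminus ` I" for s using that by auto
  have "smooth_on (uminus ` I) (\<lambda>s. \<delta> (0 + - s))"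
    by (rule smooth_on_affine[OF spherical_curveD(2) bounded_linear_minus[OF bounded_linear_ident]
          spherical_curveD(4) o]) (simp add: mem)
  moreover have "\<delta> (- s) \<in> sphere c r" if "s \<in> uminus ` I" for s
    using spherical_curveD(5)[OF mem[OF that]] by (simp add: dist_norm norm_minus_commute)
  moreover have "norm (vector_derivative (\<lambda>s. \<delta> (- s)) (at s)) = 1" if "s \<in> uminus ` I" for s
    using spherical_curveD(6)[OF mem[OF that]] vector_derivative_reverse[OF mem[OF that]] by simp
  ultimately show ?thesis
    using o iv spherical_curveD(1) by (simp add: unit_speed_spherical_curve_def)
qed

end

text \<open>By the Darboux equations \<open>N\<^sub>\<delta>'\<close> is a multiple of \<open>\<delta>'\<close>: the frame is orthonormal, and neither
  \<open>N\<^sub>\<delta>\<close> nor \<open>\<delta> - c\<close> contributes. The factor is minus the geodesic curvature.\<close>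

lemma spherical_normal_derivative:
  assumes \<delta>: "unit_speed_spherical_curve c r I \<delta>" and s: "s \<in> I"
  obtains k where "(spherical_normal c r \<delta> has_vector_derivative k *\<^sub>R vector_derivative \<delta> (at s)) (at s)"
proof -
  note I = spherical_curveD(2)[OF \<delta>]
  let ?N = "spherical_normal c r \<delta>" and ?e = "\<lambda>s. (1 / r) *\<^sub>R (\<delta> s - c)"
  let ?t = "vector_derivative \<delta> (at s)"
  have sN: "smooth_on I ?N" by (rule spherical_normal_smooth[OF \<delta>])
  have se: "smooth_on I ?e"
    by (rule smooth_on_scaleR[OF I smooth_on_const[OF I]
          smooth_on_diff[OF I spherical_curveD(4)[OF \<delta>] smooth_on_const[OF I]]])
  let ?N' = "vector_derivative ?N (at s)"
  have N': "(?N has_vector_derivative ?N') (at s)" by (rule smooth_on_vector_derivative[OF sN s])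
  have DN: "frechet_derivative ?N (at s) 1 = ?N'"
    using fun_cong[OF frechet_derivative_at[OF N'[unfolded has_vector_derivative_def]], of 1] by simp
  have e': "(?e has_vector_derivative (1 / r) *\<^sub>R ?t) (at s)"
  proof -
    have "((\<lambda>s. \<delta> s - c) has_vector_derivative ?t - 0) (at s)"
      by (rule has_vector_derivative_diff[OF smooth_on_vector_derivative[OF spherical_curveD(4)[OF \<delta>] s]
            has_vector_derivative_const])
    then have "((\<lambda>s. \<delta> s - c) has_vector_derivative ?t) (at s)" by simp
    from bounded_linear.has_vector_derivative[OF bounded_linear_scaleR_right this] show ?thesis .
  qed
  have De: "frechet_derivative ?e (at s) 1 = (1 / r) *\<^sub>R ?t"
    using fun_cong[OF frechet_derivative_at[OF e'[unfolded has_vector_derivative_def]], of 1] by simp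
  have unit: "?N s \<bullet> ?N s = 1" if "s \<in> I" for s
  proof -
    have "(norm (?N s))\<^sup>2 + (?e s \<bullet> vector_derivative \<delta> (at s))\<^sup>2
        = (norm (?e s) * norm (vector_derivative \<delta> (at s)))\<^sup>2"
      unfolding spherical_normal_def by (rule norm_cross_dot)
    then show ?thesis
      unfolding spherical_radius_orthogonal_velocity[OF \<delta> that] spherical_radius_unit[OF \<delta> that]
        spherical_curveD(6)[OF \<delta> that]
      by (simp add: power2_norm_eq_inner)
  qed
  have orth: "?e s \<bullet> ?N s = 0" for s unfolding spherical_normal_def by (rule dot_cross_self)
  have tN: "?t \<bullet> ?N s = 0" unfolding spherical_normal_def by (rule dot_cross_self)
  have N'N: "?N' \<bullet> ?N s = 0"
    using inner_constant_imp_derivative[OF I s sN sN unit, of 1] unfolding DN by (simp add: inner_commute)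
  have N'e: "?N' \<bullet> ?e s = 0"
    using inner_constant_imp_derivative[OF I s se sN orth, of 1] tN unfolding DN De
    by (simp add: inner_commute)
  have "?N' = (?N' \<bullet> ?t) *\<^sub>R ?t"
    using spherical_frame_expansion[OF \<delta> s, of ?N'] unfolding N'N N'e by simp
  then show ?thesis using N' that[of "?N' \<bullet> ?t"] by simp
qed

lemma smooth_on_cos_sin: "smooth_on UNIV (\<lambda>s. cos s *\<^sub>R a + sin s *\<^sub>R b)"
proof (rule smooth_onI)
  show "Ck_on k UNIV (\<lambda>s. cos s *\<^sub>R a + sin s *\<^sub>R b)" for k
  proof (induction k arbitrary: a b)
    case 0
    show ?case unfolding Ck_on.simps(1) by (intro continuous_intros)
  next
    case (Suc k)
    show ?case
    proof (rule Ck_on_SucI[where f'="\<lambda>s v. cos s *\<^sub>R (v *\<^sub>R b) + sin s *\<^sub>R (- v *\<^sub>R a)"])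
      show "((\<lambda>s. cos s *\<^sub>R a + sin s *\<^sub>R b) has_derivative
          (\<lambda>v. cos s *\<^sub>R (v *\<^sub>R b) + sin s *\<^sub>R (- v *\<^sub>R a))) (at s)" for s
        by (auto intro!: derivative_eq_intros simp: algebra_simps)
      show "Ck_on k UNIV (\<lambda>s. cos s *\<^sub>R (v *\<^sub>R b) + sin s *\<^sub>R (- v *\<^sub>R a))" for v
        by (rule Suc.IH)
    qed simp
  qed
qed

lemma vector_derivative_cos_sin:
  "vector_derivative (\<lambda>s. cos s *\<^sub>R a + sin s *\<^sub>R b) (at s) = - sin s *\<^sub>R a + cos s *\<^sub>R b"
  by (rule vector_derivative_at) (auto intro!: derivative_eq_intros simp: has_vector_derivative_def algebra_simps)

lemma great_circle:
  fixes a b :: "real^3"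
  assumes ab: "norm a = 1" "norm b = 1" "a \<bullet> b = 0"
  defines "\<beta> \<equiv> \<lambda>s. cos s *\<^sub>R a + sin s *\<^sub>R b"
  shows "unit_speed_spherical_curve 0 1 UNIV \<beta>" "spherical_normal 0 1 \<beta> s = cross3 a b"
proof -
  have nn: "a \<bullet> a = 1" "b \<bullet> b = 1" "b \<bullet> a = 0" using ab by (simp_all add: norm_eq_1 inner_commute)
  have d: "vector_derivative \<beta> (at s) = - sin s *\<^sub>R a + cos s *\<^sub>R b" for s
    unfolding \<beta>_def by (rule vector_derivative_cos_sin)
  have 1: "norm (\<beta> s) = 1" for s
    unfolding \<beta>_def norm_eq_1 using sin_cos_squared_add2[of s]
    by (simp add: inner_add_left inner_add_right nn ab power2_eq_square)
  have 2: "norm (vector_derivative \<beta> (at s)) = 1" for s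
    unfolding d norm_eq_1 using sin_cos_squared_add2[of s]
    by (simp add: inner_diff_left inner_diff_right nn ab power2_eq_square add.commute)
  show "unit_speed_spherical_curve 0 1 UNIV \<beta>"
    unfolding unit_speed_spherical_curve_def using smooth_on_cos_sin[of a b] 1 2
    by (simp add: \<beta>_def)
  have "cross3 (\<beta> s) (- sin s *\<^sub>R a + cos s *\<^sub>R b)
      = (cos s * cos s) *\<^sub>R cross3 a b + (sin s * sin s) *\<^sub>R cross3 a b"
    unfolding \<beta>_def cross_add_left cross_add_right cross_mult_left cross_mult_right
    using cross_skew[of b a] by (simp add: algebra_simps)
  then show "spherical_normal 0 1 \<beta> s = cross3 a b"
    unfolding spherical_normal_def d scaleR_add_left[symmetric]
    using sin_cos_squared_add2[of s] by (simp add: power2_eq_square)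
qed

section \<open>Parametrized surfaces with constant support function\<close>

text \<open>The parameters \<open>(u, \<zeta>)\<close> of an injectively parametrized piece of a ruled surface determine the point, so they
  are an injective continuous function of it and fill an open set by invariance of domain.\<close>

lemma ruled_image:
  fixes \<phi> :: "real \<times> real \<Rightarrow> 'b" and u \<zeta> :: "real \<times> real \<Rightarrow> real"
  assumes W: "open W" and inj: "inj_on \<phi> W" and cont: "continuous_on W u" "continuous_on W \<zeta>"
    and \<phi>: "\<And>x. x \<in> W \<Longrightarrow> \<phi> x = X (u x, \<zeta> x)"
  obtains Q where "open Q" "Q \<subseteq> u ` W \<times> UNIV" "\<phi> ` W = X ` Q"
proof (rule that)
  let ?h = "\<lambda>x. (u x, \<zeta> x)"
  have "inj_on ?h W"
  proof (rule inj_onI)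
    fix x y assume "x \<in> W" "y \<in> W" "?h x = ?h y"
    then show "x = y" using inj_onD[OF inj] \<phi> by simp
  qed
  then show "open (?h ` W)"
    using cont W by (intro invariance_of_domain continuous_intros)
  show "?h ` W \<subseteq> u ` W \<times> UNIV" by blast
  show "\<phi> ` W = X ` ?h ` W" using \<phi> by (simp add: image_image)
qed

locale constant_support_patch =
  fixes U :: "(real \<times> real) set" and \<phi> n :: "real \<times> real \<Rightarrow> real^3" and c :: "real^3" and r :: real
  assumes open_U: "open U" and smooth_\<phi>: "smooth_on U \<phi>" and smooth_n: "smooth_on U n"
    and immersion: "x \<in> U \<Longrightarrow> inj (frechet_derivative \<phi> (at x))" and inj_\<phi>: "inj_on \<phi> U"
    and unit_n: "x \<in> U \<Longrightarrow> norm (n x) = 1"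
    and normal_n: "x \<in> U \<Longrightarrow> n x \<bullet> frechet_derivative \<phi> (at x) v = 0"
    and support: "x \<in> U \<Longrightarrow> n x \<bullet> (\<phi> x - c) = r"
    and r_pos: "0 < r"
begin

abbreviation "D\<phi> x \<equiv> frechet_derivative \<phi> (at x)"
abbreviation "Dn x \<equiv> frechet_derivative n (at x)"

definition \<tau> :: "real \<times> real \<Rightarrow> real^3" where
  "\<tau> x = \<phi> x - c - r *\<^sub>R n x"

lemma has_derivative_\<phi>: "x \<in> U \<Longrightarrow> (\<phi> has_derivative D\<phi> x) (at x)"
  by (rule smooth_on_derivative[OF smooth_\<phi>])

lemma has_derivative_n: "x \<in> U \<Longrightarrow> (n has_derivative Dn x) (at x)"
  by (rule smooth_on_derivative[OF smooth_n])

lemma linear_D\<phi>: "x \<in> U \<Longrightarrow> linear (D\<phi> x)"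
  by (rule has_derivative_linear[OF has_derivative_\<phi>])

lemma linear_Dn: "x \<in> U \<Longrightarrow> linear (Dn x)"
  by (rule has_derivative_linear[OF has_derivative_n])

lemma n_n: "x \<in> U \<Longrightarrow> n x \<bullet> n x = 1"
  using unit_n by (simp add: norm_eq_1)

lemma smooth_\<phi>c: "smooth_on U (\<lambda>x. \<phi> x - c)"
  by (rule smooth_on_diff[OF open_U smooth_\<phi> smooth_on_const[OF open_U]])

lemma has_derivative_\<phi>c: "x \<in> U \<Longrightarrow> ((\<lambda>x. \<phi> x - c) has_derivative D\<phi> x) (at x)"
  using has_derivative_diff[OF has_derivative_\<phi> has_derivative_const] by simp

lemma smooth_\<tau>: "smooth_on U \<tau>"
proof -
  have "smooth_on U (\<lambda>x. \<phi> x - c - r *\<^sub>R n x)"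
    by (rule smooth_on_diff[OF open_U smooth_\<phi>c
          smooth_on_scaleR[OF open_U smooth_on_const[OF open_U] smooth_n]])
  then show ?thesis by (simp add: \<tau>_def[abs_def])
qed

lemma has_derivative_\<tau>: "x \<in> U \<Longrightarrow> (\<tau> has_derivative (\<lambda>v. D\<phi> x v - r *\<^sub>R Dn x v)) (at x)"
  unfolding \<tau>_def[abs_def]
  by (rule has_derivative_diff[OF has_derivative_\<phi>c has_derivative_scaleR_right[OF has_derivative_n]])

lemma D\<tau>: "x \<in> U \<Longrightarrow> frechet_derivative \<tau> (at x) v = D\<phi> x v - r *\<^sub>R Dn x v"
  using fun_cong[OF frechet_derivative_at[OF has_derivative_\<tau>], of x v] by simp

lemma n_\<tau>: "x \<in> U \<Longrightarrow> n x \<bullet> \<tau> x = 0"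
  by (simp add: \<tau>_def inner_diff_right[of _ "\<phi> x - c"] support n_n)

lemma n_Dn: "x \<in> U \<Longrightarrow> n x \<bullet> Dn x v = 0"
  using inner_constant_imp_derivative[OF open_U _ smooth_n smooth_n, of x 1 v] n_n
  by (simp add: inner_commute)

lemma Dn_position: "x \<in> U \<Longrightarrow> Dn x v \<bullet> (\<phi> x - c) = 0"
  using inner_constant_imp_derivative[OF open_U _ smooth_n smooth_\<phi>c, of x r v] support
    fun_cong[OF frechet_derivative_at[OF has_derivative_\<phi>c], of x v, symmetric] normal_n
  by simp

lemma Dn_\<tau>: "x \<in> U \<Longrightarrow> Dn x v \<bullet> \<tau> x = 0"
  unfolding \<tau>_def inner_diff_right[of _ "\<phi> x - c"] using Dn_position n_Dn by (simp add: inner_commute)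

text \<open>Self-adjointness of the shape operator, a consequence of the symmetry of the second derivative of \<open>\<phi>\<close>.\<close>

lemma Dn_self_adjoint:
  assumes "x \<in> U" shows "Dn x v \<bullet> D\<phi> x w = Dn x w \<bullet> D\<phi> x v"
proof -
  have "n x \<bullet> frechet_derivative (\<lambda>y. D\<phi> y w) (at x) v + Dn x v \<bullet> D\<phi> x w = 0" for v w
    by (rule inner_constant_imp_derivative[OF open_U assms smooth_n
          smooth_on_frechet_derivative[OF smooth_\<phi>], where k=0]) (rule normal_n)
  from this[of w v] this[of v w] show ?thesis
    using second_derivative_symmetric[OF open_U assms smooth_\<phi>, of v w] by simp
qed

lemma tangent_vector_in_range:
  assumes x: "x \<in> U" and "n x \<bullet> y = 0"
  obtains a where "D\<phi> x a = y"
proof -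
  have "range (D\<phi> x) = {y. n x \<bullet> y = 0}"
  proof (rule subspace_dim_equal)
    show "subspace (range (D\<phi> x))"
      by (rule linear_subspace_image[OF linear_D\<phi>[OF x] subspace_UNIV])
    show "range (D\<phi> x) \<subseteq> {y. n x \<bullet> y = 0}" using normal_n[OF x] by blast
    have "dim (range (D\<phi> x)) = dim (UNIV :: (real \<times> real) set)"
      by (rule dim_image_eq[OF linear_D\<phi>[OF x]]) (use immersion[OF x] in \<open>simp add: span_UNIV\<close>)
    moreover have "dim {y. n x \<bullet> y = 0} = DIM(real^3) - 1"
      by (rule dim_hyperplane) (use unit_n[OF x] in auto)
    ultimately show "dim {y. n x \<bullet> y = 0} \<le> dim (range (D\<phi> x))" by (simp add: dim_UNIV)
  qed (rule subspace_hyperplane)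
  then have "y \<in> range (D\<phi> x)" using assms by simp
  then show ?thesis using that by blast
qed

text \<open>The key fact: \<open>\<tau>\<close> is a principal direction with curvature zero. For \<open>D\<phi>(a) = \<tau>\<close> and any tangent vector
  \<open>D\<phi>(b)\<close>, one has \<open>Dn(a) \<bullet> D\<phi>(b) = Dn(b) \<bullet> \<tau> = 0\<close>; take \<open>D\<phi>(b) = Dn(a)\<close>. Moreover \<open>D\<tau>(a) = \<tau>\<close>:
  to first order, \<open>\<tau>\<close> only changes its length in this direction.\<close>

lemma tangential_position_is_asymptotic:
  assumes x: "x \<in> U" and "\<tau> x \<noteq> 0"
  obtains a where "a \<noteq> 0" "Dn x a = 0" "D\<phi> x a = \<tau> x" "frechet_derivative \<tau> (at x) a = \<tau> x"
proof -
  obtain a where a: "D\<phi> x a = \<tau> x" using tangent_vector_in_range[OF x n_\<tau>[OF x]] by blast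
  obtain b where b: "D\<phi> x b = Dn x a" using tangent_vector_in_range[OF x n_Dn[OF x]] by blast
  have "Dn x a \<bullet> Dn x a = Dn x b \<bullet> \<tau> x"
    using Dn_self_adjoint[OF x, of a b] unfolding a b .
  then have Dn: "Dn x a = 0" using Dn_\<tau>[OF x] by simp
  have "a \<noteq> 0" using a assms linear_0[OF linear_D\<phi>[OF x]] by auto
  then show ?thesis using that[OF _ Dn a] D\<tau>[OF x, of a] a Dn by simp
qed

lemma normal_surface_patch:
  assumes \<delta>: "unit_speed_spherical_curve c r I \<delta>"
    and W: "open W" "W \<subseteq> U" and u: "continuous_on W u" "u ` W \<subseteq> I"
    and along: "\<And>x. x \<in> W \<Longrightarrow> (\<phi> x - c) \<bullet> vector_derivative \<delta> (at (u x)) = 0"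
    and radial: "\<And>x. x \<in> W \<Longrightarrow> \<delta> (u x) = c + r *\<^sub>R n x"
  shows "normal_surface_to_spherical_curve c r (\<phi> ` W)"
proof -
  define \<zeta> where "\<zeta> x = (\<phi> x - c) \<bullet> spherical_normal c r \<delta> (u x)" for x
  have cont: "continuous_on W \<zeta>" unfolding \<zeta>_def
    by (intro continuous_intros continuous_on_compose2[OF _ u]
        smooth_on_imp_continuous_on spherical_normal_smooth[OF \<delta>]
        continuous_on_subset[OF smooth_on_imp_continuous_on[OF smooth_\<phi>] W(2)])
  have eq: "\<phi> x = (\<lambda>(s, z). \<delta> s + z *\<^sub>R spherical_normal c r \<delta> s) (u x, \<zeta> x)" if x: "x \<in> W" for x
  proof -
    have rad: "(1 / r) *\<^sub>R (\<delta> (u x) - c) = n x" using radial[OF x] r_pos by simp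
    have s: "(\<phi> x - c) \<bullet> n x = r" using support[of x] x W(2) by (auto simp: inner_commute)
    have "u x \<in> I" using u x by blast
    from spherical_frame_expansion[OF \<delta> this, of "\<phi> x - c"]
    have "\<phi> x - c = r *\<^sub>R n x + \<zeta> x *\<^sub>R spherical_normal c r \<delta> (u x)"
      unfolding rad s along[OF x] \<zeta>_def by simp
    then show ?thesis using radial[OF x] by (simp add: algebra_simps)
  qed
  obtain Q where Q: "open Q" "Q \<subseteq> u ` W \<times> UNIV"
      "\<phi> ` W = (\<lambda>(s, z). \<delta> s + z *\<^sub>R spherical_normal c r \<delta> s) ` Q"
    using ruled_image[OF W(1) inj_on_subset[OF inj_\<phi> W(2)] u(1) cont eq] by blast
  have "Q \<subseteq> I \<times> UNIV" using Q(2) u(2) by blast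
  then show ?thesis unfolding normal_surface_to_spherical_curve_def using \<delta> Q(1,3) by blast
qed

lemma parallel_surface_patch:
  assumes \<beta>: "unit_speed_spherical_curve 0 1 I \<beta>"
    and W: "open W" "W \<subseteq> U" and u: "continuous_on W u" "u ` W \<subseteq> I"
    and \<tau>: "\<And>x. x \<in> W \<Longrightarrow> \<tau> x = norm (\<tau> x) *\<^sub>R \<beta> (u x)"
    and n: "\<And>x. x \<in> W \<Longrightarrow> n x = spherical_normal 0 1 \<beta> (u x)"
  shows "parallel_to_conical_surface c r (\<phi> ` W)"
proof -
  have cont: "continuous_on W (\<lambda>x. norm (\<tau> x))"
    by (intro continuous_intros continuous_on_subset[OF smooth_on_imp_continuous_on[OF smooth_\<tau>] W(2)])
  have eq: "\<phi> x = (\<lambda>(s, z). c + z *\<^sub>R \<beta> s + r *\<^sub>R spherical_normal 0 1 \<beta> s) (u x, norm (\<tau> x))"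
    if x: "x \<in> W" for x
    using \<tau>[OF x] n[OF x] by (simp add: \<tau>_def)
  obtain Q where Q: "open Q" "Q \<subseteq> u ` W \<times> UNIV"
      "\<phi> ` W = (\<lambda>(s, z). c + z *\<^sub>R \<beta> s + r *\<^sub>R spherical_normal 0 1 \<beta> s) ` Q"
    using ruled_image[OF W(1) inj_on_subset[OF inj_\<phi> W(2)] u(1) cont eq] by blast
  have "Q \<subseteq> I \<times> UNIV" using Q(2) u(2) by blast
  then show ?thesis unfolding parallel_to_conical_surface_def using \<beta> Q(1,3) r_pos by blast
qed

text \<open>The rank-one map is \<open>c + r n\<close>, whose image lies on the sphere.\<close>

lemma normal_surface_if_Dn_nonzero:
  assumes rank: "\<And>x. x \<in> U \<Longrightarrow> \<exists>a. a \<noteq> 0 \<and> Dn x a = 0"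
    and x0: "x0 \<in> U" "Dn x0 v \<noteq> 0"
  obtains W where "open W" "x0 \<in> W" "W \<subseteq> U" "normal_surface_to_spherical_curve c r (\<phi> ` W)"
proof -
  define f where "f x = c + r *\<^sub>R n x" for x
  have f: "smooth_on U f" unfolding f_def
    by (rule smooth_on_add[OF open_U smooth_on_const[OF open_U]
          smooth_on_scaleR[OF open_U smooth_on_const[OF open_U] smooth_n]])
  have Df: "frechet_derivative f (at x) v = r *\<^sub>R Dn x v" if "x \<in> U" for x v
  proof -
    have "(f has_derivative (\<lambda>v. 0 + r *\<^sub>R Dn x v)) (at x)" unfolding f_def
      by (intro has_derivative_add has_derivative_const has_derivative_scaleR_right has_derivative_n that)
    from fun_cong[OF frechet_derivative_at[OF this], of v] show ?thesis by simp
  qed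
  have rank_f: "\<exists>a. a \<noteq> 0 \<and> frechet_derivative f (at x) a = 0" if "x \<in> U" for x
    using rank[OF that] by (auto simp: Df[OF that])
  have v: "frechet_derivative f (at x0) v \<noteq> 0" using x0 r_pos by (simp add: Df)
  show ?thesis
  proof (rule rank_one_factorization[OF open_U x0(1) f rank_f v])
    fix W I \<delta> u
    assume W: "open W" "x0 \<in> W" "W \<subseteq> U" and I: "open I" "is_interval I"
      and \<delta>: "smooth_on I \<delta>" "\<And>s. s \<in> I \<Longrightarrow> norm (vector_derivative \<delta> (at s)) = 1" "\<delta> ` I \<subseteq> f ` U"
      and u: "continuous_on W u" "u ` W \<subseteq> I" "\<And>x. x \<in> W \<Longrightarrow> f x = \<delta> (u x)"
      and vel: "\<And>x. x \<in> W \<Longrightarrow> \<exists>w. vector_derivative \<delta> (at (u x)) = frechet_derivative f (at x) w"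
    have "\<delta> s \<in> sphere c r" if s: "s \<in> I" for s
    proof -
      obtain x where "x \<in> U" "\<delta> s = f x" using \<delta>(3) s by blast
      then show ?thesis using unit_n[of x] r_pos by (simp add: f_def dist_norm)
    qed
    then have curve: "unit_speed_spherical_curve c r I \<delta>"
      using I \<delta> r_pos by (simp add: unit_speed_spherical_curve_def)
    have "(\<phi> x - c) \<bullet> vector_derivative \<delta> (at (u x)) = 0" if x: "x \<in> W" for x
    proof -
      obtain w where w: "vector_derivative \<delta> (at (u x)) = frechet_derivative f (at x) w" using vel[OF x] by blast
      have xU: "x \<in> U" using x W(3) by blast
      show ?thesis unfolding w using Dn_position[OF xU, of w] Df[OF xU] by (simp add: inner_commute)
    qed
    then have "normal_surface_to_spherical_curve c r (\<phi> ` W)"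
      using u(3) by (intro normal_surface_patch[OF curve W(1,3) u(1,2)]) (auto simp: f_def)
    then show thesis by (rule that[OF W])
  qed
qed

text \<open>The two orthogonality conditions leave \<open>n = \<plusminus>N\<^sub>\<beta>\<close>. The sign is locally constant, and if it is
  negative at \<open>x0\<close>, the curve is reversed.\<close>

lemma parallel_surface_if_normal_along_cone:
  assumes \<beta>: "unit_speed_spherical_curve 0 1 I \<beta>"
    and W: "open W" "W \<subseteq> U" "x0 \<in> W" and u: "continuous_on W u" "u ` W \<subseteq> I"
    and \<tau>: "\<And>x. x \<in> W \<Longrightarrow> \<tau> x = norm (\<tau> x) *\<^sub>R \<beta> (u x)"
    and n1: "\<And>x. x \<in> W \<Longrightarrow> n x \<bullet> \<beta> (u x) = 0"
    and n2: "\<And>x. x \<in> W \<Longrightarrow> n x \<bullet> vector_derivative \<beta> (at (u x)) = 0"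
  obtains W' where "open W'" "x0 \<in> W'" "W' \<subseteq> U" "parallel_to_conical_surface c r (\<phi> ` W')"
proof -
  let ?N = "spherical_normal 0 1 \<beta>"
  define \<sigma> where "\<sigma> x = n x \<bullet> ?N (u x)" for x
  have n\<sigma>: "n x = \<sigma> x *\<^sub>R ?N (u x)" if "x \<in> W" for x
  proof -
    have "u x \<in> I" using u that by blast
    from spherical_frame_expansion[OF \<beta> this, of "n x"]
    show ?thesis by (simp add: n1[OF that] n2[OF that] \<sigma>_def)
  qed
  have \<sigma>1: "\<sigma> x = 1 \<or> \<sigma> x = -1" if "x \<in> W" for x
  proof -
    have "n x \<bullet> n x = \<sigma> x * \<sigma> x"
      using arg_cong[OF n\<sigma>[OF that], of "\<lambda>y. n x \<bullet> y"] by (simp add: \<sigma>_def)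
    then have "\<sigma> x * \<sigma> x = 1" using n_n[of x] that W(2) by auto
    then show ?thesis by (simp add: square_eq_1_iff)
  qed
  have cont: "continuous_on W \<sigma>" unfolding \<sigma>_def
    by (intro continuous_intros continuous_on_compose2[OF _ u]
        smooth_on_imp_continuous_on spherical_normal_smooth[OF \<beta>]
        continuous_on_subset[OF smooth_on_imp_continuous_on[OF smooth_n] W(2)])
  define W' where "W' = W \<inter> \<sigma> -` {s. 0 < \<sigma> x0 * s}"
  have W': "open W'" unfolding W'_def
    by (rule continuous_open_preimage[OF cont W(1)]) (intro open_Collect_less continuous_intros)
  have x0: "x0 \<in> W'" using \<sigma>1[OF W(3)] W(3) by (auto simp: W'_def)
  have sub: "W' \<subseteq> W" "W' \<subseteq> U" using W(2) by (auto simp: W'_def)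
  have const: "\<sigma> x = \<sigma> x0" if "x \<in> W'" for x
    using that \<sigma>1[of x] \<sigma>1[OF W(3)] by (auto simp: W'_def)
  have u': "continuous_on W' u" "u ` W' \<subseteq> I"
    using continuous_on_subset[OF u(1) sub(1)] u(2) sub(1) by auto
  consider "\<sigma> x0 = 1" | "\<sigma> x0 = -1" using \<sigma>1[OF W(3)] by blast
  then have "parallel_to_conical_surface c r (\<phi> ` W')"
  proof cases
    case 1
    show ?thesis
    proof (rule parallel_surface_patch[OF \<beta> W' sub(2) u'])
      show "\<tau> x = norm (\<tau> x) *\<^sub>R \<beta> (u x)" if "x \<in> W'" for x using \<tau>[of x] that sub(1) by blast
      show "n x = ?N (u x)" if "x \<in> W'" for x
        using n\<sigma>[of x] const[OF that] that sub(1) 1 by auto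
    qed
  next
    case 2
    show ?thesis
    proof (rule parallel_surface_patch[OF unit_speed_spherical_curve_reverse[OF \<beta>] W' sub(2), of "\<lambda>x. - u x"])
      show "continuous_on W' (\<lambda>x. - u x)" using u'(1) by (intro continuous_intros)
      show "(\<lambda>x. - u x) ` W' \<subseteq> uminus ` I" using u'(2) by auto
      show "\<tau> x = norm (\<tau> x) *\<^sub>R \<beta> (- (- u x))" if "x \<in> W'" for x using \<tau>[of x] that sub(1) by auto
      show "n x = spherical_normal 0 1 (\<lambda>s. \<beta> (- s)) (- u x)" if "x \<in> W'" for x
      proof -
        have "- (- u x) \<in> I" using u'(2) that by auto
        from vector_derivative_reverse[OF \<beta> this]
        have "spherical_normal 0 1 (\<lambda>s. \<beta> (- s)) (- u x) = - ?N (u x)"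
          by (simp add: spherical_normal_def)
        moreover have "n x = (-1) *\<^sub>R ?N (u x)"
          using n\<sigma>[of x] const[OF that] that sub(1) 2 by auto
        ultimately show ?thesis by simp
      qed
    qed
  qed
  then show ?thesis using that W' x0 sub(2) by blast
qed

text \<open>The rank-one map is \<open>T = \<tau> / \<parallel>\<tau>\<parallel>\<close>. It is constant in the direction of \<open>\<tau>\<close>, because \<open>D\<tau>(a) = \<tau>\<close> is radial. It
  is not constant to first order at \<open>x0\<close>, because there \<open>D\<tau> = D\<phi>\<close> has rank two.\<close>

lemma parallel_surface_if_Dn_zero:
  assumes x0: "x0 \<in> U" "\<tau> x0 \<noteq> 0" and Dn0: "\<And>v. Dn x0 v = 0"
  obtains W where "open W" "x0 \<in> W" "W \<subseteq> U" "parallel_to_conical_surface c r (\<phi> ` W)"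
proof -
  define U' where "U' = U \<inter> \<tau> -` (- {0})"
  have U': "open U'" unfolding U'_def
    by (rule continuous_open_preimage[OF smooth_on_imp_continuous_on[OF smooth_\<tau>] open_U]) (simp add: open_Compl)
  have sub: "U' \<subseteq> U" by (auto simp: U'_def)
  have U'D: "x \<in> U" "\<tau> x \<noteq> 0" if "x \<in> U'" for x using that by (auto simp: U'_def)
  have x0': "x0 \<in> U'" using x0 by (simp add: U'_def)
  have sm\<tau>: "smooth_on U' \<tau>" by (rule smooth_on_subset[OF smooth_\<tau> sub])
  define \<nu> where "\<nu> x = norm (\<tau> x)" for x
  define T where "T x = inverse (\<nu> x) *\<^sub>R \<tau> x" for x
  have sm\<nu>: "smooth_on U' \<nu>" unfolding \<nu>_def by (rule smooth_on_norm[OF U' sm\<tau> U'D(2)])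
  have \<nu>0: "\<nu> x \<noteq> 0" if "x \<in> U'" for x using U'D(2)[OF that] by (simp add: \<nu>_def)
  have smT: "smooth_on U' T" unfolding T_def
    by (rule smooth_on_scaleR[OF U' smooth_on_inverse[OF U' sm\<nu> \<nu>0] sm\<tau>])
  have \<tau>T: "\<tau> x = \<nu> x *\<^sub>R T x" if "x \<in> U'" for x using \<nu>0[OF that] by (simp add: T_def)
  have T1: "norm (T x) = 1" if "x \<in> U'" for x using U'D(2)[OF that] by (simp add: T_def \<nu>_def)
  let ?D\<nu> = "\<lambda>x. frechet_derivative \<nu> (at x)" and ?DT = "\<lambda>x. frechet_derivative T (at x)"
  have D\<tau>T: "frechet_derivative \<tau> (at x) v = ?D\<nu> x v *\<^sub>R T x + \<nu> x *\<^sub>R ?DT x v" if x: "x \<in> U'" for x v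
  proof -
    have "((\<lambda>x. \<nu> x *\<^sub>R T x) has_derivative (\<lambda>v. \<nu> x *\<^sub>R ?DT x v + ?D\<nu> x v *\<^sub>R T x)) (at x)"
      by (rule has_derivative_scaleR[OF smooth_on_derivative[OF sm\<nu> x] smooth_on_derivative[OF smT x]])
    then have "(\<tau> has_derivative (\<lambda>v. \<nu> x *\<^sub>R ?DT x v + ?D\<nu> x v *\<^sub>R T x)) (at x)"
      by (rule has_derivative_transform_within_open[OF _ U' x]) (simp add: \<tau>T)
    from fun_cong[OF frechet_derivative_at[OF this], of v] show ?thesis by (simp add: add.commute)
  qed
  have T_DT: "T x \<bullet> ?DT x v = 0" if x: "x \<in> U'" for x v
    using inner_constant_imp_derivative[OF U' x smT smT, of 1 v] T1
    by (simp add: norm_eq_1 inner_commute)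
  have rank: "\<exists>a. a \<noteq> 0 \<and> ?DT x a = 0" if x: "x \<in> U'" for x
  proof -
    obtain a where a: "a \<noteq> 0" "frechet_derivative \<tau> (at x) a = \<tau> x"
      using tangential_position_is_asymptotic[OF U'D[OF x]] by metis
    have eq: "\<nu> x *\<^sub>R T x = ?D\<nu> x a *\<^sub>R T x + \<nu> x *\<^sub>R ?DT x a"
      using a(2) D\<tau>T[OF x, of a] \<tau>T[OF x] by simp
    have "T x \<bullet> T x = 1" using T1[OF x] by (simp add: norm_eq_1)
    then have "\<nu> x = ?D\<nu> x a"
      using arg_cong[OF eq, of "\<lambda>y. T x \<bullet> y"] T_DT[OF x] by (simp add: inner_add_right)
    then have "?DT x a = 0" using eq \<nu>0[OF x] by simp
    then show ?thesis using a(1) by blast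
  qed
  \<comment> \<open>In a direction in which the length of \<open>\<tau>\<close> is stationary, \<open>T\<close> has to change.\<close>
  obtain b where b: "b \<noteq> 0" "?D\<nu> x0 b = 0"
    using linear_functional_kernel[OF has_derivative_linear[OF smooth_on_derivative[OF sm\<nu> x0']]] by blast
  have v: "?DT x0 b \<noteq> 0"
  proof
    assume "?DT x0 b = 0"
    then have "D\<phi> x0 b = 0" using D\<tau>T[OF x0', of b] b(2) D\<tau>[OF x0(1), of b] Dn0 by simp
    then show False using linear_injective_0[OF linear_D\<phi>[OF x0(1)]] immersion[OF x0(1)] b(1) by blast
  qed
  have nT: "n x \<bullet> T x = 0" if "x \<in> U'" for x
    using n_\<tau>[OF U'D(1)[OF that]] by (simp add: T_def)
  show ?thesis
  proof (rule rank_one_factorization[OF U' x0' smT rank v])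
    fix W I \<beta> u
    assume W: "open W" "x0 \<in> W" "W \<subseteq> U'" and I: "open I" "is_interval I"
      and \<beta>: "smooth_on I \<beta>" "\<And>s. s \<in> I \<Longrightarrow> norm (vector_derivative \<beta> (at s)) = 1" "\<beta> ` I \<subseteq> T ` U'"
      and u: "continuous_on W u" "u ` W \<subseteq> I" "\<And>x. x \<in> W \<Longrightarrow> T x = \<beta> (u x)"
      and vel: "\<And>x. x \<in> W \<Longrightarrow> \<exists>w. vector_derivative \<beta> (at (u x)) = ?DT x w"
    have "\<beta> s \<in> sphere 0 1" if s: "s \<in> I" for s
    proof -
      obtain x where "x \<in> U'" "\<beta> s = T x" using \<beta>(3) s by blast
      then show ?thesis using T1[of x] by simp
    qed
    then have curve: "unit_speed_spherical_curve 0 1 I \<beta>"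
      using I \<beta> by (simp add: unit_speed_spherical_curve_def)
    have WU: "x \<in> U'" "x \<in> U" if "x \<in> W" for x using that W(3) sub by auto
    have WsubU: "W \<subseteq> U" using W(3) sub by blast
    have \<tau>\<beta>: "\<tau> x = norm (\<tau> x) *\<^sub>R \<beta> (u x)" if "x \<in> W" for x
      using \<tau>T[OF WU(1)[OF that]] u(3)[OF that] by (simp add: \<nu>_def)
    have n1: "n x \<bullet> \<beta> (u x) = 0" if "x \<in> W" for x
      using nT[OF WU(1)[OF that]] u(3)[OF that] by simp
    have n2: "n x \<bullet> vector_derivative \<beta> (at (u x)) = 0" if x: "x \<in> W" for x
    proof -
      obtain w where w: "vector_derivative \<beta> (at (u x)) = ?DT x w" using vel[OF x] by blast
      have "n x \<bullet> ?DT x w + Dn x w \<bullet> T x = 0"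
        by (rule inner_constant_imp_derivative[OF U' WU(1)[OF x] smooth_on_subset[OF smooth_n sub] smT nT])
      moreover have "Dn x w \<bullet> T x = 0" using Dn_\<tau>[OF WU(2)[OF x]] by (simp add: T_def)
      ultimately show ?thesis using w by simp
    qed
    show thesis
      by (rule parallel_surface_if_normal_along_cone[OF curve W(1) WsubU W(2) u(1,2) \<tau>\<beta> n1 n2 that])
  qed
qed

text \<open>At \<open>x0\<close> one has \<open>D\<tau> = D\<phi>\<close>, so the components of \<open>\<tau>\<close> in the tangent plane of \<open>x0\<close> are local coordinates \<open>G\<close>
  with \<open>G x0 = 0\<close>. In these coordinates the direction \<open>a\<close> with \<open>Dn(a) = 0\<close> and \<open>D\<tau>(a) = \<tau>\<close> is the radial
  one, so \<open>n\<close> is constant along the rays from \<open>0\<close>.\<close>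

lemma normal_constant_at_planar_foot_point:
  assumes x0: "x0 \<in> U" "\<tau> x0 = 0" and Dn0: "\<And>v. Dn x0 v = 0"
  obtains W \<rho> H where "open W" "x0 \<in> W" "W \<subseteq> U" "0 < \<rho>" "\<And>x. x \<in> W \<Longrightarrow> n x = n x0"
    "\<And>x. x \<in> W \<Longrightarrow> (\<tau> x \<bullet> D\<phi> x0 (1, 0), \<tau> x \<bullet> D\<phi> x0 (0, 1)) \<in> ball 0 \<rho>"
    "\<And>y. y \<in> ball 0 \<rho> \<Longrightarrow> H y \<in> W \<and> (\<tau> (H y) \<bullet> D\<phi> x0 (1, 0), \<tau> (H y) \<bullet> D\<phi> x0 (0, 1)) = y"
proof -
  define p q where "p = D\<phi> x0 (1, 0)" and "q = D\<phi> x0 (0, 1)"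
  define G where "G x = (\<tau> x \<bullet> p, \<tau> x \<bullet> q)" for x
  have G: "smooth_on U G" unfolding G_def
    by (rule smooth_on_Pair[OF open_U smooth_on_linear[OF bounded_linear_inner_left open_U smooth_\<tau>]
          smooth_on_linear[OF bounded_linear_inner_left open_U smooth_\<tau>]])
  have dG: "frechet_derivative G (at x) w
      = (frechet_derivative \<tau> (at x) w \<bullet> p, frechet_derivative \<tau> (at x) w \<bullet> q)" if x: "x \<in> U" for x w
  proof -
    note d\<tau> = smooth_on_derivative[OF smooth_\<tau> x]
    have "(G has_derivative (\<lambda>w. (frechet_derivative \<tau> (at x) w \<bullet> p,
        frechet_derivative \<tau> (at x) w \<bullet> q))) (at x)" unfolding G_def
      by (rule has_derivative_Pair[OF bounded_linear.has_derivative[OF bounded_linear_inner_left d\<tau>]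
            bounded_linear.has_derivative[OF bounded_linear_inner_left d\<tau>]])
    from fun_cong[OF frechet_derivative_at[OF this], of w] show ?thesis by simp
  qed
  have D\<phi>_pq: "D\<phi> x0 w = fst w *\<^sub>R p + snd w *\<^sub>R q" for w
    unfolding p_def q_def by (rule linear_plane_expansion[OF linear_D\<phi>[OF x0(1)]])
  have inj: "w = 0" if "frechet_derivative G (at x0) w = 0" for w
  proof -
    have "D\<phi> x0 w \<bullet> p = 0" "D\<phi> x0 w \<bullet> q = 0"
      using that dG[OF x0(1), of w] D\<tau>[OF x0(1), of w] Dn0 by (simp_all add: zero_prod_def)
    then have "D\<phi> x0 w \<bullet> D\<phi> x0 w = 0"
      using arg_cong[OF D\<phi>_pq[of w], of "\<lambda>y. D\<phi> x0 w \<bullet> y"] by (simp add: inner_add_right)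
    then have "D\<phi> x0 w = 0" by simp
    then show "w = 0" using linear_injective_0[OF linear_D\<phi>[OF x0(1)]] immersion[OF x0(1)] by blast
  qed
  obtain W0 V H H' where W0: "open W0" "x0 \<in> W0" "W0 \<subseteq> U" and V: "open V"
    and hom: "homeomorphism W0 V G H"
    and dH: "\<And>y. y \<in> V \<Longrightarrow> (H has_derivative H' y) (at y)"
    and GH': "\<And>y w. y \<in> V \<Longrightarrow> frechet_derivative G (at (H y)) (H' y w) = w"
    using smooth_inverse_function[OF open_U x0(1) G inj] by metis
  have GV: "G x \<in> V" if "x \<in> W0" for x using homeomorphism_image1[OF hom] that by blast
  have HW: "H y \<in> W0" if "y \<in> V" for y using homeomorphism_image2[OF hom] that by blast
  have HG: "H (G x) = x" if "x \<in> W0" for x using homeomorphism_apply1[OF hom that] .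
  have GH: "G (H y) = y" if "y \<in> V" for y using homeomorphism_apply2[OF hom that] .
  have G0: "G x0 = 0" by (simp add: G_def x0(2) zero_prod_def)
  obtain \<rho> where \<rho>: "0 < \<rho>" "ball 0 \<rho> \<subseteq> V"
    using V GV[OF W0(2)] open_contains_ball unfolding G0 by blast
  have const: "n (H y) = n x0" if y: "y \<in> ball 0 \<rho>" for y
  proof (cases "y = 0")
    case True
    then show ?thesis using HG[OF W0(2)] G0 by simp
  next
    case False
    define F where "F t = n (H (t *\<^sub>R y))" for t :: real
    have tV: "t *\<^sub>R y \<in> V" if "t \<in> {0..1}" for t :: real
    proof -
      have "norm (t *\<^sub>R y) \<le> norm y" using that by (simp add: mult_left_le_one_le)
      then have "t *\<^sub>R y \<in> ball 0 \<rho>" using y by (simp add: mem_ball_0)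
      then show ?thesis using \<rho>(2) by blast
    qed
    have dF: "(F has_derivative (\<lambda>h. Dn (H (t *\<^sub>R y)) (H' (t *\<^sub>R y) (h *\<^sub>R y)))) (at t)"
      if t: "t \<in> {0..1}" for t
    proof -
      have "((\<lambda>t. t *\<^sub>R y) has_derivative (\<lambda>h. h *\<^sub>R y)) (at t)"
        by (rule bounded_linear_imp_has_derivative[OF bounded_linear_scaleR_left])
      from diff_chain_at[OF this dH[OF tV[OF t]]]
      have d: "((\<lambda>t. H (t *\<^sub>R y)) has_derivative (\<lambda>h. H' (t *\<^sub>R y) (h *\<^sub>R y))) (at t)"
        by (simp add: o_def)
      have "H (t *\<^sub>R y) \<in> U" using HW[OF tV[OF t]] W0(3) by blast
      from diff_chain_at[OF d has_derivative_n[OF this]] show ?thesis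
        by (simp add: F_def[abs_def] o_def)
    qed
    have dF0: "(F has_derivative (\<lambda>h. 0)) (at t within {0..1})" if t: "t \<in> {0..1} - {0}" for t
    proof -
      have t': "t \<in> {0..1}" "t \<noteq> 0" using t by auto
      let ?x = "H (t *\<^sub>R y)"
      have xU: "?x \<in> U" using HW[OF tV[OF t'(1)]] W0(3) by blast
      have linG: "linear (frechet_derivative G (at ?x))"
        by (rule has_derivative_linear[OF smooth_on_derivative[OF G xU]])
      have "surj (frechet_derivative G (at ?x))"
        using GH'[OF tV[OF t'(1)]] by (metis surjI)
      then have injG: "inj (frechet_derivative G (at ?x))"
        by (intro linear_surjective_imp_injective[OF linG]) auto
      have "G ?x \<noteq> 0" using GH[OF tV[OF t'(1)]] t'(2) False by simp
      then have "\<tau> ?x \<noteq> 0" by (auto simp: G_def zero_prod_def)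
      then obtain a where a: "Dn ?x a = 0" "frechet_derivative \<tau> (at ?x) a = \<tau> ?x"
        using tangential_position_is_asymptotic[OF xU] by metis
      have "frechet_derivative G (at ?x) a = G ?x" unfolding dG[OF xU] a(2) by (simp add: G_def)
      then have Ga: "frechet_derivative G (at ?x) a = t *\<^sub>R y" using GH[OF tV[OF t'(1)]] by simp
      have "Dn ?x (H' (t *\<^sub>R y) (h *\<^sub>R y)) = 0" for h
      proof -
        have "frechet_derivative G (at ?x) (H' (t *\<^sub>R y) (h *\<^sub>R y)) = frechet_derivative G (at ?x) ((h / t) *\<^sub>R a)"
          using GH'[OF tV[OF t'(1)]] Ga t'(2) linear_cmul[OF linG] by simp
        then have "H' (t *\<^sub>R y) (h *\<^sub>R y) = (h / t) *\<^sub>R a" using injG by (simp add: inj_eq)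
        then show ?thesis using a(1) linear_cmul[OF linear_Dn[OF xU]] by simp
      qed
      then have "(F has_derivative (\<lambda>h. 0)) (at t)" using dF[OF t'(1)] by simp
      then show ?thesis by (rule has_derivative_at_withinI)
    qed
    have contF: "continuous_on {0..1} F"
      by (intro continuous_at_imp_continuous_on ballI has_derivative_continuous[OF dF])
    have "F 1 = F 0"
      by (rule has_derivative_zero_unique_strong_interval[OF _ contF refl dF0, of "{0}"]) auto
    then show ?thesis using HG[OF W0(2)] G0 by (simp add: F_def)
  qed
  define W where "W = W0 \<inter> G -` ball 0 \<rho>"
  have contG: "continuous_on W0 G" using hom by (simp add: homeomorphism_def)
  show ?thesis
  proof (rule that[of W \<rho> H, folded p_def q_def])
    show "open W" unfolding W_def by (rule continuous_open_preimage[OF contG W0(1)]) simp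
    show "x0 \<in> W" using W0(2) G0 \<rho>(1) by (simp add: W_def)
    show "W \<subseteq> U" using W0(3) by (auto simp: W_def)
    show "0 < \<rho>" by (rule \<rho>(1))
    show "n x = n x0" if "x \<in> W" for x
      using const[of "G x"] HG[of x] that by (auto simp: W_def)
    show "(\<tau> x \<bullet> p, \<tau> x \<bullet> q) \<in> ball 0 \<rho>" if "x \<in> W" for x
      using that by (simp add: W_def G_def)
    show "H y \<in> W \<and> (\<tau> (H y) \<bullet> p, \<tau> (H y) \<bullet> q) = y" if y: "y \<in> ball 0 \<rho>" for y
    proof -
      have "y \<in> V" using \<rho>(2) y by blast
      then show ?thesis using HW[of y] GH[of y] y by (simp add: W_def G_def)
    qed
  qed
qed

text \<open>A plane at distance \<open>r\<close> from \<open>c\<close> is parallel to the cone over a great circle. Polar coordinates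
  around \<open>c + r n\<close> cover a whole neighbourhood, including the vertex, since \<open>z = 0\<close> is admitted.\<close>

lemma parallel_surface_at_planar_foot_point:
  assumes x0: "x0 \<in> U" "\<tau> x0 = 0" and Dn0: "\<And>v. Dn x0 v = 0"
  obtains W where "open W" "x0 \<in> W" "W \<subseteq> U" "parallel_to_conical_surface c r (\<phi> ` W)"
proof -
  define p q where "p = D\<phi> x0 (1, 0)" and "q = D\<phi> x0 (0, 1)"
  show ?thesis
  proof (rule normal_constant_at_planar_foot_point[OF x0 Dn0, folded p_def q_def])
    fix W \<rho> H
    assume W: "open W" "x0 \<in> W" "W \<subseteq> U" and \<rho>: "0 < \<rho>" and const: "\<And>x. x \<in> W \<Longrightarrow> n x = n x0"
      and inball: "\<And>x. x \<in> W \<Longrightarrow> (\<tau> x \<bullet> p, \<tau> x \<bullet> q) \<in> ball 0 \<rho>"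
      and H: "\<And>y. y \<in> ball 0 \<rho> \<Longrightarrow> H y \<in> W \<and> (\<tau> (H y) \<bullet> p, \<tau> (H y) \<bullet> q) = y"
  have D\<phi>_pq: "D\<phi> x0 w = fst w *\<^sub>R p + snd w *\<^sub>R q" for w
    unfolding p_def q_def by (rule linear_plane_expansion[OF linear_D\<phi>[OF x0(1)]])
  have tangent0: "y = 0" if y: "n x0 \<bullet> y = 0" "y \<bullet> p = 0" "y \<bullet> q = 0" for y
  proof -
    obtain w where w: "D\<phi> x0 w = y" using tangent_vector_in_range[OF x0(1) y(1)] by blast
    have "y \<bullet> y = 0"
      using y(2,3) arg_cong[OF D\<phi>_pq[of w, unfolded w], of "\<lambda>z. y \<bullet> z"] by (simp add: inner_add_right)
    then show "y = 0" by simp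
  qed
  have "p \<noteq> 0"
  proof
    assume "p = 0"
    then have "(1, 0) = (0 :: real \<times> real)"
      using linear_injective_0[OF linear_D\<phi>[OF x0(1)]] immersion[OF x0(1)] unfolding p_def by blast
    then show False by (simp add: zero_prod_def)
  qed
  define a where "a = (1 / norm p) *\<^sub>R p"
  define b where "b = cross3 (n x0) a"
  have a1: "norm a = 1" using \<open>p \<noteq> 0\<close> by (simp add: a_def)
  have na: "n x0 \<bullet> a = 0" using normal_n[OF x0(1)] by (simp add: a_def p_def)
  have ab: "a \<bullet> b = 0" "n x0 \<bullet> b = 0" by (simp_all add: b_def dot_cross_self)
  have "(norm b)\<^sup>2 = 1"
    using norm_cross_dot[of "n x0" a] na a1 unit_n[OF x0(1)] by (simp add: b_def)
  then have b1: "norm b = 1"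
    unfolding power2_eq_1_iff using norm_ge_zero[of b] by linarith
  have axb: "cross3 a b = n x0"
    using na a1 by (simp add: b_def Lagrange inner_commute norm_eq_1)
  define \<beta> where "\<beta> s = cos s *\<^sub>R a + sin s *\<^sub>R b" for s
  have \<beta>: "unit_speed_spherical_curve 0 1 UNIV \<beta>" "spherical_normal 0 1 \<beta> s = n x0" for s
    using great_circle[OF a1 b1 ab(1)] axb by (simp_all add: \<beta>_def[abs_def])
  have n\<beta>: "n x0 \<bullet> \<beta> s = 0" for s by (simp add: \<beta>_def inner_add_right na ab)
  define Q where "Q = (\<lambda>(s, z). ((z *\<^sub>R \<beta> s) \<bullet> p, (z *\<^sub>R \<beta> s) \<bullet> q)) -` ball 0 \<rho>"
  let ?X = "\<lambda>(s, z). c + z *\<^sub>R \<beta> s + r *\<^sub>R spherical_normal 0 1 \<beta> s"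
  have openQ: "open Q" unfolding Q_def
    by (rule open_vimage[OF open_ball])
       (auto simp: \<beta>_def split_beta intro!: continuous_intros)
  have \<phi>\<tau>: "\<phi> x = c + \<tau> x + r *\<^sub>R n x0" if "x \<in> W" for x using const[OF that] by (simp add: \<tau>_def)
  have n\<tau>: "n x0 \<bullet> \<tau> x = 0" if "x \<in> W" for x using n_\<tau>[of x] const[OF that] that W(3) by auto
  have "\<phi> ` W = ?X ` Q"
  proof
    show "\<phi> ` W \<subseteq> ?X ` Q"
    proof
      fix y assume "y \<in> \<phi> ` W"
      then obtain x where x: "x \<in> W" "y = \<phi> x" by blast
      obtain z s where zs: "\<tau> x \<bullet> a = z * cos s" "\<tau> x \<bullet> b = z * sin s"
        using polar_Ex[of "\<tau> x \<bullet> a" "\<tau> x \<bullet> b"] by blast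
      have "\<tau> x \<bullet> n x0 = 0" using n\<tau>[OF x(1)] by (simp add: inner_commute)
      then have "\<tau> x = (\<tau> x \<bullet> a) *\<^sub>R a + (\<tau> x \<bullet> b) *\<^sub>R b"
        using frame_expansion[OF a1 b1 ab(1), of "\<tau> x"] unfolding axb by simp
      also have "\<dots> = z *\<^sub>R \<beta> s" unfolding zs by (simp add: \<beta>_def scaleR_add_right)
      finally have \<tau>: "\<tau> x = z *\<^sub>R \<beta> s" .
      then have "(s, z) \<in> Q" using inball[OF x(1)] by (simp add: Q_def)
      moreover have "y = ?X (s, z)" using \<phi>\<tau>[OF x(1)] \<tau> by (simp add: x(2) \<beta>(2))
      ultimately show "y \<in> ?X ` Q" by blast
    qed
    show "?X ` Q \<subseteq> \<phi> ` W"
    proof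
      fix y assume "y \<in> ?X ` Q"
      then obtain s z where sz: "(s, z) \<in> Q" "y = ?X (s, z)" by auto
      define x where "x = H ((z *\<^sub>R \<beta> s) \<bullet> p, (z *\<^sub>R \<beta> s) \<bullet> q)"
      have "((z *\<^sub>R \<beta> s) \<bullet> p, (z *\<^sub>R \<beta> s) \<bullet> q) \<in> ball 0 \<rho>" using sz(1) by (simp add: Q_def)
      from H[OF this] have x: "x \<in> W" "\<tau> x \<bullet> p = (z *\<^sub>R \<beta> s) \<bullet> p" "\<tau> x \<bullet> q = (z *\<^sub>R \<beta> s) \<bullet> q"
        unfolding x_def[symmetric] by auto
      have "\<tau> x - z *\<^sub>R \<beta> s = 0"
        by (rule tangent0) (simp_all only: inner_diff_left inner_diff_right inner_scaleR_right x n\<beta> n\<tau>[OF x(1)] diff_self mult_zero_right)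
      then have "y = \<phi> x" using \<phi>\<tau>[OF x(1)] sz(2) by (simp add: \<beta>(2))
      then show "y \<in> \<phi> ` W" using x(1) by blast
    qed
  qed
  then have "parallel_to_conical_surface c r (\<phi> ` W)"
    unfolding parallel_to_conical_surface_def using r_pos \<beta>(1) openQ
    by (intro conjI exI[of _ UNIV] exI[of _ \<beta>] exI[of _ Q]) auto
  then show thesis by (rule that[OF W])
  qed
qed

theorem locally_normal_or_parallel:
  assumes rank: "\<And>x. x \<in> U \<Longrightarrow> \<exists>a. a \<noteq> 0 \<and> Dn x a = 0" and x0: "x0 \<in> U"
  obtains W where "open W" "x0 \<in> W" "W \<subseteq> U"
    "normal_surface_to_spherical_curve c r (\<phi> ` W) \<or> parallel_to_conical_surface c r (\<phi> ` W)"
proof (cases "\<exists>v. Dn x0 v \<noteq> 0")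
  case True
  then obtain v where v: "Dn x0 v \<noteq> 0" by blast
  show ?thesis
  proof (rule normal_surface_if_Dn_nonzero[OF rank x0 v])
    fix W assume W: "open W" "x0 \<in> W" "W \<subseteq> U" "normal_surface_to_spherical_curve c r (\<phi> ` W)"
    show thesis by (rule that[OF W(1-3)]) (simp add: W(4))
  qed
next
  case False
  then have Dn0: "\<And>v. Dn x0 v = 0" by blast
  show ?thesis
  proof (cases "\<tau> x0 = 0")
    case True
    show ?thesis
    proof (rule parallel_surface_at_planar_foot_point[OF x0 True Dn0])
      fix W assume W: "open W" "x0 \<in> W" "W \<subseteq> U" "parallel_to_conical_surface c r (\<phi> ` W)"
      show thesis by (rule that[OF W(1-3)]) (simp add: W(4))
    qed
  next
    case False
    show ?thesis
    proof (rule parallel_surface_if_Dn_zero[OF x0 False Dn0])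
      fix W assume W: "open W" "x0 \<in> W" "W \<subseteq> U" "parallel_to_conical_surface c r (\<phi> ` W)"
      show thesis by (rule that[OF W(1-3)]) (simp add: W(4))
    qed
  qed
qed

end

section \<open>Charts and normals of surfaces\<close>

text \<open>The data whose existence at each point makes a set a surface.\<close>

definition chart :: "(real^3) set \<Rightarrow> (real^3) set \<Rightarrow> (real \<times> real) set \<Rightarrow> (real \<times> real \<Rightarrow> real^3) \<Rightarrow>
    (real^3 \<Rightarrow> real \<times> real) \<Rightarrow> bool" where
  "chart M V U \<phi> \<psi> \<longleftrightarrow> openin (top_of_set M) V \<and> open U \<and> smooth_on U \<phi> \<and>
     (\<forall>x\<in>U. inj (frechet_derivative \<phi> (at x))) \<and> homeomorphism U V \<phi> \<psi>"

definition chart_normal :: "(real \<times> real \<Rightarrow> real^3) \<Rightarrow> real \<times> real \<Rightarrow> real^3" where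
  "chart_normal \<phi> x = cross3 (frechet_derivative \<phi> (at x) (1, 0)) (frechet_derivative \<phi> (at x) (0, 1))"

lemma surface_chart:
  assumes "surface M" "p \<in> M"
  obtains V U \<phi> \<psi> x where "chart M V U \<phi> \<psi>" "x \<in> U" "\<phi> x = p"
proof -
  obtain V and U :: "(real \<times> real) set" and \<phi> \<psi>
    where *: "openin (top_of_set M) V" "p \<in> V" "open U" "smooth_on U \<phi>"
    "\<forall>x\<in>U. inj (frechet_derivative \<phi> (at x))" "homeomorphism U V \<phi> \<psi>"
    using assms unfolding surface_def by blast
  then have "chart M V U \<phi> \<psi>" by (simp add: chart_def)
  moreover have "\<psi> p \<in> U" "\<phi> (\<psi> p) = p"
    using homeomorphism_image2[OF *(6)] homeomorphism_apply2[OF *(6)] *(2) by blast+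
  ultimately show ?thesis by (rule that)
qed

context
  fixes M V U \<phi> \<psi>
  assumes chart: "chart M V U \<phi> \<psi>"
begin

lemma chartD:
  "openin (top_of_set M) V" "open U" "smooth_on U \<phi>" "homeomorphism U V \<phi> \<psi>"
  "x \<in> U \<Longrightarrow> inj (frechet_derivative \<phi> (at x))"
  using chart unfolding chart_def by blast+

lemma chart_mem: "x \<in> U \<Longrightarrow> \<phi> x \<in> V" "x \<in> U \<Longrightarrow> \<phi> x \<in> M" "q \<in> V \<Longrightarrow> \<psi> q \<in> U"
    "x \<in> U \<Longrightarrow> \<psi> (\<phi> x) = x" "q \<in> V \<Longrightarrow> \<phi> (\<psi> q) = q"
proof -
  show *: "\<phi> x \<in> V" if "x \<in> U" for x using homeomorphism_image1[OF chartD(4)] that by blast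
  show "\<phi> x \<in> M" if "x \<in> U" using *[OF that] openin_subset[OF chartD(1)] by auto
  show "\<psi> q \<in> U" if "q \<in> V" using homeomorphism_image2[OF chartD(4)] that by blast
  show "\<psi> (\<phi> x) = x" if "x \<in> U" by (rule homeomorphism_apply1[OF chartD(4) that])
  show "\<phi> (\<psi> q) = q" if "q \<in> V" by (rule homeomorphism_apply2[OF chartD(4) that])
qed

lemma chart_linear: "x \<in> U \<Longrightarrow> linear (frechet_derivative \<phi> (at x))"
  by (rule has_derivative_linear[OF smooth_on_derivative[OF chartD(3)]])

lemma chart_open_image:
  assumes "open W" "W \<subseteq> U" shows "openin (top_of_set M) (\<phi> ` W)"
proof -
  have "openin (top_of_set U) W" using assms chartD(2) by (simp add: open_subset)
  then have "openin (top_of_set V) (\<phi> ` W)" by (rule homeomorphism_imp_open_map[OF chartD(4)])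
  then show ?thesis using chartD(1) by (rule openin_trans)
qed

lemma chart_normal_smooth: "smooth_on U (chart_normal \<phi>)"
proof -
  have "smooth_on U (\<lambda>x. cross3 (frechet_derivative \<phi> (at x) (1, 0)) (frechet_derivative \<phi> (at x) (0, 1)))"
    by (rule smooth_on_cross3[OF chartD(2) smooth_on_frechet_derivative[OF chartD(3)]
          smooth_on_frechet_derivative[OF chartD(3)]])
  then show ?thesis by (simp add: chart_normal_def[abs_def])
qed

lemma chart_normal_nonzero: 
  assumes "x \<in> U" shows "chart_normal \<phi> x \<noteq> 0"
  using kernel_iff_cross3_eq_0[OF chart_linear[OF assms]]
    linear_injective_0[OF chart_linear[OF assms]] chartD(5)[OF assms]
  unfolding chart_normal_def by blast

lemma chart_normal_orthogonal:
  assumes "x \<in> U" shows "chart_normal \<phi> x \<bullet> frechet_derivative \<phi> (at x) v = 0"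
  unfolding linear_plane_expansion[OF chart_linear[OF assms], of v] chart_normal_def
  by (simp add: inner_add_right dot_cross_self)

lemma orthogonal_imp_parallel_chart_normal:
  assumes x: "x \<in> U" and w: "\<And>v. w \<bullet> frechet_derivative \<phi> (at x) v = 0"
  shows "\<exists>k. w = k *\<^sub>R chart_normal \<phi> x"
proof -
  let ?n = "chart_normal \<phi> x"
  have "cross3 w ?n = 0" unfolding chart_normal_def by (simp add: Lagrange w)
  then have "(?n \<bullet> ?n) *\<^sub>R w - (?n \<bullet> w) *\<^sub>R ?n = 0"
    using Lagrange[of ?n w ?n] by simp
  then have eq: "(?n \<bullet> ?n) *\<^sub>R w = (?n \<bullet> w) *\<^sub>R ?n" by simp
  have "w = (1 / (?n \<bullet> ?n)) *\<^sub>R ((?n \<bullet> ?n) *\<^sub>R w)" using chart_normal_nonzero[OF x] by simp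
  also have "\<dots> = ((?n \<bullet> w) / (?n \<bullet> ?n)) *\<^sub>R ?n" unfolding eq by simp
  finally show ?thesis by blast
qed

lemma chart_velocity_tangent:
  assumes x: "x \<in> U" shows "frechet_derivative \<phi> (at x) v \<in> tangent_space M (\<phi> x)"
proof -
  have "open ((\<lambda>t. x + t *\<^sub>R v) -` U)"
    by (rule open_vimage[OF chartD(2)]) (intro continuous_intros)
  moreover have "0 \<in> (\<lambda>t. x + t *\<^sub>R v) -` U" using x by simp
  ultimately obtain e where e: "0 < e" "ball 0 e \<subseteq> (\<lambda>t. x + t *\<^sub>R v) -` U"
    using open_contains_ball by blast
  have mem: "x + t *\<^sub>R v \<in> U" if "t \<in> {-e<..<e}" for t
  proof -
    have "t \<in> ball 0 e" using that by auto
    then show ?thesis using e(2) by blast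
  qed
  define \<gamma> where "\<gamma> t = \<phi> (x + t *\<^sub>R v)" for t
  have 1: "smooth_on {-e<..<e} \<gamma>" unfolding \<gamma>_def
    by (rule smooth_on_affine[OF chartD(2) bounded_linear_scaleR_left chartD(3) _ mem]) auto
  have 2: "\<gamma> ` {-e<..<e} \<subseteq> M" unfolding \<gamma>_def using mem chart_mem(2) by blast
  have 3: "vector_derivative \<gamma> (at 0) = frechet_derivative \<phi> (at x) v"
    using vector_derivative_at[OF has_vector_derivative_along_line[OF chartD(3), of x 0 v]] x
    by (simp add: \<gamma>_def[abs_def])
  have "\<gamma> 0 = \<phi> x" by (simp add: \<gamma>_def)
  then show ?thesis unfolding tangent_space_def using 1 2 3[symmetric] e(1) by blast
qed

text \<open>A curve in \<open>M\<close> is only known to be \<open>\<phi> \<circ> (\<psi> \<circ> \<gamma>)\<close> with \<open>\<psi> \<circ> \<gamma>\<close> continuous. As \<open>\<phi>\<close> is an immersion,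
  \<open>\<phi> y - \<phi> x\<close> deviates from the tangent plane by \<open>o(\<parallel>\<phi> y - \<phi> x\<parallel>)\<close>, which suffices.\<close>

lemma curve_velocity_orthogonal:
  assumes x: "x \<in> U" and w: "\<And>v. w \<bullet> frechet_derivative \<phi> (at x) v = 0"
    and \<gamma>: "(\<gamma> has_vector_derivative g) (at 0)" "\<gamma> 0 = \<phi> x" "\<forall>\<^sub>F t in at 0. \<gamma> t \<in> M"
  shows "w \<bullet> g = 0"
proof -
  let ?L = "frechet_derivative \<phi> (at x)"
  obtain m where m: "0 < m" "\<And>v. m * norm v \<le> norm (?L v)"
    using linear_inj_bounded_below_pos[OF chart_linear[OF x] chartD(5)[OF x]] by blast
  obtain Ov where Ov: "open Ov" "V = M \<inter> Ov" using chartD(1) by (auto simp: openin_open)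
  have cont\<gamma>: "(\<gamma> \<longlongrightarrow> \<phi> x) (at 0)"
    using has_vector_derivative_continuous[OF \<gamma>(1)] \<gamma>(2) by (simp add: continuous_within)
  have "\<phi> x \<in> Ov" using chart_mem(1)[OF x] Ov(2) by blast
  from topological_tendstoD[OF cont\<gamma> Ov(1) this] \<gamma>(3)
  have evV: "\<forall>\<^sub>F t in at 0. \<gamma> t \<in> V" by eventually_elim (simp add: Ov(2))
  have "continuous_on V \<psi>" using chartD(4) by (simp add: homeomorphism_def)
  then have "((\<lambda>t. \<psi> (\<gamma> t)) \<longlongrightarrow> \<psi> (\<phi> x)) (at 0)"
    by (rule continuous_on_tendsto_compose[OF _ cont\<gamma> chart_mem(1)[OF x] evV])
  then have cont\<psi>: "((\<lambda>t. \<psi> (\<gamma> t)) \<longlongrightarrow> x) (at 0)" using chart_mem(4)[OF x] by simp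
  have bound: "\<bar>w \<bullet> g\<bar> \<le> e * (norm w * (2 / m) * (norm g + 1) + norm w)" if e: "0 < e" "e < 1" "e < m / 2" for e
  proof -
    from smooth_on_derivative[OF chartD(3) x] e(1) obtain d where d: "0 < d"
      "\<And>y. norm (y - x) < d \<Longrightarrow> norm (\<phi> y - \<phi> x - ?L (y - x)) \<le> e * norm (y - x)"
      unfolding has_derivative_at_alt by blast
    from \<gamma>(1) e(1) obtain d' where d': "0 < d'"
      "\<And>t. norm (t - 0) < d' \<Longrightarrow> norm (\<gamma> t - \<gamma> 0 - (t - 0) *\<^sub>R g) \<le> e * norm (t - 0)"
      unfolding has_vector_derivative_def has_derivative_at_alt by blast
    have "\<forall>\<^sub>F t in at (0::real). dist t 0 < d'" using d'(1) eventually_at by blast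
    moreover have "\<forall>\<^sub>F t in at 0. dist (\<psi> (\<gamma> t)) x < d" by (rule tendstoD[OF cont\<psi> d(1)])
    moreover have "\<forall>\<^sub>F t in at (0::real). t \<noteq> 0" by (simp add: eventually_at_filter)
    ultimately have "\<forall>\<^sub>F t in at 0. dist t 0 < d' \<and> dist (\<psi> (\<gamma> t)) x < d \<and> t \<noteq> 0 \<and> \<gamma> t \<in> V"
      using evV by eventually_elim simp
    then obtain t where t: "dist t 0 < d'" "dist (\<psi> (\<gamma> t)) x < d" "t \<noteq> 0" "\<gamma> t \<in> V"
      using eventually_happens'[OF at_neq_bot] by blast
    define y where "y = \<psi> (\<gamma> t)"
    define \<Delta> where "\<Delta> = \<gamma> t - \<gamma> 0"
    have \<Delta>y: "\<Delta> = \<phi> y - \<phi> x" using chart_mem(5)[OF t(4)] \<gamma>(2) by (simp add: \<Delta>_def y_def)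
    have R: "norm (\<Delta> - ?L (y - x)) \<le> e * norm (y - x)"
      using d(2)[of y] t(2) by (simp add: \<Delta>y y_def dist_norm)
    have "norm (?L (y - x)) \<le> norm \<Delta> + norm (\<Delta> - ?L (y - x))"
      by (metis norm_minus_commute norm_triangle_sub)
    then have "m * norm (y - x) \<le> norm \<Delta> + e * norm (y - x)" using m(2)[of "y - x"] R by linarith
    moreover have "e * norm (y - x) \<le> m / 2 * norm (y - x)" using e(3) by (intro mult_right_mono) auto
    ultimately have "m / 2 * norm (y - x) \<le> norm \<Delta>" by linarith
    then have yx: "norm (y - x) \<le> 2 / m * norm \<Delta>" using m(1) by (simp add: field_simps)
    have "w \<bullet> \<Delta> = w \<bullet> (\<Delta> - ?L (y - x))" by (simp add: inner_diff_right w)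
    then have "\<bar>w \<bullet> \<Delta>\<bar> \<le> norm w * norm (\<Delta> - ?L (y - x))" using Cauchy_Schwarz_ineq2 by metis
    also have "\<dots> \<le> norm w * (e * (2 / m * norm \<Delta>))"
      using R yx e(1) by (intro mult_left_mono order_trans[OF R] ) auto
    finally have w\<Delta>: "\<bar>w \<bullet> \<Delta>\<bar> \<le> e * (norm w * (2 / m)) * norm \<Delta>" by (simp add: mult_ac)
    have G: "norm (\<Delta> - t *\<^sub>R g) \<le> e * \<bar>t\<bar>" using d'(2)[of t] t(1) by (simp add: \<Delta>_def dist_norm)
    have "norm \<Delta> \<le> norm (t *\<^sub>R g) + norm (\<Delta> - t *\<^sub>R g)"
      by (metis norm_triangle_sub)
    also have "\<dots> \<le> \<bar>t\<bar> * norm g + 1 * \<bar>t\<bar>"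
      using G e(2) mult_right_mono[of e 1 "\<bar>t\<bar>"] by simp
    finally have \<Delta>t: "norm \<Delta> \<le> \<bar>t\<bar> * (norm g + 1)" by (simp add: algebra_simps)
    have "w \<bullet> (t *\<^sub>R g) = w \<bullet> \<Delta> - w \<bullet> (\<Delta> - t *\<^sub>R g)" by (simp add: inner_diff_right)
    then have "\<bar>t\<bar> * \<bar>w \<bullet> g\<bar> \<le> \<bar>w \<bullet> \<Delta>\<bar> + \<bar>w \<bullet> (\<Delta> - t *\<^sub>R g)\<bar>"
      by (simp add: abs_mult[symmetric])
    also have "\<bar>w \<bullet> (\<Delta> - t *\<^sub>R g)\<bar> \<le> norm w * (e * \<bar>t\<bar>)"
      using Cauchy_Schwarz_ineq2[of w "\<Delta> - t *\<^sub>R g"] mult_left_mono[OF G norm_ge_zero[of w]] by linarith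
    also have "\<bar>w \<bullet> \<Delta>\<bar> \<le> e * (norm w * (2 / m)) * (\<bar>t\<bar> * (norm g + 1))"
      using w\<Delta> mult_left_mono[OF \<Delta>t, of "e * (norm w * (2 / m))"] e(1) m(1) by simp
    finally have "\<bar>t\<bar> * \<bar>w \<bullet> g\<bar> \<le> \<bar>t\<bar> * (e * (norm w * (2 / m) * (norm g + 1) + norm w))"
      by (simp add: algebra_simps)
    then show ?thesis using t(3) by simp
  qed
  define C where "C = norm w * (2 / m) * (norm g + 1) + norm w"
  have C: "0 \<le> C" using m(1) by (simp add: C_def)
  have "\<bar>w \<bullet> g\<bar> \<le> 0"
  proof (rule field_le_epsilon)
    fix e' :: real assume e': "0 < e'"
    define e where "e = min (e' / (C + 1)) (min (1 / 2) (m / 4))"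
    have "0 < e" using e' C m(1) by (simp add: e_def)
    moreover have "e \<le> min (1 / 2) (m / 4)" unfolding e_def by (rule min.cobounded2)
    ultimately have e: "0 < e" "e < 1" "e < m / 2" using m(1) by auto
    have "\<bar>w \<bullet> g\<bar> \<le> e * C" unfolding C_def by (rule bound[OF e])
    also have "\<dots> \<le> e' / (C + 1) * C" using C by (intro mult_right_mono) (auto simp: e_def)
    also have "\<dots> \<le> e'" using C e' by (simp add: field_simps)
    finally show "\<bar>w \<bullet> g\<bar> \<le> 0 + e'" by simp
  qed
  then show ?thesis by simp
qed

lemma tangent_space_orthogonal:
  assumes x: "x \<in> U" and w: "\<And>v. w \<bullet> frechet_derivative \<phi> (at x) v = 0"
    and g: "g \<in> tangent_space M (\<phi> x)"
  shows "w \<bullet> g = 0"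
proof -
  obtain \<gamma> e where \<gamma>: "g = vector_derivative \<gamma> (at 0)" "0 < e" "smooth_on {-e<..<e} \<gamma>"
    "\<gamma> ` {-e<..<e} \<subseteq> M" "\<gamma> 0 = \<phi> x"
    using g unfolding tangent_space_def by blast
  show ?thesis
  proof (rule curve_velocity_orthogonal[OF x w])
    show "(\<gamma> has_vector_derivative g) (at 0)" unfolding \<gamma>(1)
      by (rule smooth_on_vector_derivative[OF \<gamma>(3)]) (use \<gamma>(2) in simp)
    show "\<gamma> 0 = \<phi> x" by (rule \<gamma>(5))
    have "\<forall>\<^sub>F t in at 0. t \<in> {-e<..<e}"
      by (rule eventually_at_in_open') (use \<gamma>(2) in auto)
    then show "\<forall>\<^sub>F t in at 0. \<gamma> t \<in> M" by (rule eventually_mono) (use \<gamma>(4) in blast)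
  qed
qed

end

text \<open>A surface inside a sphere is open in it, which is invariance of domain for maps from the plane to the sphere.\<close>

lemma openin_sphere_of_surface:
  assumes M: "surface M" "M \<subseteq> sphere c r" and r: "0 < r"
  shows "openin (top_of_set (sphere c r)) M"
proof (subst openin_subopen, intro ballI)
  fix p assume p: "p \<in> M"
  obtain V U \<phi> \<psi> x where ch: "chart M V U \<phi> \<psi>" and x: "x \<in> U" "\<phi> x = p"
    by (rule surface_chart[OF M(1) p])
  \<comment> \<open>The open cone over \<open>V\<close> with vertex \<open>c\<close> is parametrized injectively by an open set of dimension three.\<close>
  define F where "F = (\<lambda>(x, t). c + t *\<^sub>R (\<phi> x - c))"
  have sph: "norm (\<phi> y - c) = r" if "y \<in> U" for y
    using chart_mem(2)[OF ch that] M(2) by (auto simp: dist_norm norm_minus_commute)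
  have "continuous_on (U \<times> {0<..}) F" unfolding F_def split_beta
    by (intro continuous_intros continuous_on_compose2[OF smooth_on_imp_continuous_on[OF chartD(3)[OF ch]]]) auto
  moreover have "inj_on F (U \<times> {0<..})"
  proof (rule inj_onI)
    fix a b assume ab: "a \<in> U \<times> {0<..}" "b \<in> U \<times> {0<..}" and eq: "F a = F b"
    obtain y t z t' where yz: "a = (y, t)" "b = (z, t')" "y \<in> U" "z \<in> U" "0 < t" "0 < t'"
      using ab by auto
    have e: "t *\<^sub>R (\<phi> y - c) = t' *\<^sub>R (\<phi> z - c)" using eq by (simp add: F_def yz)
    have "t * r = t' * r"
      using arg_cong[OF e, of norm] sph yz by simp
    then have tt: "t = t'" using r by simp
    then have "\<phi> y = \<phi> z" using e yz by simp
    then have "y = z" using chart_mem(4)[OF ch] yz by metis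
    then show "a = b" using tt yz by simp
  qed
  moreover have "open (U \<times> {0::real<..})" using chartD(2)[OF ch] by (intro open_Times) auto
  ultimately have "open (F ` (U \<times> {0<..}))"
    by (intro invariance_of_domain_gen) auto
  moreover have "V = sphere c r \<inter> F ` (U \<times> {0<..})"
  proof
    show "V \<subseteq> sphere c r \<inter> F ` (U \<times> {0<..})"
    proof
      fix q assume q: "q \<in> V"
      have "q \<in> M" using chart_mem(2)[OF ch chart_mem(3)[OF ch q]] chart_mem(5)[OF ch q] by simp
      then have "q \<in> sphere c r" using M(2) by blast
      moreover have "F (\<psi> q, 1) = q" using chart_mem(5)[OF ch q] by (simp add: F_def)
      then have "q \<in> F ` (U \<times> {0<..})" using chart_mem(3)[OF ch q]
        by (metis SigmaI greaterThan_iff imageI zero_less_one)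
      ultimately show "q \<in> sphere c r \<inter> F ` (U \<times> {0<..})" by blast
    qed
    show "sphere c r \<inter> F ` (U \<times> {0<..}) \<subseteq> V"
    proof
      fix q assume q: "q \<in> sphere c r \<inter> F ` (U \<times> {0<..})"
      then obtain y t where yt: "y \<in> U" "0 < t" "q = c + t *\<^sub>R (\<phi> y - c)" by (auto simp: F_def)
      have "norm (q - c) = r" using q by (auto simp: dist_norm norm_minus_commute)
      then have "t * r = r" using yt sph[OF yt(1)] by simp
      then have "q = \<phi> y" using yt(3) r by simp
      then show "q \<in> V" using chart_mem(1)[OF ch yt(1)] by simp
    qed
  qed
  ultimately have "openin (top_of_set (sphere c r)) V" by (metis openin_open_Int)
  moreover have "p \<in> V" using chart_mem(1)[OF ch x(1)] x(2) by simp
  moreover have "V \<subseteq> M" using openin_subset[OF chartD(1)[OF ch]] by auto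
  ultimately show "\<exists>T. openin (top_of_set (sphere c r)) T \<and> p \<in> T \<and> T \<subseteq> M" by blast
qed

section \<open>Surfaces with constant support function\<close>

text \<open>The unit normal in a chart is a rational expression in \<open>\<phi>\<close> and its first derivatives, which makes
  its smoothness evident.\<close>

definition supported_normal :: "real^3 \<Rightarrow> real \<Rightarrow> (real \<times> real \<Rightarrow> real^3) \<Rightarrow> real \<times> real \<Rightarrow> real^3" where
  "supported_normal c r \<phi> x = (r * inverse (chart_normal \<phi> x \<bullet> (\<phi> x - c))) *\<^sub>R chart_normal \<phi> x"

lemma supported_normal_unique:
  assumes ch: "chart M V U \<phi> \<psi>" and x: "x \<in> U" and r: "0 < r"
    and w: "\<And>v. w \<bullet> frechet_derivative \<phi> (at x) v = 0" "w \<bullet> (\<phi> x - c) = r"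
  shows "w = supported_normal c r \<phi> x" "chart_normal \<phi> x \<bullet> (\<phi> x - c) \<noteq> 0"
proof -
  obtain k where k: "w = k *\<^sub>R chart_normal \<phi> x"
    using orthogonal_imp_parallel_chart_normal[OF ch x w(1)] by blast
  then have kr: "k * (chart_normal \<phi> x \<bullet> (\<phi> x - c)) = r" using w(2) by simp
  then show nz: "chart_normal \<phi> x \<bullet> (\<phi> x - c) \<noteq> 0" using r by auto
  then have "k = r * inverse (chart_normal \<phi> x \<bullet> (\<phi> x - c))" using kr by (simp add: field_simps)
  then show "w = supported_normal c r \<phi> x" using k by (simp add: supported_normal_def)
qed

lemma smooth_supported_normal:
  assumes ch: "chart M V U \<phi> \<psi>" and nz: "\<And>x. x \<in> U \<Longrightarrow> chart_normal \<phi> x \<bullet> (\<phi> x - c) \<noteq> 0"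
  shows "smooth_on U (supported_normal c r \<phi>)"
proof -
  note U = chartD(2)[OF ch]
  have sc: "smooth_on U (\<lambda>x. \<phi> x - c)"
    by (rule smooth_on_diff[OF U chartD(3)[OF ch] smooth_on_const[OF U]])
  have "smooth_on U (\<lambda>x. (r * inverse (chart_normal \<phi> x \<bullet> (\<phi> x - c))) *\<^sub>R chart_normal \<phi> x)"
    by (rule smooth_on_scaleR[OF U smooth_on_linear[OF bounded_linear_mult_right U
            smooth_on_inverse[OF U smooth_on_inner[OF U chart_normal_smooth[OF ch] sc] nz]]
          chart_normal_smooth[OF ch]])
  then show ?thesis by (simp add: supported_normal_def[abs_def])
qed

context
  fixes M :: "(real^3) set" and N :: "real^3 \<Rightarrow> real^3" and c :: "real^3" and r :: real
  assumes M: "surface M" and N: "unit_normal_field M N"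
    and supp: "\<And>p. p \<in> M \<Longrightarrow> N p \<bullet> (p - c) = r" and r: "0 < r"
begin

lemma N_eq_supported_normal:
  assumes ch: "chart M V U \<phi> \<psi>" and x: "x \<in> U"
  shows "N (\<phi> x) = supported_normal c r \<phi> x" "chart_normal \<phi> x \<bullet> (\<phi> x - c) \<noteq> 0"
proof -
  have p: "\<phi> x \<in> M" by (rule chart_mem(2)[OF ch x])
  have "N (\<phi> x) \<bullet> frechet_derivative \<phi> (at x) v = 0" for v
    using N chart_velocity_tangent[OF ch x] p unfolding unit_normal_field_def by blast
  note * = supported_normal_unique[OF ch x r this supp[OF p]]
  show "N (\<phi> x) = supported_normal c r \<phi> x" "chart_normal \<phi> x \<bullet> (\<phi> x - c) \<noteq> 0" by (rule *)+
qed

lemma chart_constant_support_patch: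
  assumes ch: "chart M V U \<phi> \<psi>"
  shows "constant_support_patch U \<phi> (supported_normal c r \<phi>) c r"
proof
  show "open U" "smooth_on U \<phi>" by (rule chartD[OF ch])+
  show "smooth_on U (supported_normal c r \<phi>)"
    by (rule smooth_supported_normal[OF ch N_eq_supported_normal(2)[OF ch]])
  show "inj (frechet_derivative \<phi> (at x))" if "x \<in> U" for x by (rule chartD(5)[OF ch that])
  show "inj_on \<phi> U" by (rule inj_on_inverseI) (rule chart_mem(4)[OF ch])
  fix x v assume x: "x \<in> U"
  have p: "\<phi> x \<in> M" by (rule chart_mem(2)[OF ch x])
  note eq = N_eq_supported_normal(1)[OF ch x, symmetric]
  show "norm (supported_normal c r \<phi> x) = 1"
    using N p unfolding eq unit_normal_field_def by blast
  show "supported_normal c r \<phi> x \<bullet> frechet_derivative \<phi> (at x) v = 0"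
    using N p chart_velocity_tangent[OF ch x] unfolding eq unit_normal_field_def by blast
  show "supported_normal c r \<phi> x \<bullet> (\<phi> x - c) = r" using supp[OF p] unfolding eq .
qed (rule r)

text \<open>The interior of the set \<open>\<tau> = 0\<close>.\<close>

definition spherical_points :: "(real^3) set" where
  "spherical_points = {p\<in>M. \<exists>T. openin (top_of_set M) T \<and> p \<in> T \<and> T \<subseteq> sphere c r}"

text \<open>Where \<open>\<tau> \<noteq> 0\<close>, the derivative of the normal has a kernel. If it has none at \<open>x\<close>, the same
  holds near \<open>x\<close>, so \<open>\<tau>\<close> vanishes near \<open>x\<close>.\<close>

lemma spherical_if_normal_immersive:
  assumes ch: "chart M V U \<phi> \<psi>" and x: "x \<in> U"
    and nz: "cross3 (frechet_derivative (supported_normal c r \<phi>) (at x) (1, 0))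
      (frechet_derivative (supported_normal c r \<phi>) (at x) (0, 1)) \<noteq> 0"
  obtains W where "open W" "x \<in> W" "W \<subseteq> U" "\<phi> ` W \<subseteq> spherical_points"
proof -
  interpret constant_support_patch U \<phi> "supported_normal c r \<phi>" c r
    by (rule chart_constant_support_patch[OF ch])
  define K where "K x = cross3 (Dn x (1, 0)) (Dn x (0, 1))" for x
  have "continuous_on U K" unfolding K_def
    by (intro continuous_on_cross smooth_on_imp_continuous_on smooth_on_frechet_derivative smooth_n)
  then have W: "open (U \<inter> K -` (- {0}))"
    by (rule continuous_open_preimage[OF _ open_U]) (simp add: open_Compl)
  let ?W = "U \<inter> K -` (- {0})"
  have sph: "\<phi> y \<in> sphere c r" if y: "y \<in> ?W" for y
  proof -
    have yU: "y \<in> U" "K y \<noteq> 0" using y by auto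
    have "\<tau> y = 0"
    proof (rule ccontr)
      assume "\<tau> y \<noteq> 0"
      then obtain a where "a \<noteq> 0" "Dn y a = 0"
        using tangential_position_is_asymptotic[OF yU(1)] by metis
      then show False using kernel_iff_cross3_eq_0[OF linear_Dn[OF yU(1)]] yU(2) unfolding K_def by blast
    qed
    then have "\<phi> y - c = r *\<^sub>R supported_normal c r \<phi> y" by (simp add: \<tau>_def)
    then have "norm (\<phi> y - c) = r" using unit_n[OF yU(1)] r by simp
    then show ?thesis by (simp add: dist_norm norm_minus_commute)
  qed
  have "openin (top_of_set M) (\<phi> ` ?W)" by (rule chart_open_image[OF ch W]) simp
  moreover have "\<phi> ` ?W \<subseteq> sphere c r" using sph by blast
  ultimately have "\<phi> ` ?W \<subseteq> spherical_points"
    using chart_mem(2)[OF ch] unfolding spherical_points_def by blast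
  then show ?thesis using W x nz by (intro that[of ?W]) (auto simp: K_def)
qed

text \<open>On a spherical piece \<open>n = (\<phi> - c) / r\<close>, so \<open>Dn\<close> is as far from degenerate as \<open>D\<phi>\<close>; this persists in the limit.\<close>

lemma not_spherical_if_normal_degenerate:
  assumes ch: "chart M V U \<phi> \<psi>" and x: "x \<in> U"
    and z: "cross3 (frechet_derivative (supported_normal c r \<phi>) (at x) (1, 0))
      (frechet_derivative (supported_normal c r \<phi>) (at x) (0, 1)) = 0"
  obtains W where "open W" "x \<in> W" "W \<subseteq> U" "\<phi> ` W \<inter> spherical_points = {}"
proof -
  interpret constant_support_patch U \<phi> "supported_normal c r \<phi>" c r
    by (rule chart_constant_support_patch[OF ch])
  \<comment> \<open>\<open>K\<close> vanishes on spherical pieces.\<close>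
  define K where "K x = (r * r) *\<^sub>R cross3 (Dn x (1, 0)) (Dn x (0, 1)) - chart_normal \<phi> x" for x
  have "continuous_on U K" unfolding K_def
    by (intro continuous_intros continuous_on_cross smooth_on_imp_continuous_on
        smooth_on_frechet_derivative smooth_n chart_normal_smooth[OF ch])
  then have W: "open (U \<inter> K -` (- {0}))"
    by (rule continuous_open_preimage[OF _ open_U]) (simp add: open_Compl)
  let ?W = "U \<inter> K -` (- {0})"
  have "\<phi> y \<notin> spherical_points" if y: "y \<in> ?W" for y
  proof
    assume "\<phi> y \<in> spherical_points"
    then obtain T where T: "openin (top_of_set M) T" "\<phi> y \<in> T" "T \<subseteq> sphere c r"
      by (auto simp: spherical_points_def)
    have yU: "y \<in> U" "K y \<noteq> 0" using y by auto
    obtain Ov where Ov: "open Ov" "T = M \<inter> Ov" using T(1) by (auto simp: openin_open)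
    define B where "B = U \<inter> \<phi> -` Ov"
    have B: "open B" unfolding B_def
      by (rule continuous_open_preimage[OF smooth_on_imp_continuous_on[OF smooth_\<phi>] open_U Ov(1)])
    have yB: "y \<in> B" using yU(1) T(2) Ov(2) by (simp add: B_def)
    have "\<phi> z - c = r *\<^sub>R supported_normal c r \<phi> z" if z: "z \<in> B" for z
    proof -
      have zU: "z \<in> U" "\<phi> z \<in> T" using z Ov(2) chart_mem(2)[OF ch] by (auto simp: B_def)
      then have "norm (\<phi> z - c) = r" using T(3) by (auto simp: dist_norm norm_minus_commute)
      then have "(\<phi> z - c) \<bullet> (\<phi> z - c) = r * r" by (simp add: dot_square_norm power2_eq_square)
      moreover have "(\<phi> z - c) \<bullet> supported_normal c r \<phi> z = r" using support[OF zU(1)] by (simp add: inner_commute)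
      ultimately have "\<tau> z \<bullet> \<tau> z = 0"
        using n_n[OF zU(1)] support[OF zU(1)]
        by (simp add: \<tau>_def inner_diff_left[of "\<phi> z - c"] inner_diff_right[of _ "\<phi> z - c"])
      then show ?thesis by (simp add: \<tau>_def)
    qed
    moreover have "((\<lambda>z. r *\<^sub>R supported_normal c r \<phi> z) has_derivative (\<lambda>v. r *\<^sub>R Dn y v)) (at y)"
      by (rule has_derivative_scaleR_right[OF has_derivative_n[OF yU(1)]])
    ultimately have "((\<lambda>z. \<phi> z - c) has_derivative (\<lambda>v. r *\<^sub>R Dn y v)) (at y)"
      using has_derivative_transform_within_open[OF _ B yB] by (metis (no_types, lifting))
    from has_derivative_unique[OF has_derivative_\<phi>c[OF yU(1)] this]
    have "K y = 0" by (simp add: K_def chart_normal_def cross_mult_left cross_mult_right)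
    then show False using yU(2) by simp
  qed
  moreover have "K x \<noteq> 0" using z chart_normal_nonzero[OF ch x] by (simp add: K_def)
  ultimately show ?thesis using W x by (intro that[of ?W]) auto
qed

text \<open>At each point of \<open>M\<close>, one of the two preceding lemmas provides a neighbourhood inside or outside the
  set.\<close>

lemma spherical_points_clopen: "spherical_points = {} \<or> spherical_points = M"
proof -
  have op: "openin (top_of_set M) spherical_points"
  proof (subst openin_subopen, intro ballI)
    fix p assume "p \<in> spherical_points"
    then obtain T where T: "openin (top_of_set M) T" "p \<in> T" "T \<subseteq> sphere c r"
      by (auto simp: spherical_points_def)
    then have "T \<subseteq> spherical_points" using openin_subset[OF T(1)] by (auto simp: spherical_points_def)
    then show "\<exists>T. openin (top_of_set M) T \<and> p \<in> T \<and> T \<subseteq> spherical_points" using T by blast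
  qed
  have "openin (top_of_set M) (M - spherical_points)"
  proof (subst openin_subopen, intro ballI)
    fix p assume p: "p \<in> M - spherical_points"
    obtain V U \<phi> \<psi> x where ch: "chart M V U \<phi> \<psi>" and x: "x \<in> U" "\<phi> x = p"
      by (rule surface_chart[OF M, of p]) (use p in blast)+
    have z: "cross3 (frechet_derivative (supported_normal c r \<phi>) (at x) (1, 0))
      (frechet_derivative (supported_normal c r \<phi>) (at x) (0, 1)) = 0"
    proof (rule ccontr)
      assume nz: "\<not> ?thesis"
      show False
        by (rule spherical_if_normal_immersive[OF ch x(1) nz]) (use p x(2) in blast)
    qed
    show "\<exists>T. openin (top_of_set M) T \<and> p \<in> T \<and> T \<subseteq> M - spherical_points"
    proof (rule not_spherical_if_normal_degenerate[OF ch x(1) z])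
      fix W assume W: "open W" "x \<in> W" "W \<subseteq> U" "\<phi> ` W \<inter> spherical_points = {}"
      have "openin (top_of_set M) (\<phi> ` W)" by (rule chart_open_image[OF ch W(1,3)])
      moreover have "\<phi> ` W \<subseteq> M" using chart_mem(2)[OF ch] W(3) by blast
      ultimately show ?thesis using W x(2) by blast
    qed
  qed
  then have "closedin (top_of_set M) spherical_points"
    using openin_subset[OF op] by (simp add: closedin_def)
  moreover have "connected M" using M by (simp add: surface_def)
  ultimately show ?thesis using op unfolding connected_clopen by blast
qed

theorem locally_normal_or_parallel_surface:
  assumes not_sphere: "\<not> openin (top_of_set (sphere c r)) M" and p: "p \<in> M"
  shows "\<exists>V. openin (top_of_set M) V \<and> p \<in> V \<and>
      (normal_surface_to_spherical_curve c r V \<or> parallel_to_conical_surface c r V)"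
proof -
  have "spherical_points \<noteq> M"
  proof
    assume "spherical_points = M"
    then have "M \<subseteq> sphere c r" by (auto simp: spherical_points_def)
    then show False using openin_sphere_of_surface[OF M _ r] not_sphere by blast
  qed
  then have empty: "spherical_points = {}" using spherical_points_clopen by blast
  obtain V U \<phi> \<psi> x where ch: "chart M V U \<phi> \<psi>" and x: "x \<in> U" "\<phi> x = p"
    by (rule surface_chart[OF M p])
  interpret constant_support_patch U \<phi> "supported_normal c r \<phi>" c r
    by (rule chart_constant_support_patch[OF ch])
  have rank: "\<exists>a. a \<noteq> 0 \<and> Dn y a = 0" if y: "y \<in> U" for y
  proof (rule ccontr)
    assume "\<not> ?thesis"
    then have nz: "cross3 (Dn y (1, 0)) (Dn y (0, 1)) \<noteq> 0"
      using kernel_iff_cross3_eq_0[OF linear_Dn[OF y]] by blast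
    show False by (rule spherical_if_normal_immersive[OF ch y nz]) (use empty in blast)
  qed
  show ?thesis
  proof (rule locally_normal_or_parallel[OF rank x(1)])
    fix W assume W: "open W" "x \<in> W" "W \<subseteq> U"
      "normal_surface_to_spherical_curve c r (\<phi> ` W) \<or> parallel_to_conical_surface c r (\<phi> ` W)"
    have "openin (top_of_set M) (\<phi> ` W)" by (rule chart_open_image[OF ch W(1,3)])
    moreover have "p \<in> \<phi> ` W" using W(2) x(2) by blast
    ultimately show ?thesis using W(4) by blast
  qed
qed

end

section \<open>Normals of ruled surfaces with parallel normals along the rulings\<close>

text \<open>Both types of surfaces are of the form \<open>b(s) + z w(s)\<close> with \<open>b' = a t\<close> and \<open>w' = k t\<close> for a unit vector
  \<open>t\<close> orthogonal to \<open>w\<close>. The derivative \<open>(a + z k) t\<close> in \<open>s\<close> shows that \<open>t\<close> is tangent, except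
  for at most one \<open>z\<close> on each ruling, where the same follows by continuity of the normal.\<close>

lemma ruled_surface_normal:
  fixes b w :: "real \<Rightarrow> real^3"
  defines "X \<equiv> \<lambda>(s, z). b s + z *\<^sub>R w s"
  assumes ch: "chart M V U \<phi> \<psi>" and x: "x \<in> U" "\<phi> x = X (s, z)"
    and Q: "open Q" "X ` Q \<subseteq> M" "(s, z) \<in> Q"
    and b: "(b has_vector_derivative a *\<^sub>R t) (at s)" and w: "(w has_vector_derivative k *\<^sub>R t) (at s)"
    and ak: "a \<noteq> 0 \<or> k \<noteq> 0"
    and frame: "norm (w s) = 1" "norm t = 1" "w s \<bullet> t = 0"
  shows "\<exists>\<alpha>. chart_normal \<phi> x = \<alpha> *\<^sub>R cross3 (w s) t"
proof -
  have contX: "continuous (at z) (\<lambda>z. X (s, z))" unfolding X_def by (simp add: continuous_intros)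
  have oz: "open {z. (s, z) \<in> Q}"
  proof -
    have "open ((\<lambda>z. (s, z)) -` Q)" by (rule open_vimage[OF Q(1)]) (intro continuous_intros)
    then show ?thesis by (simp add: vimage_def)
  qed
  have along_ruling: "chart_normal \<phi> x \<bullet> w s = 0"
  proof (rule curve_velocity_orthogonal[OF ch x(1) chart_normal_orthogonal[OF ch x(1)]])
    let ?\<gamma> = "\<lambda>h. X (s, z + h)"
    show "(?\<gamma> has_vector_derivative w s) (at 0)"
      unfolding X_def by (auto intro!: derivative_eq_intros simp: has_vector_derivative_def algebra_simps)
    show "?\<gamma> 0 = \<phi> x" using x(2) by simp
    have "open ((\<lambda>h. (s, z + h)) -` Q)" by (rule open_vimage[OF Q(1)]) (intro continuous_intros)
    moreover have "0 \<in> (\<lambda>h. (s, z + h)) -` Q" using Q(3) by simp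
    ultimately have "\<forall>\<^sub>F h in at 0. h \<in> (\<lambda>h. (s, z + h)) -` Q" by (rule eventually_at_in_open')
    then show "\<forall>\<^sub>F h in at 0. ?\<gamma> h \<in> M" by (rule eventually_mono) (use Q(2) in blast)
  qed
  have regular: "chart_normal \<phi> y \<bullet> t = 0" if y: "y \<in> U" "\<phi> y = X (s, z')" "(s, z') \<in> Q" and reg: "a + z' * k \<noteq> 0" for y z'
  proof -
    have "chart_normal \<phi> y \<bullet> ((a + z' * k) *\<^sub>R t) = 0"
    proof (rule curve_velocity_orthogonal[OF ch y(1) chart_normal_orthogonal[OF ch y(1)]])
      let ?\<gamma> = "\<lambda>h. X (s + h, z')"
      have "((\<lambda>s. X (s, z')) has_vector_derivative (a + z' * k) *\<^sub>R t) (at s)"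
      proof -
        have "((\<lambda>s. b s + z' *\<^sub>R w s) has_vector_derivative a *\<^sub>R t + z' *\<^sub>R (k *\<^sub>R t)) (at s)"
          by (intro has_vector_derivative_add b
              bounded_linear.has_vector_derivative[OF bounded_linear_scaleR_right w])
        then show ?thesis by (simp add: X_def scaleR_add_left)
      qed
      then have d: "((\<lambda>s. X (s, z')) has_vector_derivative (a + z' * k) *\<^sub>R t) (at (s + 0))" by simp
      have "((\<lambda>h. s + h) has_vector_derivative 1) (at 0)"
        by (auto intro!: derivative_eq_intros simp: has_vector_derivative_def)
      from vector_diff_chain_at[OF this d]
      show "(?\<gamma> has_vector_derivative (a + z' * k) *\<^sub>R t) (at 0)" by (simp add: o_def)
      show "?\<gamma> 0 = \<phi> y" using y(2) by simp
      have "open ((\<lambda>h. (s + h, z')) -` Q)" by (rule open_vimage[OF Q(1)]) (intro continuous_intros)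
      moreover have "0 \<in> (\<lambda>h. (s + h, z')) -` Q" using y(3) by simp
      ultimately have "\<forall>\<^sub>F h in at 0. h \<in> (\<lambda>h. (s + h, z')) -` Q" by (rule eventually_at_in_open')
      then show "\<forall>\<^sub>F h in at 0. ?\<gamma> h \<in> M" by (rule eventually_mono) (use Q(2) in blast)
    qed
    then show ?thesis using reg by simp
  qed
  have "chart_normal \<phi> x \<bullet> t = 0"
  proof (cases "a + z * k = 0")
    case False
    then show ?thesis by (rule regular[OF x Q(3)])
  next
    case True
    then have k: "k \<noteq> 0" using ak by auto
    obtain Ov where Ov: "open Ov" "V = M \<inter> Ov" using chartD(1)[OF ch] by (auto simp: openin_open)
    have XV: "X (s, z) \<in> V" using chart_mem(1)[OF ch x(1)] x(2) by simp
    have limX: "((\<lambda>z. X (s, z)) \<longlongrightarrow> X (s, z)) (at z)" using contX by (simp add: continuous_at)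
    have evQ: "\<forall>\<^sub>F z' in at z. (s, z') \<in> Q"
      using eventually_at_in_open'[OF oz, of z] Q(3) by simp
    have "\<forall>\<^sub>F z' in at z. X (s, z') \<in> Ov"
      using topological_tendstoD[OF limX Ov(1)] XV Ov(2) by blast
    then have evV: "\<forall>\<^sub>F z' in at z. X (s, z') \<in> V"
      using evQ by eventually_elim (use Ov(2) Q(2) in blast)
    have "continuous_on V (\<lambda>q. chart_normal \<phi> (\<psi> q))"
    proof (rule continuous_on_compose2[of U])
      show "continuous_on U (chart_normal \<phi>)"
        by (rule smooth_on_imp_continuous_on[OF chart_normal_smooth[OF ch]])
      show "continuous_on V \<psi>" using chartD(4)[OF ch] by (simp add: homeomorphism_def)
      show "\<psi> ` V \<subseteq> U" using chart_mem(3)[OF ch] by blast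
    qed
    from continuous_on_tendsto_compose[OF continuous_on_inner[OF this continuous_on_const] limX XV evV]
    have lim: "((\<lambda>z'. chart_normal \<phi> (\<psi> (X (s, z'))) \<bullet> t) \<longlongrightarrow> chart_normal \<phi> x \<bullet> t) (at z)"
      using chart_mem(4)[OF ch x(1)] x(2) by simp
    have "\<forall>\<^sub>F z' in at z. z' \<noteq> z" by (simp add: eventually_at_filter)
    then have "\<forall>\<^sub>F z' in at z. chart_normal \<phi> (\<psi> (X (s, z'))) \<bullet> t = 0"
      using evQ evV
    proof eventually_elim
      case (elim z')
      have "a + z' * k \<noteq> 0"
      proof
        assume "a + z' * k = 0"
        then have "(z' - z) * k = 0" using True unfolding left_diff_distrib by linarith
        then show False using elim(1) k by simp
      qed
      then show ?case
        using regular[of "\<psi> (X (s, z'))" z'] chart_mem(3)[OF ch elim(3)] chart_mem(5)[OF ch elim(3)] elim(2)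
        by blast
    qed
    then have "((\<lambda>z'. chart_normal \<phi> (\<psi> (X (s, z'))) \<bullet> t) \<longlongrightarrow> 0) (at z)"
      by (rule tendsto_eventually)
    then show ?thesis using tendsto_unique[OF at_neq_bot lim] by blast
  qed
  then show ?thesis
    using frame_expansion[OF frame, of "chart_normal \<phi> x"] along_ruling by auto
qed

text \<open>For both types of surfaces, the distance of the tangent plane from \<open>c\<close> is \<open>r\<close>. For the normal surface
  the unit normal is the radius \<open>(\<delta> - c) / r\<close>, for the parallel surface it is the normal \<open>N\<^sub>\<beta>\<close> of the cone.\<close>

lemma normal_surface_support:
  assumes S: "normal_surface_to_spherical_curve c r S" "S \<subseteq> M"
    and ch: "chart M V U \<phi> \<psi>" and x: "x \<in> U" "\<phi> x \<in> S"
  shows "\<bar>chart_normal \<phi> x \<bullet> (\<phi> x - c)\<bar> = r * norm (chart_normal \<phi> x)"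
proof -
  obtain I \<delta> Q where \<delta>: "unit_speed_spherical_curve c r I \<delta>" and Q: "open Q" "Q \<subseteq> I \<times> UNIV"
    and S': "S = (\<lambda>(u, z). \<delta> u + z *\<^sub>R spherical_normal c r \<delta> u) ` Q"
    using S(1) unfolding normal_surface_to_spherical_curve_def by blast
  obtain s z where sz: "(s, z) \<in> Q" "\<phi> x = \<delta> s + z *\<^sub>R spherical_normal c r \<delta> s"
    using x(2) S' by auto
  have s: "s \<in> I" using sz(1) Q(2) by blast
  let ?e = "(1 / r) *\<^sub>R (\<delta> s - c)" and ?t = "vector_derivative \<delta> (at s)" and ?w = "spherical_normal c r \<delta> s"
  have r: "0 < r" by (rule spherical_curveD(1)[OF \<delta>])
  have e1: "norm ?e = 1" and t1: "norm ?t = 1" and et: "?e \<bullet> ?t = 0"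
    by (rule spherical_radius_unit[OF \<delta> s] spherical_curveD(6)[OF \<delta> s]
        spherical_radius_orthogonal_velocity[OF \<delta> s])+
  have w: "?w = cross3 ?e ?t" by (simp add: spherical_normal_def)
  have w1: "norm ?w = 1"
  proof -
    have "(norm ?w)\<^sup>2 = 1" using norm_cross_dot[of ?e ?t] unfolding w[symmetric] e1 t1 et by simp
    then show ?thesis unfolding power2_eq_1_iff using norm_ge_zero[of ?w] by linarith
  qed
  have wt: "?w \<bullet> ?t = 0" unfolding w by (rule dot_cross_self)
  have "cross3 ?t ?w = ?e" unfolding w Lagrange using t1 et by (simp add: norm_eq_1 inner_commute)
  then have wxt: "cross3 ?w ?t = - ?e" using cross_skew[of ?w ?t] by simp
  obtain k where k: "(spherical_normal c r \<delta> has_vector_derivative k *\<^sub>R ?t) (at s)"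
    by (rule spherical_normal_derivative[OF \<delta> s])
  have d: "(\<delta> has_vector_derivative 1 *\<^sub>R ?t) (at s)"
    using smooth_on_vector_derivative[OF spherical_curveD(4)[OF \<delta>] s] by simp
  have "\<exists>\<alpha>. chart_normal \<phi> x = \<alpha> *\<^sub>R cross3 ?w ?t"
    by (rule ruled_surface_normal[OF ch x(1) _ Q(1) _ sz(1) d k _ w1 t1 wt])
       (use sz(2) S' S(2) in auto)
  then obtain \<alpha> where \<alpha>: "chart_normal \<phi> x = (- \<alpha>) *\<^sub>R ?e" unfolding wxt by auto
  have "\<phi> x - c = r *\<^sub>R ?e + z *\<^sub>R ?w" using sz(2) r by (simp add: algebra_simps)
  then have "?e \<bullet> (\<phi> x - c) = r * (?e \<bullet> ?e) + z * (?e \<bullet> ?w)" by (simp only: inner_add_right inner_scaleR_right)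
  also have "\<dots> = r"
  proof -
    have "?e \<bullet> ?e = 1" using e1 unfolding norm_eq_1 .
    moreover have "?e \<bullet> ?w = 0" unfolding w by (rule dot_cross_self)
    ultimately show ?thesis by (simp only:)
  qed
  finally have "chart_normal \<phi> x \<bullet> (\<phi> x - c) = - \<alpha> * r" unfolding \<alpha> by (simp only: inner_scaleR_left)
  moreover have "norm (chart_normal \<phi> x) = \<bar>- \<alpha>\<bar> * norm ?e" unfolding \<alpha> by (rule norm_scaleR)
  then have "norm (chart_normal \<phi> x) = \<bar>\<alpha>\<bar>" unfolding e1 by simp
  ultimately show ?thesis using r by (simp add: abs_mult)
qed

lemma parallel_surface_support:
  assumes S: "parallel_to_conical_surface c r S" "S \<subseteq> M" and r: "0 < r"
    and ch: "chart M V U \<phi> \<psi>" and x: "x \<in> U" "\<phi> x \<in> S"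
  shows "\<bar>chart_normal \<phi> x \<bullet> (\<phi> x - c)\<bar> = r * norm (chart_normal \<phi> x)"
proof -
  obtain I \<beta> Q where \<beta>: "unit_speed_spherical_curve 0 1 I \<beta>" and Q: "open Q" "Q \<subseteq> I \<times> UNIV"
    and S': "S = (\<lambda>(s, z). c + z *\<^sub>R \<beta> s + r *\<^sub>R spherical_normal 0 1 \<beta> s) ` Q"
    using S(1) unfolding parallel_to_conical_surface_def by blast
  obtain s z where sz: "(s, z) \<in> Q" "\<phi> x = c + z *\<^sub>R \<beta> s + r *\<^sub>R spherical_normal 0 1 \<beta> s"
    using x(2) S' by auto
  have s: "s \<in> I" using sz(1) Q(2) by blast
  let ?t = "vector_derivative \<beta> (at s)" and ?m = "spherical_normal 0 1 \<beta> s"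
  have w1: "norm (\<beta> s) = 1" and t1: "norm ?t = 1" and wt: "\<beta> s \<bullet> ?t = 0"
    using spherical_radius_unit[OF \<beta> s] spherical_curveD(6)[OF \<beta> s]
      spherical_radius_orthogonal_velocity[OF \<beta> s] by simp_all
  have m: "?m = cross3 (\<beta> s) ?t" by (simp add: spherical_normal_def)
  have m1: "norm ?m = 1"
  proof -
    have "(norm ?m)\<^sup>2 = 1" using norm_cross_dot[of "\<beta> s" ?t] unfolding m[symmetric] w1 t1 wt by simp
    then show ?thesis unfolding power2_eq_1_iff using norm_ge_zero[of ?m] by linarith
  qed
  obtain k where k: "(spherical_normal 0 1 \<beta> has_vector_derivative k *\<^sub>R ?t) (at s)"
    by (rule spherical_normal_derivative[OF \<beta> s])
  define b where "b s = c + r *\<^sub>R spherical_normal 0 1 \<beta> s" for s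
  have "(b has_vector_derivative 0 + r *\<^sub>R (k *\<^sub>R ?t)) (at s)" unfolding b_def
    by (intro has_vector_derivative_add has_vector_derivative_const
        bounded_linear.has_vector_derivative[OF bounded_linear_scaleR_right k])
  then have b: "(b has_vector_derivative (r * k) *\<^sub>R ?t) (at s)" by simp
  have d: "(\<beta> has_vector_derivative 1 *\<^sub>R ?t) (at s)"
    using smooth_on_vector_derivative[OF spherical_curveD(4)[OF \<beta>] s] by simp
  have X: "(\<lambda>(s, z). b s + z *\<^sub>R \<beta> s) = (\<lambda>(s, z). c + z *\<^sub>R \<beta> s + r *\<^sub>R spherical_normal 0 1 \<beta> s)"
    by (auto simp: b_def algebra_simps)
  have "\<exists>\<alpha>. chart_normal \<phi> x = \<alpha> *\<^sub>R cross3 (\<beta> s) ?t"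
  proof (rule ruled_surface_normal[OF ch x(1) _ Q(1) _ sz(1) b d _ w1 t1 wt])
    show "\<phi> x = (\<lambda>(s, z). b s + z *\<^sub>R \<beta> s) (s, z)" unfolding X using sz(2) by simp
    show "(\<lambda>(s, z). b s + z *\<^sub>R \<beta> s) ` Q \<subseteq> M" unfolding X using S' S(2) by blast
  qed simp
  then obtain \<alpha> where \<alpha>: "chart_normal \<phi> x = \<alpha> *\<^sub>R ?m" unfolding m by blast
  have "\<phi> x - c = z *\<^sub>R \<beta> s + r *\<^sub>R ?m" using sz(2) by simp
  then have "?m \<bullet> (\<phi> x - c) = z * (?m \<bullet> \<beta> s) + r * (?m \<bullet> ?m)" by (simp add: inner_add_right)
  also have "\<dots> = r" using m1 dot_cross_self(3)[of ?t "\<beta> s"] dot_cross_self(1)[of "\<beta> s" ?t]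
    unfolding norm_eq_1 m[symmetric] by (simp add: inner_commute)
  finally have "chart_normal \<phi> x \<bullet> (\<phi> x - c) = \<alpha> * r" unfolding \<alpha> by simp
  moreover have "norm (chart_normal \<phi> x) = \<bar>\<alpha>\<bar>" unfolding \<alpha> using m1 by simp
  ultimately show ?thesis using r by (simp add: abs_mult)
qed

text \<open>Tangent planes at distance \<open>r\<close> from \<open>c\<close> are oriented by the condition that the support function be
  \<open>+r\<close>, which also makes the unit normal field continuous.\<close>

lemma unit_normal_field_with_constant_support:
  assumes M: "surface M" and r: "0 < r"
    and supp: "\<And>V U \<phi> \<psi> x. chart M V U \<phi> \<psi> \<Longrightarrow> x \<in> U \<Longrightarrow>
      \<bar>chart_normal \<phi> x \<bullet> (\<phi> x - c)\<bar> = r * norm (chart_normal \<phi> x)"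
  obtains N where "unit_normal_field M N" "\<And>p. p \<in> M \<Longrightarrow> N p \<bullet> (p - c) = r"
proof -
  define P where "P p w \<longleftrightarrow> norm w = 1 \<and> (\<forall>v\<in>tangent_space M p. w \<bullet> v = 0) \<and> w \<bullet> (p - c) = r" for p w
  define N where "N p = (SOME w. P p w)" for p
  have loc: "P (\<phi> x) (supported_normal c r \<phi> x)" "chart_normal \<phi> x \<bullet> (\<phi> x - c) \<noteq> 0"
    if ch: "chart M V U \<phi> \<psi>" and x: "x \<in> U" for V U \<phi> \<psi> x
  proof -
    let ?n = "chart_normal \<phi> x"
    have "norm ?n \<noteq> 0" using chart_normal_nonzero[OF ch x] by simp
    then have abs: "\<bar>?n \<bullet> (\<phi> x - c)\<bar> = r * norm ?n" and n0: "r * norm ?n \<noteq> 0"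
      using supp[OF ch x] r by simp_all
    then show nz: "?n \<bullet> (\<phi> x - c) \<noteq> 0" by auto
    have "norm (supported_normal c r \<phi> x) = r * inverse \<bar>?n \<bullet> (\<phi> x - c)\<bar> * norm ?n"
      unfolding supported_normal_def using r by (simp add: abs_mult)
    then have 1: "norm (supported_normal c r \<phi> x) = 1" unfolding abs using n0 by (simp add: field_simps)
    have "supported_normal c r \<phi> x \<bullet> frechet_derivative \<phi> (at x) v = 0" for v
      unfolding supported_normal_def by (simp add: chart_normal_orthogonal[OF ch x])
    then have 2: "\<forall>v\<in>tangent_space M (\<phi> x). supported_normal c r \<phi> x \<bullet> v = 0"
      using tangent_space_orthogonal[OF ch x] by blast
    have 3: "supported_normal c r \<phi> x \<bullet> (\<phi> x - c) = r"
      unfolding supported_normal_def using nz by simp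
    show "P (\<phi> x) (supported_normal c r \<phi> x)" using 1 2 3 by (simp add: P_def)
  qed
  have NP: "P (\<phi> x) (N (\<phi> x))" and Neq: "N (\<phi> x) = supported_normal c r \<phi> x"
    if ch: "chart M V U \<phi> \<psi>" and x: "x \<in> U" for V U \<phi> \<psi> x
  proof -
    show *: "P (\<phi> x) (N (\<phi> x))" unfolding N_def by (rule someI[of "P (\<phi> x)", OF loc(1)[OF ch x]])
    show "N (\<phi> x) = supported_normal c r \<phi> x"
    proof (rule supported_normal_unique(1)[OF ch x r])
      show "N (\<phi> x) \<bullet> frechet_derivative \<phi> (at x) v = 0" for v
        using * chart_velocity_tangent[OF ch x] unfolding P_def by blast
      show "N (\<phi> x) \<bullet> (\<phi> x - c) = r" using * by (simp add: P_def)
    qed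
  qed
  have PM: "P p (N p)" if "p \<in> M" for p
  proof (rule surface_chart[OF M that])
    fix V U \<phi> \<psi> x assume "chart M V U \<phi> \<psi>" "x \<in> U" "\<phi> x = p"
    then show ?thesis using NP by blast
  qed
  have "continuous (at p within M) N" if p: "p \<in> M" for p
  proof (rule surface_chart[OF M p])
    fix V U \<phi> \<psi> x assume ch: "chart M V U \<phi> \<psi>" and x: "x \<in> U" "\<phi> x = p"
    obtain Ov where Ov: "open Ov" "V = M \<inter> Ov" using chartD(1)[OF ch] by (auto simp: openin_open)
    have pV: "p \<in> V" using chart_mem(1)[OF ch x(1)] x(2) by simp
    have "continuous_on V (\<lambda>q. supported_normal c r \<phi> (\<psi> q))"
    proof (rule continuous_on_compose2[of U])
      show "continuous_on U (supported_normal c r \<phi>)"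
        by (rule smooth_on_imp_continuous_on[OF smooth_supported_normal[OF ch loc(2)[OF ch]]])
      show "continuous_on V \<psi>" using chartD(4)[OF ch] by (simp add: homeomorphism_def)
      show "\<psi> ` V \<subseteq> U" using chart_mem(3)[OF ch] by blast
    qed
    then have "continuous_on V N"
      by (rule continuous_on_eq) (metis Neq[OF ch] chart_mem(3,5)[OF ch])
    then have "continuous (at p within V) N" using pV continuous_on_eq_continuous_within by blast
    moreover have "at p within V = at p within M"
      by (rule at_within_nhd[of p Ov]) (use Ov pV in auto)
    ultimately show ?thesis by simp
  qed
  then have "continuous_on M N" by (simp add: continuous_on_eq_continuous_within)
  then show ?thesis using PM by (intro that[of N]) (auto simp: unit_normal_field_def P_def)
qed

section \<open>The characterization\<close>

theorem theorem3p7: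
  fixes M :: "(real^3) set"
  assumes "surface M"
  shows "proper_concircular_surface M \<longleftrightarrow>
    nontrivial_surface M \<and>
    (\<exists>c r. 0 < r \<and>
      (\<forall>p\<in>M. \<exists>V. openin (top_of_set M) V \<and> p \<in> V \<and>
        (normal_surface_to_spherical_curve c r V \<or> parallel_to_conical_surface c r V)))"
proof
  assume "proper_concircular_surface M"
  then obtain \<mu> v l where nt: "nontrivial_surface M" and l\<mu>: "l * \<mu> \<noteq> 0"
    and conc: "concircular_surface M (concircular_field \<mu> v) l"
    unfolding proper_concircular_surface_def by blast
  obtain N where N: "unit_normal_field M N" and NY: "\<And>p. p \<in> M \<Longrightarrow> N p \<bullet> (\<mu> *\<^sub>R p + v) = l"
    using conc unfolding concircular_surface_def concircular_field_def by blast
  \<comment> \<open>The zero of the axis is \<open>c\<close>; the orientation is chosen such that the support function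
    with respect to \<open>c\<close> is positive.\<close>
  define c where "c = (- 1 / \<mu>) *\<^sub>R v"
  define r where "r = \<bar>l / \<mu>\<bar>"
  define N' where "N' p = sgn (l / \<mu>) *\<^sub>R N p" for p
  have r: "0 < r" using l\<mu> by (simp add: r_def)
  have sgn: "sgn (l / \<mu>) = 1 \<or> sgn (l / \<mu>) = -1" using l\<mu> by (auto simp: sgn_if)
  then have N': "unit_normal_field M N'"
    using N unfolding unit_normal_field_def N'_def by (auto intro: continuous_intros)
  have supp: "N' p \<bullet> (p - c) = r" if p: "p \<in> M" for p
  proof -
    have "p - c = (1 / \<mu>) *\<^sub>R (\<mu> *\<^sub>R p + v)" using l\<mu> by (simp add: c_def scaleR_add_right)
    then have "N p \<bullet> (p - c) = l / \<mu>" using NY[OF p] by simp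
    then have "N' p \<bullet> (p - c) = sgn (l / \<mu>) * (l / \<mu>)" by (simp add: N'_def)
    then show ?thesis by (simp add: r_def sgn_mult_self_eq abs_sgn mult.commute)
  qed
  have "\<not> openin (top_of_set (sphere c r)) M" using nt r unfolding nontrivial_surface_def by blast
  then have "\<forall>p\<in>M. \<exists>V. openin (top_of_set M) V \<and> p \<in> V \<and>
        (normal_surface_to_spherical_curve c r V \<or> parallel_to_conical_surface c r V)"
    using locally_normal_or_parallel_surface[OF assms N' supp r] by blast
  then show "nontrivial_surface M \<and> (\<exists>c r. 0 < r \<and>
      (\<forall>p\<in>M. \<exists>V. openin (top_of_set M) V \<and> p \<in> V \<and>
        (normal_surface_to_spherical_curve c r V \<or> parallel_to_conical_surface c r V)))"
    using nt r by blast
next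
  assume "nontrivial_surface M \<and> (\<exists>c r. 0 < r \<and>
      (\<forall>p\<in>M. \<exists>V. openin (top_of_set M) V \<and> p \<in> V \<and>
        (normal_surface_to_spherical_curve c r V \<or> parallel_to_conical_surface c r V)))"
  then obtain c r where nt: "nontrivial_surface M" and r: "0 < r"
    and cover: "\<And>p. p \<in> M \<Longrightarrow> \<exists>V. openin (top_of_set M) V \<and> p \<in> V \<and>
        (normal_surface_to_spherical_curve c r V \<or> parallel_to_conical_surface c r V)"
    by blast
  have supp: "\<bar>chart_normal \<phi> x \<bullet> (\<phi> x - c)\<bar> = r * norm (chart_normal \<phi> x)"
    if ch: "chart M V U \<phi> \<psi>" and x: "x \<in> U" for V U \<phi> \<psi> x
  proof -
    obtain S where S: "openin (top_of_set M) S" "\<phi> x \<in> S"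
      "normal_surface_to_spherical_curve c r S \<or> parallel_to_conical_surface c r S"
      using cover[OF chart_mem(2)[OF ch x]] by blast
    have SM: "S \<subseteq> M" using openin_subset[OF S(1)] by simp
    show ?thesis
      using S(3) normal_surface_support[OF _ SM ch x S(2)] parallel_surface_support[OF _ SM r ch x S(2)]
      by blast
  qed
  show "proper_concircular_surface M"
  proof (rule unit_normal_field_with_constant_support[OF assms r supp])
    fix N assume N: "unit_normal_field M N" "\<And>p. p \<in> M \<Longrightarrow> N p \<bullet> (p - c) = r"
    have "concircular_surface M (concircular_field 1 (- c)) r"
      unfolding concircular_surface_def concircular_field_def using assms N by auto
    then show ?thesis unfolding proper_concircular_surface_def using nt r by force
  qed
qed

end
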